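(* Let $\mu,\nu\in\mathbb{C}$. Then for $x\in(0,1)$, $$P_\nu^{-\mu}(x)=\frac{\sqrt\pi}{2^{\mu-2\nu}}\sum_{n=0}^\infty\frac{(2\nu)_n(\mu-\nu)_n\,C_n^{1/2-\nu-n}(x)\,P_\nu^{-\frac{n+\mu+\nu}{2}}\left(\frac{1+x^2}{2x}\right)}{2^{2n}\left(\frac12+\nu\right)_n\Gamma\left(\frac{\mu-\nu+n+1}{2}\right)x^{-\nu}(1-x^2)^{\frac{n+\nu}{2}}},$$ $$\frac{\sqrt\pi\,P_\nu^{-\frac{\mu+\nu}{2}}\left(\frac{1+x^2}{2x}\right)}{2^{\mu-2\nu}x^{-\nu}\,\Gamma\left(\frac{\mu-\nu+1}{2}\right)}=\sum_{n=0}^\infty\frac{(-2\nu)_n(\mu-\nu)_n}{2^n\left(\frac12-\nu\right)_n}\,\frac{C_n^{1/2+\nu-n}(x)}{(1-x^2)^{\frac{n-\nu}{2}}}\,P_\nu^{-\mu-n}(x).$$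
   Context: $(a)_n=a(a+1)\cdots(a+n-1)$, $(a)_0=1$. $C_k^{\lambda}(x)=\sum_{j=0}^{[k/2]}\frac{(-1)^j(\lambda)_{k-j}}{j!\,(k-2j)!}(2x)^{k-2j}$ is the Gegenbauer polynomial ($[\cdot]$ is the integer part). For fixed $x$ the quantity $\frac{(2\tau)_n}{(\frac12+\tau)_n}C_n^{1/2-\tau-n}(x)$ is a polynomial in $\tau$ (it occurs here with $\tau=\nu$ and $\tau=-\nu$). For $\mu,\nu\in\mathbb{C}$ and real $x>-1$, $$P_\nu^{-\mu}(x)=\left|\frac{1-x}{1+x}\right|^{\mu/2}\frac{F\left(-\nu,\nu+1;1+\mu;\frac{1-x}{2}\right)}{\Gamma(1+\mu)},$$ where $F(a,b;c;t)$ is the Gauss hypergeometric function (analytically continued where needed; $F(a,b;c;t)/\Gamma(c)$ is entire in $a,b,c$). For $|x|<1$ this is the Ferrers function of the first kind, for $x>1$ the associated Legendre function of the first kind.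
   Formalization: The second identity is asserted only for Re ν > −1 or μ−ν ∈ {0,−1,−2,…}; for all other μ, ν its series diverges (e.g. μ=0, ν=−1, where the terms do not tend to 0), so the printed claim for all complex μ, ν fails. *)

theory Defs
  imports "HOL-Complex_Analysis.Complex_Analysis"
begin

definition gegenbauer :: "nat \<Rightarrow> complex \<Rightarrow> complex \<Rightarrow> complex" where
  "gegenbauer k l x =
     (\<Sum>j\<le>k div 2. (-1) ^ j * pochhammer l (k - j) / (fact j * fact (k - 2 * j)) * (2 * x) ^ (k - 2 * j))"

text \<open>
  The quotient (2t)_n / (1/2+t)_n * C_n^(1/2-t-n)(x) coincides with a polynomial in t wherever its
  denominator does not vanish; it is read as that polynomial, i.e. with the removable singularities
  at t = -1/2, -3/2, ... filled in.
\<close>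

definition gegenbauer_quot :: "nat \<Rightarrow> complex \<Rightarrow> complex \<Rightarrow> complex" where
  "gegenbauer_quot n t x =
     poly (THE p. \<forall>s. pochhammer (1/2 + s) n \<noteq> 0 \<longrightarrow>
             poly p s = pochhammer (2 * s) n / pochhammer (1/2 + s) n
                          * gegenbauer n (1/2 - s - of_nat n) x) t"

text \<open>
  The power series of F(a,b;c;z)/Gamma(c) in the unit disc. Since Gamma(c) (c)_n = Gamma(c+n), the
  coefficients are written with the entire function 1/Gamma, which also covers c = 0, -1, -2, ...
\<close>

definition hypergeo_reg_series :: "complex \<Rightarrow> complex \<Rightarrow> complex \<Rightarrow> complex \<Rightarrow> complex" where
  "hypergeo_reg_series a b c z =
     (\<Sum>n. pochhammer a n * pochhammer b n * rGamma (c + of_nat n) / fact n * z ^ n)"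

text \<open>
  The principal branch of F(a,b;c;z)/Gamma(c): the analytic continuation of the series along the
  segment from 0 to z, which avoids the cut [1,\<infinity>) for every z outside it. A segment
  along which f continues analytically has a convex open neighbourhood of the kind used here,
  and two such continuations agree at z because the intersection of the domains is convex.
\<close>

definition hypergeo_reg_cont ::
    "complex \<Rightarrow> complex \<Rightarrow> complex \<Rightarrow> complex \<Rightarrow> complex \<Rightarrow> bool" where
  "hypergeo_reg_cont a b c z w \<longleftrightarrow>
     (\<exists>S f. open S \<and> convex S \<and> 0 \<in> S \<and> z \<in> S \<and> f holomorphic_on S \<and>
            (\<forall>u\<in>S. norm u < 1 \<longrightarrow> f u = hypergeo_reg_series a b c u) \<and> w = f z)"

definition hypergeo_reg :: "complex \<Rightarrow> complex \<Rightarrow> complex \<Rightarrow> complex \<Rightarrow> complex" where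
  "hypergeo_reg a b c z = (THE w. hypergeo_reg_cont a b c z w)"

lemma hypergeo_reg_cont_unique:
  assumes "hypergeo_reg_cont a b c z v" "hypergeo_reg_cont a b c z w"
  shows "v = w"
proof -
  obtain S f where f: "open S" "convex S" "0 \<in> S" "z \<in> S" "f holomorphic_on S"
      "\<And>u. u \<in> S \<Longrightarrow> norm u < 1 \<Longrightarrow> f u = hypergeo_reg_series a b c u" "v = f z"
    using assms(1) unfolding hypergeo_reg_cont_def by blast
  obtain T g where g: "open T" "convex T" "0 \<in> T" "z \<in> T" "g holomorphic_on T"
      "\<And>u. u \<in> T \<Longrightarrow> norm u < 1 \<Longrightarrow> g u = hypergeo_reg_series a b c u" "w = g z"
    using assms(2) unfolding hypergeo_reg_cont_def by blast
  have "f z = g z"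
  proof (rule analytic_continuation_open[where f = f and g = g and s = "S \<inter> T \<inter> ball 0 1"
          and s' = "S \<inter> T"])
    show "S \<inter> T \<inter> ball 0 1 \<noteq> {}" using f(3) g(3) by auto
    show "connected (S \<inter> T)" using f(2) g(2) by (intro convex_connected convex_Int)
    show "f holomorphic_on S \<inter> T"
      using f(5) by (rule holomorphic_on_subset) auto
    show "g holomorphic_on S \<inter> T"
      using g(5) by (rule holomorphic_on_subset) auto
  qed (use f g in auto)
  then show ?thesis using f g by simp
qed

text \<open>
  legendre_P nu m x is P_nu^m(x) for real x > -1, with m the actual upper index: the Ferrers
  function of the first kind for |x| < 1, the associated Legendre function of the first kind
  for x > 1.
\<close>

definition legendre_P :: "complex \<Rightarrow> complex \<Rightarrow> real \<Rightarrow> complex" where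
  "legendre_P nu m x =
     complex_of_real \<bar>(1 - x) / (1 + x)\<bar> powr (- m / 2)
       * hypergeo_reg (- nu) (nu + 1) (1 - m) (of_real ((1 - x) / 2))"

end

theory Submission
  imports Defs "HOL-Probability.Characteristic_Functions" "HOL-Real_Asymp.Real_Asymp"
begin

text \<open>
  Put \<open>a = \<mu> - \<nu>\<close> and \<open>w = (1 - x) / (1 + x)\<close>. Every function in the two expansions is the integral of
  a simple function of \<open>u\<close> against one of the weights \<open>u^(a - 1) (1 - u)^\<nu>\<close> and
  \<open>u^(a - 1) (1 - u^2)^\<nu>\<close> on \<open>[0, 1]\<close>, up to elementary factors:

  \<^item> By Pfaff's transformation and Euler's integral, \<open>(a)_n P_\<nu>^(-\<mu>-n)(x)\<close> is the integral of
    \<open>u^n (1 + w u)^\<nu>\<close> against the first weight (\<open>legendre_P_ferrers\<close>).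
  \<^item> The point \<open>y = (1 + x^2) / (2 x)\<close> satisfies \<open>(1 - y) / (1 + y) = - w^2\<close>. The substitution of
    \<open>u^2\<close> for \<open>u\<close> and the duplication formula make the Legendre functions at \<open>y\<close> integrals of
    \<open>u^n (1 - w^2 u^2)^\<nu>\<close> against the second weight (\<open>legendre_P_even\<close>).
  \<^item> The Gegenbauer factor is \<open>(2 (1 + x))^n\<close> times the coefficient of \<open>u^n\<close> in
    \<open>((1 + u) (1 - w u))^(-t)\<close> (\<open>gegenbauer_quot_convolution\<close>).

  Now \<open>(1 - u^2)^\<nu> (1 - w^2 u^2)^\<nu>\<close> and \<open>(1 - u)^\<nu> (1 + w u)^\<nu>\<close> differ by exactly the factor
  \<open>((1 + u) (1 - w u))^\<nu>\<close>. Expanding its inverse in powers of \<open>u\<close> under the integral gives the first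
  formula; expanding the factor itself gives the second one.

  The integrals exist only for \<open>Re a > 0\<close> and \<open>Re \<nu> > -1\<close>, so the proof keeps only their moments, which
  are entire in the parameters once they are divided by \<open>\<Gamma>(a) \<Gamma>(1 + \<nu>)\<close>. That
  multiplication by \<open>(1 + u)^\<nu>\<close> or \<open>(1 + u)^(-\<nu>)\<close> exchanges the two weights becomes a
  pair of dual summation formulas, \<open>beta_moment_binomial_sums\<close> (Kummer's evaluation of \<open>F\<close> at \<open>-1\<close>) and
  \<open>even_moment_binomial_sums\<close>. Each is proved by recurrences in \<open>a\<close> and \<open>\<nu>\<close>, which come from total
  derivatives and hence telescope on the level of moments; the remaining constant is found by letting
  \<open>a\<close> tend to infinity.

  The lemma \<open>moment_series_rearrange\<close> combines these formulas with the factors that depend on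
  \<open>w u\<close>. Those have geometrically decaying coefficients, so the only delicate point is the factor \<open>(1 + u)^\<nu>\<close>.
  For \<open>-1 < Re \<nu> \<le> -1/2\<close> its series converges only conditionally, which is why the
  rearrangement asks for bounded partial sums instead of absolute convergence.
\<close>

section \<open>Growth of Pochhammer symbols and binomial coefficients\<close>

lemma powr_of_nat_mult:
  assumes "n > 0"
  shows "of_nat n powr (s + t) = of_nat n powr s * (of_nat n powr t :: complex)"
  using assms by (simp add: powr_add)

lemma powr_ratio_tendsto_1:
  fixes s :: complex
  shows "(\<lambda>n. of_nat n powr s / of_nat (n + j) powr s) \<longlonglongrightarrow> 1"
proof -
  have "(\<lambda>n. real n / real (n + j)) \<longlonglongrightarrow> 1"
    by real_asymp
  from tendsto_of_real[OF this, where ?'a = complex]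
  have lim: "(\<lambda>n. complex_of_real (real n / real (n + j))) \<longlonglongrightarrow> of_real 1" .
  have "(\<lambda>n. complex_of_real (real n / real (n + j)) powr s) \<longlonglongrightarrow> of_real 1 powr s"
    by (intro tendsto_powr_complex lim tendsto_const) auto
  moreover have "eventually (\<lambda>n. complex_of_real (real n / real (n + j)) powr s
        = of_nat n powr s / of_nat (n + j) powr s) sequentially"
    using eventually_gt_at_top[of 0]
  proof eventually_elim
    case (elim n)
    have "complex_of_real (real n / real (n + j)) powr s
        * complex_of_real (real (n + j)) powr s
        = complex_of_real (real n / real (n + j) * real (n + j)) powr s"
      unfolding of_real_mult
      by (rule powr_times_real[symmetric]) (use elim in \<open>auto simp del: of_nat_add\<close>)
    also have "real n / real (n + j) * real (n + j) = real n"
      using elim by (simp add: field_simps)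
    finally have "complex_of_real (real n / real (n + j)) powr s * of_nat (n + j) powr s = of_nat n powr s"
      by simp
    moreover have "complex_of_nat (n + j) \<noteq> 0"
      using elim unfolding of_nat_eq_0_iff by simp
    ultimately show ?case by (metis nonzero_eq_divide_eq powr_eq_0_iff)
  qed
  ultimately show ?thesis
    by (auto intro: Lim_transform_eventually)
qed

lemma norm_bound_of_LIMSEQ:
  fixes f :: "nat \<Rightarrow> complex"
  assumes "(\<lambda>n. f n * of_nat n powr s) \<longlonglongrightarrow> L"
  obtains K where "K > 0" "\<And>n. norm (f n) \<le> K * (1 + real n) powr (- Re s)"
proof -
  have "Bseq (\<lambda>n. f n * of_nat n powr s)"
    using assms by (intro convergent_imp_Bseq) (auto simp: convergent_def)
  then obtain K0 where K0: "K0 > 0" "\<And>n. norm (f n * of_nat n powr s) \<le> K0"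
    by (auto elim: BseqE)
  define K where "K = K0 * 2 powr \<bar>Re s\<bar> + norm (f 0)"
  have "norm (f n) \<le> K * (1 + real n) powr (- Re s)" for n
  proof (cases "n = 0")
    case True
    thus ?thesis using K0(1) by (simp add: K_def)
  next
    case False
    have "norm (f n) * real n powr Re s \<le> K0"
      using K0(2)[of n] False by (simp add: norm_mult norm_powr_real_powr)
    hence "norm (f n) \<le> K0 * real n powr (- Re s)"
      using False by (simp add: powr_minus field_simps)
    also have "real n powr (- Re s) \<le> 2 powr \<bar>Re s\<bar> * (1 + real n) powr (- Re s)"
    proof (cases "Re s \<ge> 0")
      case True
      have "(1 + real n) powr Re s \<le> (2 * real n) powr Re s"
        using False True by (intro powr_mono2) auto
      thus ?thesis using False True
        by (simp add: powr_minus powr_mult field_simps)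
    next
      case neg: False
      have "real n powr (- Re s) \<le> (1 + real n) powr (- Re s)"
        using False neg by (intro powr_mono2) auto
      also have "\<dots> \<le> 2 powr \<bar>Re s\<bar> * (1 + real n) powr (- Re s)"
        using ge_one_powr_ge_zero[of 2 "\<bar>Re s\<bar>"] by (simp add: mult_le_cancel_right1)
      finally show ?thesis .
    qed
    also have "K0 * (2 powr \<bar>Re s\<bar> * (1 + real n) powr (- Re s)) \<le> K * (1 + real n) powr (- Re s)"
      using K0(1) by (simp add: K_def algebra_simps)
    finally show ?thesis using K0(1) by (simp add: mult_left_mono)
  qed
  moreover have "K > 0"
    using K0(1) by (simp add: K_def add_pos_nonneg)
  ultimately show ?thesis using that by blast
qed

lemma gbinomial_LIMSEQ:
  fixes z :: complex
  shows "(\<lambda>n. (-1) ^ n * (z gchoose n) * of_nat n powr (z + 1)) \<longlonglongrightarrow> rGamma (- z)"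
proof -
  have "(\<lambda>n. (z gchoose n) / ((-1)^n / exp ((z+1) * of_real (ln (real n))))) \<longlonglongrightarrow> rGamma (- z)"
    using gbinomial_asymptotic[of z] by (simp add: rGamma_inverse_Gamma)
  moreover have "eventually (\<lambda>n. (z gchoose n) / ((-1)^n / exp ((z+1) * of_real (ln (real n))))
      = (-1) ^ n * (z gchoose n) * of_nat n powr (z + 1)) sequentially"
    using eventually_gt_at_top[of 0]
  proof eventually_elim
    case (elim n)
    have "complex_of_real (ln (real n)) = Ln (of_nat n)"
      using elim Ln_of_nat[of n] by simp
    moreover have "(z gchoose n) / (-1) ^ n = (-1) ^ n * (z gchoose n)"
      by (cases "even n") auto
    moreover have "(z gchoose n) / ((-1) ^ n / E) = (z gchoose n) / (-1) ^ n * E" for E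
      by simp
    ultimately show ?case using elim by (simp only: powr_def) simp
  qed
  ultimately show ?thesis by (auto intro: Lim_transform_eventually)
qed

lemma pochhammer_LIMSEQ:
  fixes z :: complex
  shows "(\<lambda>n. pochhammer z n / fact n * of_nat n powr (1 - z)) \<longlonglongrightarrow> rGamma z"
  using gbinomial_LIMSEQ[of "-z"]
  by (simp add: gbinomial_pochhammer mult.assoc[symmetric] power_mult_distrib[symmetric] add.commute)

text \<open>
  For \<open>z\<close> outside the poles of \<open>\<Gamma>\<close> this is the reciprocal of the limit for
  \<open>pochhammer z n\<close>. The functional equation lets \<open>z\<close> be replaced by \<open>z + 1\<close>, which leads away from the poles.
\<close>

lemma rGamma_shift_LIMSEQ:
  fixes z :: complex
  shows "(\<lambda>n. rGamma (z + of_nat n) * fact n * of_nat n powr (z - 1)) \<longlonglongrightarrow> 1"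
proof -
  have step: "(\<lambda>n. rGamma (z + of_nat n) * fact n * of_nat n powr (z - 1)) \<longlonglongrightarrow> 1"
    if "(\<lambda>n. rGamma (z + 1 + of_nat n) * fact n * of_nat n powr (z + 1 - 1)) \<longlonglongrightarrow> 1" for z :: complex
  proof -
    have "(\<lambda>n. z * inverse (of_nat n) + 1) \<longlonglongrightarrow> z * 0 + 1"
      by (intro tendsto_intros lim_inverse_n)
    from tendsto_mult[OF this that]
    have "(\<lambda>n. (z * inverse (of_nat n) + 1) *
        (rGamma (z + 1 + of_nat n) * fact n * of_nat n powr (z + 1 - 1))) \<longlonglongrightarrow> 1" by simp
    moreover have "eventually (\<lambda>n. (z * inverse (of_nat n) + 1) *
        (rGamma (z + 1 + of_nat n) * fact n * of_nat n powr (z + 1 - 1)) =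
        rGamma (z + of_nat n) * fact n * of_nat n powr (z - 1)) sequentially"
      using eventually_gt_at_top[of 0]
    proof eventually_elim
      case (elim n)
      have "rGamma (z + of_nat n) = (z + of_nat n) * rGamma (z + 1 + of_nat n)"
        using rGamma_plus1[of "z + of_nat n"] by (simp add: add_ac)
      moreover have "of_nat n powr z = of_nat n * of_nat n powr (z - 1)"
        using elim powr_add[of "of_nat n" 1 "z - 1"] by simp
      ultimately show ?case using elim by (simp add: field_simps)
    qed
    ultimately show ?thesis by (rule Lim_transform_eventually)
  qed
  have regular: "(\<lambda>n. rGamma (z + of_nat n) * fact n * of_nat n powr (z - 1)) \<longlonglongrightarrow> 1"
    if z: "z \<notin> \<int>\<^sub>\<le>\<^sub>0" for z :: complex
  proof -
    have nz: "rGamma z \<noteq> 0" using z by (simp add: rGamma_eq_zero_iff)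
    have "(\<lambda>n. rGamma z / (pochhammer z n / fact n * of_nat n powr (1 - z))) \<longlonglongrightarrow> rGamma z / rGamma z"
      by (intro tendsto_intros pochhammer_LIMSEQ nz)
    moreover have "rGamma z / (pochhammer z n / fact n * of_nat n powr (1 - z))
        = rGamma (z + of_nat n) * fact n * of_nat n powr (z - 1)" for n
    proof -
      have "pochhammer z n \<noteq> 0"
        using z pochhammer_eq_0_imp_nonpos_Int by blast
      thus ?thesis
        using powr_minus[of "of_nat n :: complex" "1 - z"]
        by (simp add: pochhammer_rGamma[of z n] field_simps)
    qed
    ultimately show ?thesis using nz by simp
  qed
  \<comment> \<open>Choose \<open>k\<close> so large that \<open>z + k\<close> lies in the right half plane, and descend from there.\<close>
  obtain k :: nat where k: "real k > - Re z"
    using reals_Archimedean2 by blast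
  have "z + of_nat k \<notin> \<int>\<^sub>\<le>\<^sub>0"
    using k by (auto elim!: nonpos_Ints_cases simp: complex_eq_iff)
  hence "(\<lambda>n. rGamma (z + of_nat k + of_nat n) * fact n * of_nat n powr (z + of_nat k - 1)) \<longlonglongrightarrow> 1"
    by (rule regular)
  thus ?thesis
  proof (induction k)
    case (Suc k)
    thus ?case using step[of "z + of_nat k"] by (simp add: add_ac)
  qed simp
qed

lemma pochhammer_rGamma_LIMSEQ:
  fixes a c :: complex
  shows "(\<lambda>n. pochhammer a n * rGamma (c + of_nat n) * of_nat n powr (c - a)) \<longlonglongrightarrow> rGamma a"
proof -
  have "(\<lambda>n. (pochhammer a n / fact n * of_nat n powr (1 - a))
      * (rGamma (c + of_nat n) * fact n * of_nat n powr (c - 1))) \<longlonglongrightarrow> rGamma a * 1"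
    by (intro tendsto_mult pochhammer_LIMSEQ rGamma_shift_LIMSEQ)
  moreover have "eventually (\<lambda>n. (pochhammer a n / fact n * of_nat n powr (1 - a))
      * (rGamma (c + of_nat n) * fact n * of_nat n powr (c - 1))
      = pochhammer a n * rGamma (c + of_nat n) * of_nat n powr (c - a)) sequentially"
    using eventually_gt_at_top[of 0]
  proof eventually_elim
    case (elim n)
    have "of_nat n powr (c - a) = of_nat n powr (1 - a) * (of_nat n powr (c - 1) :: complex)"
      using powr_of_nat_mult[OF elim, of "1 - a" "c - 1"] by simp
    thus ?case by simp
  qed
  ultimately show ?thesis by (auto intro: Lim_transform_eventually)
qed

section \<open>Moments of the two weights\<close>

text \<open>
  The moment of order \<open>m\<close> of \<open>u^(a - 1) (1 - u)^\<nu>\<close> on \<open>[0, 1]\<close>, divided by \<open>\<Gamma>(a) \<Gamma>(1 + \<nu>)\<close>.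
  The reciprocal Gamma function makes this entire in \<open>a\<close> and \<open>\<nu>\<close>.
\<close>

definition beta_moment :: "complex \<Rightarrow> complex \<Rightarrow> nat \<Rightarrow> complex" where
  "beta_moment \<nu> a m = pochhammer a m * rGamma (a + 1 + \<nu> + of_nat m)"

text \<open>
  The total mass of \<open>u^(a - 1) (1 - u^2)^\<nu>\<close> on \<open>[0, 1]\<close>, again divided by \<open>\<Gamma>(a) \<Gamma>(1 + \<nu>)\<close>. The
  quotient \<open>\<Gamma>(a/2) / (2 \<Gamma>(a))\<close> that the substitution of \<open>u^2\<close> produces is rewritten with the
  duplication formula, which removes its singularities.
\<close>

definition even_beta :: "complex \<Rightarrow> complex \<Rightarrow> complex" where
  "even_beta \<nu> a = of_real (sqrt pi) * 2 powr (- a) * rGamma ((a + 1) / 2) * rGamma (1 + \<nu> + a / 2)"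

definition even_moment :: "complex \<Rightarrow> complex \<Rightarrow> nat \<Rightarrow> complex" where
  "even_moment \<nu> a m = pochhammer a m * even_beta \<nu> (a + of_nat m)"

lemma beta_moment_add:
  "beta_moment \<nu> a (n + m) = pochhammer a n * beta_moment \<nu> (a + of_nat n) m"
  unfolding beta_moment_def pochhammer_product' by (simp add: add_ac)

lemma even_moment_add:
  "even_moment \<nu> a (n + m) = pochhammer a n * even_moment \<nu> (a + of_nat n) m"
  unfolding even_moment_def pochhammer_product' by (simp add: add_ac)

lemma even_beta_plus2: "even_beta \<nu> a = (a + 1) * (a + 2 + 2 * \<nu>) * even_beta \<nu> (a + 2)"
proof -
  have 1: "rGamma ((a + 1) / 2) = (a + 1) / 2 * rGamma ((a + 2 + 1) / 2)"
    using rGamma_plus1[of "(a + 1) / 2"] by (simp add: field_simps)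
  have 2: "rGamma (1 + \<nu> + a / 2) = (1 + \<nu> + a / 2) * rGamma (1 + \<nu> + (a + 2) / 2)"
    using rGamma_plus1[of "1 + \<nu> + a / 2"] by (simp add: field_simps)
  have 3: "2 powr (- a) = 4 * (2 powr (- (a + 2)) :: complex)"
    by (simp add: powr_diff powr_minus)
  show ?thesis
    unfolding even_beta_def 1 2 3 by (simp add: field_simps)
qed

lemma even_beta_raise: "even_beta \<nu> a = (1 + \<nu> + a / 2) * even_beta (\<nu> + 1) a"
  using rGamma_plus1[of "1 + \<nu> + a / 2"] by (simp add: even_beta_def add_ac)

lemma even_beta_0 [simp]: "even_beta \<nu> 0 = rGamma (1 + \<nu>)"
  by (simp add: even_beta_def rGamma_inverse_Gamma Gamma_one_half_complex del: of_real_sqrt)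

text \<open>
  Stated with reciprocals, Legendre's duplication formula survives at the poles, where both sides vanish.
\<close>

lemma rGamma_duplication:
  fixes z :: complex
  shows "of_real (sqrt pi) * 2 powr (- z) * rGamma ((z + 1) / 2) * rGamma (z / 2) = rGamma z / 2"
proof (cases "z \<in> \<int>\<^sub>\<le>\<^sub>0")
  case True
  then obtain k where k: "z = - of_nat k" by (auto elim: nonpos_Ints_cases')
  have "rGamma ((z + 1) / 2) * rGamma (z / 2) = 0"
  proof (cases "even k")
    case True
    then obtain l where "k = 2 * l" by blast
    hence "z / 2 = - of_nat l" using k by simp
    thus ?thesis by (simp add: rGamma_eq_zero_iff)
  next
    case False
    then obtain l where "k = 2 * l + 1" by (auto elim: oddE)
    hence "(z + 1) / 2 = - of_nat l" using k by simp
    thus ?thesis by (simp add: rGamma_eq_zero_iff)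
  qed
  moreover have "rGamma z = 0" using True by (simp add: rGamma_eq_zero_iff)
  ultimately show ?thesis by (simp add: mult.assoc)
next
  case False
  have 1: "z / 2 \<notin> \<int>\<^sub>\<le>\<^sub>0"
  proof
    assume "z / 2 \<in> \<int>\<^sub>\<le>\<^sub>0"
    then obtain k where "z / 2 = - of_nat k" by (auto elim: nonpos_Ints_cases')
    hence "z = - of_nat (2 * k)" by (simp add: field_simps)
    thus False using False by (metis minus_of_nat_in_nonpos_Ints)
  qed
  have 2: "z / 2 + 1 / 2 \<notin> \<int>\<^sub>\<le>\<^sub>0"
  proof
    assume "z / 2 + 1 / 2 \<in> \<int>\<^sub>\<le>\<^sub>0"
    then obtain k where "z / 2 + 1 / 2 = - of_nat k" by (auto elim: nonpos_Ints_cases')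
    hence "z = - of_nat (2 * k + 1)" by (simp add: field_simps eq_neg_iff_add_eq_0)
    thus False using False by (metis minus_of_nat_in_nonpos_Ints)
  qed
  have "Gamma (z / 2) * Gamma (z / 2 + 1 / 2) =
      exp ((1 - z) * of_real (ln 2)) * of_real (sqrt pi) * Gamma z"
    using Gamma_legendre_duplication[OF 1 2] by simp
  also have "exp ((1 - z) * of_real (ln 2)) = 2 * 2 powr (- z)"
  proof -
    have "Ln (2 :: complex) = of_real (ln 2)"
      by (simp add: Ln_Reals_eq)
    hence "2 powr (- z) = exp (- z * of_real (ln 2))"
      by (simp add: powr_def)
    moreover have "exp ((1 - z) * complex_of_real (ln 2)) = exp (of_real (ln 2)) * exp (- z * of_real (ln 2))"
      unfolding exp_add[symmetric] by (rule arg_cong[of _ _ exp]) (simp only: ring_distribs, simp)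
    moreover have "exp (complex_of_real (ln 2)) = 2"
      by (subst exp_of_real) simp
    ultimately show ?thesis by simp
  qed
  finally have *: "Gamma (z / 2) * Gamma (z / 2 + 1 / 2) = 2 * 2 powr (- z) * of_real (sqrt pi) * Gamma z" .
  have nz: "Gamma z \<noteq> 0" "Gamma (z / 2) \<noteq> 0" "Gamma (z / 2 + 1 / 2) \<noteq> 0"
    using False 1 2 by (simp_all add: Gamma_eq_zero_iff)
  have solve: "S * P * inverse E * inverse D = inverse C / 2"
    if "D * E = 2 * P * S * C" "C \<noteq> 0" "D \<noteq> 0" "E \<noteq> 0" for S P C D E :: complex
  proof -
    have "P \<noteq> 0" "S \<noteq> 0" using that by auto
    thus ?thesis using that by (simp add: field_simps)
  qed
  have half: "(z + 1) / 2 = z / 2 + 1 / 2" by (simp add: field_simps)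
  show ?thesis
    unfolding rGamma_inverse_Gamma half by (rule solve[OF * nz])
qed

lemma beta_moment_LIMSEQ:
  "(\<lambda>m. beta_moment \<nu> a m * of_nat m powr (\<nu> + 1)) \<longlonglongrightarrow> rGamma a"
  using pochhammer_rGamma_LIMSEQ[of a "a + 1 + \<nu>"] by (simp add: beta_moment_def add_ac)

text \<open>
  Even moments of the second weight are moments of \<open>v^(a/2 - 1) (1 - v)^\<nu>\<close>, by \<open>v = u^2\<close>.
\<close>

lemma even_moment_even:
  "even_moment \<nu> a (2 * i) = of_real (sqrt pi) * 2 powr (- a) * rGamma ((a + 1) / 2)
     * (pochhammer (a / 2) i * rGamma (1 + \<nu> + a / 2 + of_nat i))"
proof -
  have "even_moment \<nu> a (2 * i) = of_real (sqrt pi) * pochhammer a (2 * i) * 2 powr (- a - of_nat (2 * i))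
     * rGamma ((a + 1) / 2 + of_nat i) * rGamma (1 + \<nu> + a / 2 + of_nat i)"
    by (simp add: even_moment_def even_beta_def add_divide_distrib add_ac)
  also have "pochhammer a (2 * i) = 4 ^ i * pochhammer (a / 2) i * pochhammer ((a + 1) / 2) i"
    using pochhammer_double[of "a / 2" i] by (simp add: power_mult add_divide_distrib)
  also have "2 powr (- a - of_nat (2 * i)) = 2 powr (- a) / (4 ^ i :: complex)"
    by (subst powr_diff, subst powr_nat') (simp_all add: power_mult)
  also have "of_real (sqrt pi) * (4 ^ i * pochhammer (a / 2) i * pochhammer ((a + 1) / 2) i)
      * (2 powr (- a) / 4 ^ i) * rGamma ((a + 1) / 2 + of_nat i) * rGamma (1 + \<nu> + a / 2 + of_nat i)
      = of_real (sqrt pi) * 2 powr (- a) * (pochhammer ((a + 1) / 2) i * rGamma ((a + 1) / 2 + of_nat i))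
     * (pochhammer (a / 2) i * rGamma (1 + \<nu> + a / 2 + of_nat i))"
    by (simp add: field_simps)
  finally show ?thesis by (simp add: pochhammer_rGamma[symmetric])
qed

text \<open>
  The asymptotics are read off separately along even and odd indices, because \<open>(a)_m\<close> splits into two Pochhammer
  symbols of half the length. That both subsequences have the same limit is what later makes an
  oscillating boundary term cancel.
\<close>

lemma even_moment_LIMSEQ:
  "(\<lambda>m. even_moment \<nu> a m * of_nat m powr (\<nu> + 1)) \<longlonglongrightarrow> 2 powr \<nu> * rGamma a"
proof (rule limseq_even_odd)
  have two: "complex_of_nat (2 * i) powr s = 2 powr s * of_nat i powr s" for i s
    using powr_times_real[of 2 "of_nat i" s] by simp
  show even: "(\<lambda>i. even_moment \<nu> a (2 * i) * of_nat (2 * i) powr (\<nu> + 1)) \<longlonglongrightarrow> 2 powr \<nu> * rGamma a"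
    for a
  proof -
    have "(\<lambda>i. of_real (sqrt pi) * 2 powr (- a) * rGamma ((a + 1) / 2) * 2 powr (\<nu> + 1)
       * (pochhammer (a / 2) i * rGamma (1 + \<nu> + a / 2 + of_nat i)
            * of_nat i powr (1 + \<nu> + a / 2 - a / 2))) \<longlonglongrightarrow>
       of_real (sqrt pi) * 2 powr (- a) * rGamma ((a + 1) / 2) * 2 powr (\<nu> + 1) * rGamma (a / 2)"
      by (intro tendsto_mult tendsto_const pochhammer_rGamma_LIMSEQ)
    also have "(\<lambda>i. of_real (sqrt pi) * 2 powr (- a) * rGamma ((a + 1) / 2) * 2 powr (\<nu> + 1)
       * (pochhammer (a / 2) i * rGamma (1 + \<nu> + a / 2 + of_nat i)
            * of_nat i powr (1 + \<nu> + a / 2 - a / 2)))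
       = (\<lambda>i. even_moment \<nu> a (2 * i) * of_nat (2 * i) powr (\<nu> + 1))"
      unfolding even_moment_even two by (simp add: mult_ac add_ac del: of_real_sqrt)
    also have "of_real (sqrt pi) * 2 powr (- a) * rGamma ((a + 1) / 2) * 2 powr (\<nu> + 1) * rGamma (a / 2)
        = (of_real (sqrt pi) * 2 powr (- a) * rGamma ((a + 1) / 2) * rGamma (a / 2)) * 2 powr (\<nu> + 1)"
      by (simp only: mult_ac)
    also have "\<dots> = 2 powr \<nu> * rGamma a"
      unfolding rGamma_duplication by (simp add: powr_add)
    finally show ?thesis .
  qed
  show "(\<lambda>i. even_moment \<nu> a (2 * i + 1) * of_nat (2 * i + 1) powr (\<nu> + 1)) \<longlonglongrightarrow> 2 powr \<nu> * rGamma a"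
  proof -
    have "(\<lambda>i. of_nat (2 * i) powr (\<nu> + 1) / of_nat (2 * i + 1) powr (\<nu> + 1)) \<longlonglongrightarrow> (1 :: complex)"
      by (rule filterlim_compose[OF powr_ratio_tendsto_1[of "\<nu> + 1" 1]]) real_asymp
    hence "(\<lambda>i. a * (even_moment \<nu> (a + 1) (2 * i) * of_nat (2 * i) powr (\<nu> + 1)) /
         (of_nat (2 * i) powr (\<nu> + 1) / of_nat (2 * i + 1) powr (\<nu> + 1)))
         \<longlonglongrightarrow> a * (2 powr \<nu> * rGamma (a + 1)) / 1"
      by (intro tendsto_divide tendsto_mult tendsto_const even) auto
    moreover have "eventually (\<lambda>i. a * (even_moment \<nu> (a + 1) (2 * i) * of_nat (2 * i) powr (\<nu> + 1)) /
         (of_nat (2 * i) powr (\<nu> + 1) / of_nat (2 * i + 1) powr (\<nu> + 1))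
         = even_moment \<nu> a (2 * i + 1) * of_nat (2 * i + 1) powr (\<nu> + 1)) sequentially"
      using eventually_gt_at_top[of 0]
    proof eventually_elim
      case (elim i)
      have "even_moment \<nu> a (2 * i + 1) = a * even_moment \<nu> (a + 1) (2 * i)"
        using even_moment_add[of \<nu> a 1 "2 * i"] by (simp add: add_ac)
      thus ?case using elim by simp
    qed
    ultimately have "(\<lambda>i. even_moment \<nu> a (2 * i + 1) * of_nat (2 * i + 1) powr (\<nu> + 1))
         \<longlonglongrightarrow> a * (2 powr \<nu> * rGamma (a + 1)) / 1"
      by (rule Lim_transform_eventually)
    also have "a * (2 powr \<nu> * rGamma (a + 1)) / 1 = 2 powr \<nu> * (a * rGamma (a + 1))"
      by simp
    finally show ?thesis unfolding rGamma_plus1 .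
  qed
qed

section \<open>Series of binomial coefficients\<close>

lemma gbinomial_Suc_mult:
  fixes z :: complex
  shows "of_nat (Suc k) * (z gchoose Suc k) = (z - of_nat k) * (z gchoose k)"
  using gbinomial_absorption[of k z] gbinomial_absorb_comp[of z k] by simp

lemma gbinomial_norm_bound:
  fixes z :: complex
  obtains K where "K > 0" "\<And>n. norm (z gchoose n) \<le> K * (1 + real n) powr (- Re z - 1)"
proof -
  obtain K where "K > 0" "\<And>n. norm ((-1) ^ n * (z gchoose n)) \<le> K * (1 + real n) powr (- Re (z + 1))"
    by (rule norm_bound_of_LIMSEQ[OF gbinomial_LIMSEQ[of z]]) blast
  thus ?thesis using that[of K] by (simp add: norm_mult norm_power)
qed

lemma beta_moment_norm_bound:
  obtains K where "K > 0" "\<And>n. norm (beta_moment \<nu> a n) \<le> K * (1 + real n) powr (- Re \<nu> - 1)"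
proof -
  obtain K where "K > 0" "\<And>n. norm (beta_moment \<nu> a n) \<le> K * (1 + real n) powr (- Re (\<nu> + 1))"
    by (rule norm_bound_of_LIMSEQ[OF beta_moment_LIMSEQ[of \<nu> a]]) blast
  thus ?thesis using that[of K] by simp
qed

lemma even_moment_norm_bound:
  obtains K where "K > 0" "\<And>n. norm (even_moment \<nu> a n) \<le> K * (1 + real n) powr (- Re \<nu> - 1)"
proof -
  obtain K where "K > 0" "\<And>n. norm (even_moment \<nu> a n) \<le> K * (1 + real n) powr (- Re (\<nu> + 1))"
    by (rule norm_bound_of_LIMSEQ[OF even_moment_LIMSEQ[of \<nu> a]]) blast
  thus ?thesis using that[of K] by simp
qed

lemma summable_one_plus_powr:
  fixes s :: real
  assumes "s < - 1"
  shows "summable (\<lambda>n. (1 + real n) powr s)"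
proof -
  have "summable (\<lambda>n. real (Suc n) powr s)"
    using assms by (subst summable_Suc_iff) (simp add: summable_real_powr_iff)
  thus ?thesis by (simp add: add.commute)
qed

lemma one_plus_powr_tendsto_0:
  fixes s :: real
  assumes "s < 0"
  shows "(\<lambda>n. K * (1 + real n) powr s) \<longlonglongrightarrow> 0"
proof -
  have "(\<lambda>n. (1 + real n) powr s) \<longlonglongrightarrow> 0"
    using assms by real_asymp
  from tendsto_mult_right_zero[OF this] show ?thesis .
qed

lemma one_plus_add_powr_le:
  fixes t :: real
  shows "(1 + real (j + m)) powr t \<le> (1 + real j) powr t * (1 + real m) powr \<bar>t\<bar>"
proof (cases "t \<ge> 0")
  case True
  have "(1 + real (j + m)) powr t \<le> ((1 + real j) * (1 + real m)) powr t"
    using True by (intro powr_mono2) (auto simp: algebra_simps)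
  thus ?thesis using True by (simp add: powr_mult)
next
  case False
  have "(1 + real (j + m)) powr t \<le> (1 + real j) powr t"
    using False by (intro powr_mono2') auto
  also have "\<dots> \<le> (1 + real j) powr t * (1 + real m) powr \<bar>t\<bar>"
    using ge_one_powr_ge_zero[of "1 + real m" "\<bar>t\<bar>"] by (simp add: mult_le_cancel_left1)
  finally show ?thesis .
qed

text \<open>
  Tannery's theorem for \<open>\<Sum> b_j h_(N+j)\<close> as \<open>N\<close> grows, where \<open>h_m\<close> behaves like \<open>c m^(-s)\<close>. The ratio
  \<open>h_(N+j) / N^(-s)\<close> tends to \<open>c\<close> for each \<open>j\<close>, and it is at most a constant times \<open>(1 + j)^p\<close>. Since \<open>(a)_N\<close> times a
  moment for \<open>a + N\<close> is a shifted moment for \<open>a\<close>, this gives the behaviour of moment series as \<open>a\<close> tends to infinity.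
\<close>

lemma shifted_series_LIMSEQ:
  fixes b h :: "nat \<Rightarrow> complex"
  assumes h: "(\<lambda>m. h m * of_nat m powr s) \<longlonglongrightarrow> c"
    and b: "summable (\<lambda>j. norm (b j) * (1 + real j) powr p)" and p: "p \<ge> 0" "- Re s \<le> p"
    and X: "\<And>N. (\<lambda>j. b j * h (N + j)) sums X N"
  shows "(\<lambda>N. X N * of_nat N powr s) \<longlonglongrightarrow> (\<Sum>j. b j) * c"
proof -
  obtain K where K: "K > 0" "\<And>n. norm (h n) \<le> K * (1 + real n) powr (- Re s)"
    by (rule norm_bound_of_LIMSEQ[OF h]) blast
  define M where "M j = K * 2 powr p * (norm (b j) * (1 + real j) powr p)" for j
  have "norm (b j) \<le> norm (b j) * (1 + real j) powr p" for j
    using p(1) ge_one_powr_ge_zero[of "1 + real j" p] by (simp add: mult_le_cancel_left1)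
  hence b_sum: "summable b"
    by (intro summable_norm_cancel[OF summable_comparison_test'[OF b]]) auto
  have bound: "norm (b j * (h (N + j) * of_nat N powr s)) \<le> M j" if N: "N > 0" for j N
  proof -
    define r where "r = (1 + real (N + j)) / real N"
    have "real N * 1 \<le> 1 + real (N + j)" by simp
    hence r: "1 \<le> r" "r \<le> 2 * (1 + real j)"
    proof -
      show "1 \<le> r" using N by (simp add: r_def)
      have "1 * 1 \<le> real N * (1 + 2 * real j)"
        using N by (intro mult_mono) auto
      moreover have "real j \<le> real N * real j"
        using N by (simp add: mult_le_cancel_right1)
      ultimately show "r \<le> 2 * (1 + real j)"
        using N by (simp add: r_def field_simps)
    qed
    have "norm (h (N + j)) * real N powr Re s \<le> K * (1 + real (N + j)) powr (- Re s) * real N powr Re s"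
      by (intro mult_right_mono K) auto
    also have "\<dots> = K * r powr (- Re s)"
    proof -
      have "r powr (- Re s) = (1 + real (N + j)) powr (- Re s) / real N powr (- Re s)"
        unfolding r_def by (rule powr_divide)
      also have "\<dots> = (1 + real (N + j)) powr (- Re s) * real N powr Re s"
        by (simp add: powr_minus divide_inverse)
      finally show ?thesis by simp
    qed
    also have "r powr (- Re s) \<le> r powr p"
      using r(1) p(2) by (intro powr_mono) auto
    also have "\<dots> \<le> (2 * (1 + real j)) powr p"
      using r p(1) by (intro powr_mono2) auto
    also have "\<dots> = 2 powr p * (1 + real j) powr p"
      by (rule powr_mult)
    finally have "norm (h (N + j)) * real N powr Re s \<le> K * (2 powr p * (1 + real j) powr p)"
      using K(1) by simp
    hence "norm (b j) * (norm (h (N + j)) * real N powr Re s)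
        \<le> norm (b j) * (K * (2 powr p * (1 + real j) powr p))"
      by (intro mult_left_mono) auto
    thus ?thesis
      using N by (simp add: norm_mult norm_powr_real_powr M_def mult_ac)
  qed
  have "(\<lambda>N. \<Sum>j. b j * (h (N + j) * of_nat N powr s)) \<longlonglongrightarrow> (\<Sum>j. b j * c)"
  proof (rule tannerys_theorem[THEN conjunct2, THEN conjunct2])
    show "(\<lambda>N. b j * (h (N + j) * of_nat N powr s)) \<longlonglongrightarrow> b j * c" for j
    proof (rule tendsto_mult[OF tendsto_const])
      have "(\<lambda>N. (h (N + j) * of_nat (N + j) powr s) * (of_nat N powr s / of_nat (N + j) powr s)) \<longlonglongrightarrow> c * 1"
        by (intro tendsto_mult powr_ratio_tendsto_1 LIMSEQ_ignore_initial_segment[OF h])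
      moreover have "eventually (\<lambda>N. (h (N + j) * of_nat (N + j) powr s) *
          (of_nat N powr s / of_nat (N + j) powr s) = h (N + j) * of_nat N powr s) sequentially"
        using eventually_gt_at_top[of 0]
      proof eventually_elim
        case (elim N)
        hence "complex_of_nat (N + j) \<noteq> 0" unfolding of_nat_eq_0_iff by simp
        hence "complex_of_nat (N + j) powr s \<noteq> 0" by (metis powr_eq_0_iff)
        thus ?case by (simp del: of_nat_add)
      qed
      ultimately show "(\<lambda>N. h (N + j) * of_nat N powr s) \<longlonglongrightarrow> c"
        by (auto intro: Lim_transform_eventually)
    qed
    show "\<forall>\<^sub>F (j, N) in sequentially \<times>\<^sub>F sequentially. norm (b j * (h (N + j) * of_nat N powr s)) \<le> M j"
      unfolding eventually_prod_filter
    proof (intro exI conjI)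
      show "eventually (\<lambda>_. True) sequentially" by simp
      show "eventually (\<lambda>N :: nat. N > 0) sequentially" by (rule eventually_gt_at_top)
    qed (use bound in auto)
    show "summable M" unfolding M_def by (intro summable_mult b)
  qed simp
  also have "(\<lambda>N. \<Sum>j. b j * (h (N + j) * of_nat N powr s)) = (\<lambda>N. X N * of_nat N powr s)"
  proof
    fix N show "(\<Sum>j. b j * (h (N + j) * of_nat N powr s)) = X N * of_nat N powr s"
      using sums_mult2[OF X[of N], of "of_nat N powr s"] by (simp add: sums_iff mult_ac)
  qed
  also have "(\<Sum>j. b j * c) = (\<Sum>j. b j) * c"
    using b_sum by (rule suminf_mult2[symmetric])
  finally show ?thesis .
qed

lemma summable_norm_gbinomial_powr:
  fixes z :: complex
  assumes "p < Re z"
  shows "summable (\<lambda>j. norm (z gchoose j) * (1 + real j) powr p)"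
proof -
  obtain K where K: "K > 0" "\<And>n. norm (z gchoose n) \<le> K * (1 + real n) powr (- Re z - 1)"
    by (rule gbinomial_norm_bound[of z]) blast
  have "summable (\<lambda>j. K * (1 + real j) powr (p - Re z - 1))"
    using assms by (intro summable_mult summable_one_plus_powr) auto
  thus ?thesis
  proof (rule summable_comparison_test')
    fix n :: nat
    have "norm (z gchoose n) * (1 + real n) powr p \<le> K * (1 + real n) powr (- Re z - 1) * (1 + real n) powr p"
      by (intro mult_right_mono K) auto
    also have "\<dots> = K * (1 + real n) powr (p - Re z - 1)"
      by (simp add: powr_add[symmetric] algebra_simps)
    finally show "norm (norm (z gchoose n) * (1 + real n) powr p) \<le> K * (1 + real n) powr (p - Re z - 1)"
      by simp
  qed
qed

text \<open>
  The binomial series on the boundary of its disc, by Tannery's theorem along \<open>n / (n + 1)\<close>.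
\<close>

lemma gbinomial_sums_two_powr:
  fixes z :: complex
  assumes "Re z > 0"
  shows "(\<lambda>j. z gchoose j) sums (2 powr z)"
proof -
  have sm: "summable (\<lambda>j. norm (z gchoose j))"
    using summable_norm_gbinomial_powr[of 0 z] assms by simp
  define x where "x n = real n / (1 + real n)" for n
  have x: "0 \<le> x n" "x n < 1" for n by (auto simp: x_def)
  have lim: "x \<longlonglongrightarrow> 1" unfolding x_def by real_asymp
  have "(\<lambda>n. \<Sum>k. (z gchoose k) * of_real (x n) ^ k) \<longlonglongrightarrow> (\<Sum>k. z gchoose k)"
  proof (rule tannerys_theorem[THEN conjunct2, THEN conjunct2])
    have "(\<lambda>n. (z gchoose k) * of_real (x n) ^ k) \<longlonglongrightarrow> (z gchoose k) * of_real 1 ^ k" for k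
      by (intro tendsto_intros lim)
    thus "(\<lambda>n. (z gchoose k) * of_real (x n) ^ k) \<longlonglongrightarrow> (z gchoose k)" for k by simp
    have "norm ((z gchoose k) * of_real (x n) ^ k) \<le> norm (z gchoose k)" for k n
      using x[of n] power_le_one[of "x n" k]
      by (simp add: norm_mult norm_power mult_left_le)
    thus "\<forall>\<^sub>F (k, n) in sequentially \<times>\<^sub>F sequentially. norm ((z gchoose k) * of_real (x n) ^ k) \<le> norm (z gchoose k)"
      by (intro always_eventually) auto
  qed (use sm in auto)
  moreover have "(\<Sum>k. (z gchoose k) * of_real (x n) ^ k) = (1 + of_real (x n)) powr z" for n
    using gen_binomial_complex[of "of_real (x n)" z] x[of n] by (simp add: sums_iff)
  moreover have "(\<lambda>n. (1 + complex_of_real (x n)) powr z) \<longlonglongrightarrow> (1 + of_real 1) powr z"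
    by (intro tendsto_powr_complex tendsto_add tendsto_of_real lim tendsto_const) auto
  ultimately have "(\<Sum>k. z gchoose k) = 2 powr z"
    using LIMSEQ_unique by simp
  thus ?thesis using summable_norm_cancel[OF sm] by (simp add: sums_iff)
qed

section \<open>Relations between moments\<close>

text \<open>
  The integral of the derivative of \<open>u^(a + m) (1 - u)^(\<nu> + 1)\<close> vanishes.
\<close>

lemma beta_moment_rec:
  "(a + of_nat m) * beta_moment \<nu> a m = (a + of_nat m + \<nu> + 1) * beta_moment \<nu> a (Suc m)"
proof -
  have e: "rGamma (a + 1 + \<nu> + of_nat m) = (a + of_nat m + \<nu> + 1) * rGamma (a + 1 + \<nu> + of_nat (Suc m))"
    using rGamma_plus1[of "a + 1 + \<nu> + of_nat m"] by (simp add: add_ac)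
  show ?thesis unfolding beta_moment_def e pochhammer_rec' by (simp only: mult_ac)
qed

text \<open>
  Multiplying the weight by \<open>1 - u\<close> raises \<open>\<nu>\<close> by one; the factor \<open>1 + \<nu>\<close> comes from the normalisation by
  \<open>\<Gamma>(1 + \<nu>)\<close>. For the second weight below the multiplier is \<open>1 - u^2\<close>.
\<close>

lemma beta_moment_raise:
  "(1 + \<nu>) * beta_moment (\<nu> + 1) a m = beta_moment \<nu> a m - beta_moment \<nu> a (Suc m)"
proof -
  have e: "rGamma (a + 1 + \<nu> + of_nat m) = (a + of_nat m + \<nu> + 1) * rGamma (a + 1 + \<nu> + of_nat (Suc m))"
    using rGamma_plus1[of "a + 1 + \<nu> + of_nat m"] by (simp add: add_ac)
  have e': "a + 1 + (\<nu> + 1) + of_nat m = a + 1 + \<nu> + of_nat (Suc m)" by simp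
  show ?thesis unfolding beta_moment_def e e' pochhammer_rec' by (simp only: ring_distribs) (simp add: mult_ac)
qed

lemma even_moment_rec:
  "(a + of_nat m) * even_moment \<nu> a m = (a + of_nat m + 2 * \<nu> + 2) * even_moment \<nu> a (m + 2)"
  using even_beta_plus2[of \<nu> "a + of_nat m"]
  by (simp add: even_moment_def pochhammer_rec' add_ac)

lemma even_moment_raise:
  "(1 + \<nu>) * even_moment (\<nu> + 1) a m = even_moment \<nu> a m - even_moment \<nu> a (m + 2)"
proof -
  define A where "A = a + of_nat m"
  have e: "(A + 1) * even_beta \<nu> (A + 2) = even_beta (\<nu> + 1) A / 2"
  proof -
    have 1: "rGamma ((A + 1) / 2) = (A + 1) / 2 * rGamma ((A + 2 + 1) / 2)"
      using rGamma_plus1[of "(A + 1) / 2"] by (simp add: field_simps)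
    have 2: "2 powr (- A) = 4 * (2 powr (- (A + 2)) :: complex)"
      by (simp add: powr_diff powr_minus)
    have 3: "1 + (\<nu> + 1) + A / 2 = 1 + \<nu> + (A + 2) / 2"
      by (simp add: field_simps)
    show ?thesis unfolding even_beta_def 1 2 3 by (simp add: field_simps)
  qed
  have m2: "even_moment \<nu> a (m + 2) = pochhammer a m * A * ((A + 1) * even_beta \<nu> (A + 2))"
    by (simp add: even_moment_def pochhammer_rec' A_def add_ac)
  have m0: "even_moment \<nu> a m = pochhammer a m * ((1 + \<nu> + A / 2) * even_beta (\<nu> + 1) A)"
    using even_beta_raise[of \<nu> A] by (simp add: even_moment_def A_def)
  have m1: "even_moment (\<nu> + 1) a m = pochhammer a m * even_beta (\<nu> + 1) A"
    by (simp add: even_moment_def A_def)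
  show ?thesis unfolding m0 m1 m2 e by (simp add: field_simps)
qed

section \<open>Multiplying the first weight by a power of 1 + u\<close>

text \<open>
  When \<open>b\<close> alternates like \<open>C(\<nu>, j)\<close>, the sums \<open>b_j + b_(j+1)\<close> decay one order faster than \<open>b\<close>, and the
  differences of \<open>h\<close> one order faster than \<open>h\<close>. This expresses a conditionally convergent series by
  two absolutely convergent ones.
\<close>

lemma averaged_partial_sum:
  fixes h b f :: "nat \<Rightarrow> complex"
  assumes "f 0 = b 0" "\<And>j. f (Suc j) = b j + b (Suc j)"
  shows "2 * (\<Sum>j<Suc J. b j * h j) = b J * h J + (\<Sum>j<Suc J. f j * h j) + (\<Sum>j<J. b j * (h j - h (Suc j)))"
  by (induction J) (simp_all add: assms algebra_simps)

lemma beta_series_boundary: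
  assumes "Re \<nu> > - 1"
  shows "(\<lambda>J. (a + of_nat (J + 1)) * (\<nu> + 1 gchoose (J + 1)) * beta_moment \<nu> a (J + 1)) \<longlonglongrightarrow> 0"
proof -
  obtain K where K: "K > 0" "\<And>n. norm (\<nu> + 1 gchoose n) \<le> K * (1 + real n) powr (- Re \<nu> - 2)"
    using gbinomial_norm_bound[of "\<nu> + 1"] by (auto simp: algebra_simps)
  obtain L where L: "L > 0" "\<And>n. norm (beta_moment \<nu> a n) \<le> L * (1 + real n) powr (- Re \<nu> - 1)"
    by (rule beta_moment_norm_bound[of \<nu> a]) blast
  have bound: "norm ((a + of_nat n) * (\<nu> + 1 gchoose n) * beta_moment \<nu> a n)
      \<le> (norm a + 1) * K * L * (1 + real n) powr (- 2 * Re \<nu> - 2)" for n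
  proof -
    have "norm (a + of_nat n) \<le> norm a + real n"
      using norm_triangle_ineq[of a "of_nat n"] by simp
    also have "\<dots> \<le> (norm a + 1) * (1 + real n) powr 1"
      by (simp add: algebra_simps)
    finally have "norm (a + of_nat n) \<le> (norm a + 1) * (1 + real n) powr 1" .
    hence "norm ((a + of_nat n) * (\<nu> + 1 gchoose n) * beta_moment \<nu> a n)
        \<le> ((norm a + 1) * (1 + real n) powr 1) * (K * (1 + real n) powr (- Re \<nu> - 2))
          * (L * (1 + real n) powr (- Re \<nu> - 1))"
      unfolding norm_mult using K L by (intro mult_mono) auto
    also have "\<dots> = (norm a + 1) * K * L * ((1 + real n) powr 1 * (1 + real n) powr (- Re \<nu> - 2)
          * (1 + real n) powr (- Re \<nu> - 1))"
      by (simp only: mult_ac)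
    also have "\<dots> = (norm a + 1) * K * L * (1 + real n) powr (- 2 * Re \<nu> - 2)"
      unfolding powr_add[symmetric] by simp
    finally show ?thesis .
  qed
  have "(\<lambda>n. (a + of_nat n) * (\<nu> + 1 gchoose n) * beta_moment \<nu> a n) \<longlonglongrightarrow> 0"
  proof (rule Lim_null_comparison[OF always_eventually, OF allI, OF bound])
    show "(\<lambda>n. (norm a + 1) * K * L * (1 + real n) powr (- 2 * Re \<nu> - 2)) \<longlonglongrightarrow> 0"
      using assms by (intro one_plus_powr_tendsto_0) auto
  qed
  thus ?thesis by (rule LIMSEQ_ignore_initial_segment[of _ _ 1])
qed

text \<open>
  With \<open>\<sigma> = Re \<nu>\<close> the terms have size \<open>j^(-2 \<sigma> - 2)\<close>, so the series need not converge absolutely. Averaging gains one order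
  and leaves \<open>j^(-2 \<sigma> - 3)\<close>, which is summable exactly for \<open>\<sigma> > -1\<close>, uniformly in the shift \<open>m\<close>.
\<close>

lemma beta_series_summable_bounded:
  assumes "Re \<nu> > - 1"
  shows "summable (\<lambda>j. (\<nu> gchoose j) * beta_moment \<nu> a (j + m))"
    and "\<exists>K. \<forall>m J. norm (\<Sum>j<J. (\<nu> gchoose j) * beta_moment \<nu> a (j + m)) \<le> K"
proof -
  define \<sigma> where "\<sigma> = Re \<nu>"
  define f where "f j = (\<nu> + 1 gchoose j)" for j
  obtain B where B: "B > 0" "\<And>n. norm (\<nu> gchoose n) \<le> B * (1 + real n) powr (- \<sigma> - 1)"
    unfolding \<sigma>_def by (rule gbinomial_norm_bound[of \<nu>]) blast
  obtain F where F: "F > 0" "\<And>n. norm (f n) \<le> F * (1 + real n) powr (- \<sigma> - 2)"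
    using gbinomial_norm_bound[of "\<nu> + 1"] by (auto simp: algebra_simps \<sigma>_def f_def)
  obtain G where G: "G > 0" "\<And>n. norm (beta_moment \<nu> a n) \<le> G * (1 + real n) powr (- \<sigma> - 1)"
    unfolding \<sigma>_def by (rule beta_moment_norm_bound[of \<nu> a]) blast
  obtain H where H: "H > 0" "\<And>n. norm (beta_moment (\<nu> + 1) a n) \<le> H * (1 + real n) powr (- \<sigma> - 2)"
    using beta_moment_norm_bound[of "\<nu> + 1" a] by (auto simp: algebra_simps \<sigma>_def)
  define M where "M j = (1 + real j) powr (- 2 * \<sigma> - 3)" for j
  have M: "summable M" unfolding M_def
    using assms by (intro summable_one_plus_powr) (simp add: \<sigma>_def)
  have M0: "M j \<ge> 0" for j by (simp add: M_def)
  have shift: "(1 + real (j + m)) powr t \<le> (1 + real j) powr t" if "t \<le> 0" for j m t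
    using that by (intro powr_mono2') auto
  have fg: "norm (f j * beta_moment \<nu> a (j + m)) \<le> F * G * M j" for j m
  proof -
    have "norm (beta_moment \<nu> a (j + m)) \<le> G * (1 + real (j + m)) powr (- \<sigma> - 1)" by (rule G)
    also have "\<dots> \<le> G * (1 + real j) powr (- \<sigma> - 1)"
      using G(1) assms by (intro mult_left_mono shift) (auto simp: \<sigma>_def)
    finally have "norm (f j * beta_moment \<nu> a (j + m)) \<le>
        (F * (1 + real j) powr (- \<sigma> - 2)) * (G * (1 + real j) powr (- \<sigma> - 1))"
      unfolding norm_mult using F by (intro mult_mono) auto
    also have "\<dots> = F * G * ((1 + real j) powr (- \<sigma> - 2) * (1 + real j) powr (- \<sigma> - 1))"
      by (simp only: mult_ac)
    finally show ?thesis unfolding powr_add[symmetric] M_def by simp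
  qed
  have bh: "norm ((\<nu> gchoose j) * beta_moment (\<nu> + 1) a (j + m)) \<le> B * H * M j" for j m
  proof -
    have "norm (beta_moment (\<nu> + 1) a (j + m)) \<le> H * (1 + real (j + m)) powr (- \<sigma> - 2)" by (rule H)
    also have "\<dots> \<le> H * (1 + real j) powr (- \<sigma> - 2)"
      using H(1) assms by (intro mult_left_mono shift) (auto simp: \<sigma>_def)
    finally have "norm ((\<nu> gchoose j) * beta_moment (\<nu> + 1) a (j + m)) \<le>
        (B * (1 + real j) powr (- \<sigma> - 1)) * (H * (1 + real j) powr (- \<sigma> - 2))"
      unfolding norm_mult using B by (intro mult_mono) auto
    also have "\<dots> = B * H * ((1 + real j) powr (- \<sigma> - 1) * (1 + real j) powr (- \<sigma> - 2))"
      by (simp only: mult_ac)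
    finally show ?thesis unfolding powr_add[symmetric] M_def by simp
  qed
  have bg: "norm ((\<nu> gchoose j) * beta_moment \<nu> a (j + m)) \<le> B * G * (1 + real j) powr (- 2 * \<sigma> - 2)" for j m
  proof -
    have "norm (beta_moment \<nu> a (j + m)) \<le> G * (1 + real (j + m)) powr (- \<sigma> - 1)" by (rule G)
    also have "\<dots> \<le> G * (1 + real j) powr (- \<sigma> - 1)"
      using G(1) assms by (intro mult_left_mono shift) (auto simp: \<sigma>_def)
    finally have "norm ((\<nu> gchoose j) * beta_moment \<nu> a (j + m)) \<le>
        (B * (1 + real j) powr (- \<sigma> - 1)) * (G * (1 + real j) powr (- \<sigma> - 1))"
      unfolding norm_mult using B by (intro mult_mono) auto
    also have "\<dots> = B * G * ((1 + real j) powr (- \<sigma> - 1) * (1 + real j) powr (- \<sigma> - 1))"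
      by (simp only: mult_ac)
    finally show ?thesis unfolding powr_add[symmetric] by simp
  qed
  have split: "2 * (\<Sum>j<Suc J. (\<nu> gchoose j) * beta_moment \<nu> a (j + m)) =
      (\<nu> gchoose J) * beta_moment \<nu> a (J + m) + (\<Sum>j<Suc J. f j * beta_moment \<nu> a (j + m))
      + (1 + \<nu>) * (\<Sum>j<J. (\<nu> gchoose j) * beta_moment (\<nu> + 1) a (j + m))" for J m
  proof -
    have "f 0 = (\<nu> gchoose 0)" "\<And>j. f (Suc j) = (\<nu> gchoose j) + (\<nu> gchoose Suc j)"
      by (simp_all add: f_def gbinomial_Suc_Suc)
    from averaged_partial_sum[OF this, where J = J and h = "\<lambda>j. beta_moment \<nu> a (j + m)"]
    show ?thesis
      using beta_moment_raise[of \<nu> a, symmetric] by (simp add: sum_distrib_left mult_ac)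
  qed
  have sum_fg: "summable (\<lambda>j. f j * beta_moment \<nu> a (j + m))" for m
    by (rule summable_comparison_test'[OF summable_mult[OF M, of "F * G"]]) (rule fg)
  have sum_bh: "summable (\<lambda>j. (\<nu> gchoose j) * beta_moment (\<nu> + 1) a (j + m))" for m
    by (rule summable_comparison_test'[OF summable_mult[OF M, of "B * H"]]) (rule bh)
  show "summable (\<lambda>j. (\<nu> gchoose j) * beta_moment \<nu> a (j + m))"
  proof -
    have "(\<lambda>J. (\<nu> gchoose J) * beta_moment \<nu> a (J + m)) \<longlonglongrightarrow> 0"
    proof (rule Lim_null_comparison[OF always_eventually, OF allI, OF bg])
      show "(\<lambda>n. B * G * (1 + real n) powr (- 2 * \<sigma> - 2)) \<longlonglongrightarrow> 0"
        using assms by (intro one_plus_powr_tendsto_0) (simp add: \<sigma>_def)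
    qed
    moreover have "(\<lambda>J. \<Sum>j<Suc J. f j * beta_moment \<nu> a (j + m)) \<longlonglongrightarrow> (\<Sum>j. f j * beta_moment \<nu> a (j + m))"
      by (rule LIMSEQ_Suc[OF summable_LIMSEQ[OF sum_fg]])
    moreover have "(\<lambda>J. \<Sum>j<J. (\<nu> gchoose j) * beta_moment (\<nu> + 1) a (j + m))
        \<longlonglongrightarrow> (\<Sum>j. (\<nu> gchoose j) * beta_moment (\<nu> + 1) a (j + m))"
      by (rule summable_LIMSEQ[OF sum_bh])
    ultimately have "(\<lambda>J. (1 / 2) * ((\<nu> gchoose J) * beta_moment \<nu> a (J + m)
          + (\<Sum>j<Suc J. f j * beta_moment \<nu> a (j + m))
          + (1 + \<nu>) * (\<Sum>j<J. (\<nu> gchoose j) * beta_moment (\<nu> + 1) a (j + m))))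
        \<longlonglongrightarrow> (1 / 2) * (0 + (\<Sum>j. f j * beta_moment \<nu> a (j + m))
          + (1 + \<nu>) * (\<Sum>j. (\<nu> gchoose j) * beta_moment (\<nu> + 1) a (j + m)))"
      by (intro tendsto_mult tendsto_add tendsto_const)
    moreover have half: "1 / 2 * (2 * z) = z" for z :: complex by simp
    ultimately have "convergent (\<lambda>J. \<Sum>j<Suc J. (\<nu> gchoose j) * beta_moment \<nu> a (j + m))"
      unfolding split[symmetric] half convergent_def by blast
    thus ?thesis
      unfolding summable_iff_convergent by (subst (asm) convergent_Suc_iff)
  qed
  show "\<exists>K. \<forall>m J. norm (\<Sum>j<J. (\<nu> gchoose j) * beta_moment \<nu> a (j + m)) \<le> K"
  proof (intro exI allI)
    fix m J
    define C where "C = B * G + F * G * suminf M + norm (1 + \<nu>) * (B * H * suminf M)"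
    have C: "C \<ge> 0"
      unfolding C_def using B(1) F(1) G(1) H(1) suminf_nonneg[OF M M0] by (intro add_nonneg_nonneg mult_nonneg_nonneg) auto
    show "norm (\<Sum>j<J. (\<nu> gchoose j) * beta_moment \<nu> a (j + m)) \<le> C"
    proof (cases J)
      case 0
      thus ?thesis using C by simp
    next
      case (Suc I)
      have part: "norm (\<Sum>j<J. u j) \<le> c * suminf M" if "\<And>j. norm (u j) \<le> c * M j" "c \<ge> 0" for u :: "nat \<Rightarrow> complex" and c J
      proof -
        have "norm (\<Sum>j<J. u j) \<le> (\<Sum>j<J. c * M j)"
          by (rule sum_norm_le) (rule that)
        also have "\<dots> = c * (\<Sum>j<J. M j)" by (simp add: sum_distrib_left)
        also have "\<dots> \<le> c * suminf M"
          using that(2) M M0 by (intro mult_left_mono sum_le_suminf) auto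
        finally show ?thesis .
      qed
      have "norm ((\<nu> gchoose I) * beta_moment \<nu> a (I + m)) \<le> B * G * (1 + real I) powr (- 2 * \<sigma> - 2)"
        by (rule bg)
      also have "\<dots> \<le> B * G * 1"
        using B(1) G(1) assms powr_mono[of "- 2 * \<sigma> - 2" 0 "1 + real I"]
        by (intro mult_left_mono) (auto simp: \<sigma>_def)
      finally have 1: "norm ((\<nu> gchoose I) * beta_moment \<nu> a (I + m)) \<le> B * G" by simp
      have 2: "norm (\<Sum>j<Suc I. f j * beta_moment \<nu> a (j + m)) \<le> F * G * suminf M"
        using F(1) G(1) by (intro part fg) auto
      have 3: "norm ((1 + \<nu>) * (\<Sum>j<I. (\<nu> gchoose j) * beta_moment (\<nu> + 1) a (j + m))) \<le> norm (1 + \<nu>) * (B * H * suminf M)"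
        unfolding norm_mult using B(1) H(1) by (intro mult_left_mono part bh) auto
      have "norm (2 * (\<Sum>j<Suc I. (\<nu> gchoose j) * beta_moment \<nu> a (j + m))) \<le> C"
        unfolding split C_def by (intro norm_triangle_le add_mono 1 2 3)
      thus ?thesis
        unfolding Suc norm_mult norm_numeral
        using norm_ge_zero[of "\<Sum>j<Suc I. (\<nu> gchoose j) * beta_moment \<nu> a (j + m)"] by linarith
    qed
  qed
qed

text \<open>
  The derivative of \<open>u^a (1 - u)^(\<nu> + 1) (1 + u)^(\<nu> + 1)\<close> equals
  \<open>u^(a - 1) (1 - u)^\<nu> (1 + u)^\<nu> (a - (a + 2 + 2 \<nu>) u^2)\<close>. On the level of moments its integral is a
  telescoping sum, and the right hand side is the boundary term of the partial sum.
\<close>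

lemma beta_series_telescope:
  "a * (\<Sum>m<J + 2. (\<nu> gchoose m) * beta_moment \<nu> a m)
     - (a + 2 + 2 * \<nu>) * (\<Sum>m<J. (\<nu> gchoose m) * beta_moment \<nu> a (m + 2))
   = (a + of_nat (J + 1)) * (\<nu> + 1 gchoose (J + 1)) * beta_moment \<nu> a (J + 1)"
proof (induction J)
  case 0
  have "a * beta_moment \<nu> a 0 = (a + \<nu> + 1) * beta_moment \<nu> a 1"
    using beta_moment_rec[of a 0 \<nu>] by simp
  thus ?case by (simp add: numeral_2_eq_2 algebra_simps)
next
  case (Suc J)
  define b where "b m = (\<nu> gchoose m)" for m
  define g where "g = beta_moment \<nu> a"
  have f: "(\<nu> + 1 gchoose Suc m) = b m + b (Suc m)" for m
    by (simp add: b_def gbinomial_Suc_Suc)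
  have b1: "of_nat (Suc J) * b (Suc J) = (\<nu> - of_nat J) * b J"
    and b2: "of_nat (Suc (Suc J)) * b (Suc (Suc J)) = (\<nu> - of_nat (Suc J)) * b (Suc J)"
    unfolding b_def by (rule gbinomial_Suc_mult)+
  have g: "(a + of_nat (Suc J)) * g (Suc J) = (a + of_nat (Suc J) + \<nu> + 1) * g (Suc (Suc J))"
    unfolding g_def by (rule beta_moment_rec)
  have coeff: "a * b'' - (a + 2 + 2 * \<nu>) * b0 = (a + (N + 2)) * (b' + b'') - (a + (N + 1) + \<nu> + 1) * (b0 + b')"
    if "(N + 1) * b' = (\<nu> - N) * b0" "(N + 2) * b'' = (\<nu> - (N + 1)) * b'" for b0 b' b'' N
    using that by algebra
  have N: "complex_of_nat (Suc J) = of_nat J + 1" "complex_of_nat (Suc (Suc J)) = of_nat J + 2"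
    by simp_all
  have "a * b (Suc (Suc J)) - (a + 2 + 2 * \<nu>) * b J
     = (a + of_nat (Suc (Suc J))) * (b (Suc J) + b (Suc (Suc J))) - (a + of_nat (Suc J) + \<nu> + 1) * (b J + b (Suc J))"
    using coeff b1 b2 unfolding N by blast
  moreover have "U * v = A * B * v - E * D * w" if "U = A * B - C * D" "E * w = C * v" for U v w A B C D E :: complex
    using that by algebra
  ultimately have *: "(a * b (Suc (Suc J)) - (a + 2 + 2 * \<nu>) * b J) * g (Suc (Suc J))
     = (a + of_nat (Suc (Suc J))) * (b (Suc J) + b (Suc (Suc J))) * g (Suc (Suc J))
       - (a + of_nat (Suc J)) * (b J + b (Suc J)) * g (Suc J)"
    using g by blast
  have combine: "a * (S + u * v) - c * (T + w * v) = Y" if "a * S - c * T = X" "(a * u - c * w) * v = Y - X"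
    for S T u v w c X Y
    using that by (simp add: algebra_simps)
  have IH: "a * (\<Sum>m<Suc (Suc J). b m * g m) - (a + 2 + 2 * \<nu>) * (\<Sum>m<J. b m * g (Suc (Suc m)))
      = (a + of_nat (Suc J)) * (b J + b (Suc J)) * g (Suc J)"
    using Suc.IH unfolding b_def[symmetric] g_def[symmetric] by (simp only: add_2_eq_Suc' add_Suc_right add_0_right One_nat_def f)
  show ?case
    unfolding b_def[symmetric] g_def[symmetric]
    using combine[OF IH *] by (simp only: add_2_eq_Suc' add_Suc_right add_0_right One_nat_def f sum.lessThan_Suc[of _ J] sum.lessThan_Suc[of _ "Suc (Suc J)"])
qed

lemma beta_series_rec:
  assumes X: "(\<lambda>j. (\<nu> gchoose j) * beta_moment \<nu> a j) sums X"
    and Y: "(\<lambda>j. (\<nu> gchoose j) * beta_moment \<nu> a (j + 2)) sums Y"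
    and 0: "(\<lambda>J. (a + of_nat (J + 1)) * (\<nu> + 1 gchoose (J + 1)) * beta_moment \<nu> a (J + 1)) \<longlonglongrightarrow> 0"
  shows "a * X = (a + 2 + 2 * \<nu>) * Y"
proof -
  have "(\<lambda>J. \<Sum>m<J + 2. (\<nu> gchoose m) * beta_moment \<nu> a m) \<longlonglongrightarrow> X"
    using LIMSEQ_ignore_initial_segment[OF X[unfolded sums_def], of 2] .
  hence "(\<lambda>J. a * (\<Sum>m<J + 2. (\<nu> gchoose m) * beta_moment \<nu> a m)
     - (a + 2 + 2 * \<nu>) * (\<Sum>m<J. (\<nu> gchoose m) * beta_moment \<nu> a (m + 2))) \<longlonglongrightarrow> a * X - (a + 2 + 2 * \<nu>) * Y"
    using Y unfolding sums_def by (intro tendsto_diff tendsto_mult tendsto_const)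
  hence "a * X - (a + 2 + 2 * \<nu>) * Y = 0"
    unfolding beta_series_telescope using 0 by (rule LIMSEQ_unique)
  thus ?thesis by simp
qed

lemma pochhammer_2: "pochhammer (a :: complex) 2 = a * (a + 1)"
  by (simp add: numeral_2_eq_2 pochhammer_rec')

lemma beta_moment_nonpos_eq_0:
  assumes "m > n"
  shows "beta_moment \<nu> (- of_nat n) m = 0"
  using assms by (simp add: beta_moment_def pochhammer_of_nat_eq_0_lemma)

text \<open>
  For \<open>a = -n\<close> the moments vanish beyond \<open>n\<close>, so that the series is a finite sum for every \<open>\<nu>\<close>. The recurrence descends in steps of two to the cases \<open>a = 0\<close> and \<open>a = -1\<close>.
\<close>

lemma beta_series_nonpos:
  "(\<lambda>j. (\<nu> gchoose j) * beta_moment \<nu> (- of_nat n) j) sums even_beta \<nu> (- of_nat n)"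
proof (induction n rule: less_induct)
  case (less n)
  let ?a = "- of_nat n :: complex"
  have sums: "(\<lambda>j. (\<nu> gchoose j) * beta_moment \<nu> ?a j) sums (\<Sum>j\<le>n. (\<nu> gchoose j) * beta_moment \<nu> ?a j)"
    by (rule sums_finite) (auto simp: beta_moment_nonpos_eq_0)
  show ?case
  proof (cases "n < 2")
    case True
    hence "n = 0 \<or> n = 1" by auto
    thus ?thesis
    proof
      assume "n = 0"
      thus ?thesis using sums by (simp add: beta_moment_def add_ac)
    next
      assume n: "n = 1"
      have "\<nu> * rGamma (\<nu> + 1) = rGamma \<nu>" by (rule rGamma_plus1)
      thus ?thesis using sums n
        by (simp add: beta_moment_def even_beta_def rGamma_eq_zero_iff)
    qed
  next
    case False
    then obtain k where n: "n = k + 2" using le_Suc_ex[of 2 n] by auto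
    have a: "?a + 2 = - of_nat k" by (simp add: n)
    have IH: "(\<lambda>j. (\<nu> gchoose j) * beta_moment \<nu> (?a + 2) j) sums even_beta \<nu> (?a + 2)"
      unfolding a using less[of k] n by simp
    have shift: "beta_moment \<nu> ?a (j + 2) = ?a * (?a + 1) * beta_moment \<nu> (?a + 2) j" for j
      using beta_moment_add[of \<nu> ?a 2 j] by (simp add: pochhammer_2 add_ac)
    have Y: "(\<lambda>j. (\<nu> gchoose j) * beta_moment \<nu> ?a (j + 2)) sums (?a * (?a + 1) * even_beta \<nu> (?a + 2))"
      unfolding shift using sums_mult[OF IH, of "?a * (?a + 1)"] by (simp add: mult_ac)
    have "eventually (\<lambda>J. (?a + of_nat (J + 1)) * (\<nu> + 1 gchoose (J + 1)) * beta_moment \<nu> ?a (J + 1) = 0) sequentially"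
      using eventually_ge_at_top[of n] by eventually_elim (simp add: beta_moment_nonpos_eq_0)
    hence "(\<lambda>J. (?a + of_nat (J + 1)) * (\<nu> + 1 gchoose (J + 1)) * beta_moment \<nu> ?a (J + 1)) \<longlonglongrightarrow> 0"
      by (rule tendsto_eventually)
    from beta_series_rec[OF sums Y this]
    have "?a * (\<Sum>j\<le>n. (\<nu> gchoose j) * beta_moment \<nu> ?a j) = ?a * even_beta \<nu> ?a"
      unfolding even_beta_plus2[of \<nu> ?a] by (simp only: mult_ac)
    moreover have "?a \<noteq> 0" using n unfolding neg_equal_0_iff_equal of_nat_eq_0_iff by simp
    ultimately show ?thesis using sums by simp
  qed
qed

lemma beta_series_shift2:
  assumes "Re \<nu> > - 1"
  shows "a * (\<Sum>j. (\<nu> gchoose j) * beta_moment \<nu> a j)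
       = (a + 2 + 2 * \<nu>) * (\<Sum>j. (\<nu> gchoose j) * beta_moment \<nu> a (j + 2))"
proof (rule beta_series_rec)
  show "(\<lambda>j. (\<nu> gchoose j) * beta_moment \<nu> a j) sums (\<Sum>j. (\<nu> gchoose j) * beta_moment \<nu> a j)"
    using beta_series_summable_bounded(1)[OF assms, of a 0] by (simp add: summable_sums)
  show "(\<lambda>j. (\<nu> gchoose j) * beta_moment \<nu> a (j + 2)) sums (\<Sum>j. (\<nu> gchoose j) * beta_moment \<nu> a (j + 2))"
    by (rule summable_sums[OF beta_series_summable_bounded(1)[OF assms]])
qed (rule beta_series_boundary[OF assms])

lemma plus_nat_notin_nonpos_Ints:
  assumes "(a :: complex) \<notin> \<int>\<^sub>\<le>\<^sub>0"
  shows "a + of_nat k \<notin> \<int>\<^sub>\<le>\<^sub>0"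
proof
  assume "a + of_nat k \<in> \<int>\<^sub>\<le>\<^sub>0"
  then obtain n where "a + of_nat k = - of_nat n" by (auto elim: nonpos_Ints_cases')
  hence "a = - of_nat n - of_nat k" by (metis add_diff_cancel_right')
  hence "a = - of_nat (n + k)" by simp
  thus False using assms by (metis minus_of_nat_in_nonpos_Ints)
qed

text \<open>
  Both sides satisfy the same recurrence from \<open>a\<close> to \<open>a + 2\<close>, hence their cross products with the values at
  \<open>a + 2 N\<close> agree (\<open>cross\<close>), also where a factor of the recurrence vanishes. After multiplication by
  \<open>(a)_(2 N)\<close> these values are both asymptotic to the same multiple of \<open>N^(-\<nu> - 1)\<close>. The condition on \<open>\<nu>\<close> makes the binomial
  coefficients absolutely summable.
\<close>

lemma beta_series_right_half_plane:
  assumes \<nu>: "Re \<nu> > 0" and a: "a \<notin> \<int>\<^sub>\<le>\<^sub>0"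
  shows "(\<Sum>j. (\<nu> gchoose j) * beta_moment \<nu> a j) = even_beta \<nu> a"
proof -
  define S where "S a = (\<Sum>j. (\<nu> gchoose j) * beta_moment \<nu> a j)" for a
  have sm: "summable (\<lambda>j. (\<nu> gchoose j) * beta_moment \<nu> a (j + m))" for a m
    using \<nu> by (intro beta_series_summable_bounded) auto
  have shift: "(\<Sum>j. (\<nu> gchoose j) * beta_moment \<nu> a (m + j)) = pochhammer a m * S (a + of_nat m)" for a m
    using suminf_mult[OF sm[of "a + of_nat m" 0], of "pochhammer a m"]
    by (simp add: S_def beta_moment_add mult_ac)
  have S_rec: "S a = (a + 1) * (a + 2 + 2 * \<nu>) * S (a + 2)" if "a \<notin> \<int>\<^sub>\<le>\<^sub>0" for a
  proof -
    have "a * S a = (a + 2 + 2 * \<nu>) * (\<Sum>j. (\<nu> gchoose j) * beta_moment \<nu> a (j + 2))"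
      unfolding S_def using \<nu> by (intro beta_series_shift2) auto
    also have "(\<Sum>j. (\<nu> gchoose j) * beta_moment \<nu> a (j + 2)) = a * (a + 1) * S (a + 2)"
      using shift[of a 2] by (simp add: pochhammer_2 add_ac)
    finally have "a * S a = a * ((a + 1) * (a + 2 + 2 * \<nu>) * S (a + 2))" by (simp only: mult_ac)
    thus ?thesis using that by auto
  qed
  have cross: "S a * even_beta \<nu> (a + of_nat (2 * N)) = even_beta \<nu> a * S (a + of_nat (2 * N))"
    if "a \<notin> \<int>\<^sub>\<le>\<^sub>0" for a N
    using that
  proof (induction N arbitrary: a)
    case (Suc N)
    have e: "a + of_nat (2 * Suc N) = (a + 2) + of_nat (2 * N)" by simp
    have "a + 2 \<notin> \<int>\<^sub>\<le>\<^sub>0" using plus_nat_notin_nonpos_Ints[OF Suc.prems, of 2] by simp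
    from Suc.IH[OF this] show ?case
      unfolding e S_rec[OF Suc.prems] even_beta_plus2[of \<nu> a] by (simp only: mult.assoc) 
  qed simp
  have two: "filterlim (\<lambda>N :: nat. 2 * N) at_top sequentially" by real_asymp
  have "(\<lambda>N. (\<Sum>j. (\<nu> gchoose j) * beta_moment \<nu> a (N + j)) * of_nat N powr (\<nu> + 1))
      \<longlonglongrightarrow> (\<Sum>j. \<nu> gchoose j) * rGamma a"
  proof (rule shifted_series_LIMSEQ[OF beta_moment_LIMSEQ])
    show "summable (\<lambda>j. norm (\<nu> gchoose j) * (1 + real j) powr 0)"
      by (rule summable_norm_gbinomial_powr[OF \<nu>])
    show "(\<lambda>j. (\<nu> gchoose j) * beta_moment \<nu> a (N + j)) sums (\<Sum>j. (\<nu> gchoose j) * beta_moment \<nu> a (N + j))" for N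
      using sm[of a N] by (simp add: add_ac summable_sums)
  qed (use \<nu> in auto)
  also have "(\<Sum>j. \<nu> gchoose j) = 2 powr \<nu>"
    using gbinomial_sums_two_powr[OF \<nu>] by (simp add: sums_iff)
  finally have "(\<lambda>N. pochhammer a N * S (a + of_nat N) * of_nat N powr (\<nu> + 1)) \<longlonglongrightarrow> 2 powr \<nu> * rGamma a"
    unfolding shift .
  from filterlim_compose[OF this two]
  have "(\<lambda>N. even_beta \<nu> a * (pochhammer a (2 * N) * S (a + of_nat (2 * N)) * of_nat (2 * N) powr (\<nu> + 1)))
      \<longlonglongrightarrow> even_beta \<nu> a * (2 powr \<nu> * rGamma a)"
    by (rule tendsto_mult[OF tendsto_const])
  moreover have "(\<lambda>N. S a * (even_moment \<nu> a (2 * N) * of_nat (2 * N) powr (\<nu> + 1)))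
      \<longlonglongrightarrow> S a * (2 powr \<nu> * rGamma a)"
    by (intro tendsto_mult tendsto_const filterlim_compose[OF even_moment_LIMSEQ two])
  moreover have "even_beta \<nu> a * (pochhammer a (2 * N) * S (a + of_nat (2 * N)) * of_nat (2 * N) powr (\<nu> + 1))
      = S a * (even_moment \<nu> a (2 * N) * of_nat (2 * N) powr (\<nu> + 1))" for N
  proof -
    have "even_beta \<nu> a * (pochhammer a (2 * N) * S (a + of_nat (2 * N)) * of_nat (2 * N) powr (\<nu> + 1))
      = (even_beta \<nu> a * S (a + of_nat (2 * N))) * (pochhammer a (2 * N) * of_nat (2 * N) powr (\<nu> + 1))"
      by (simp only: mult_ac)
    thus ?thesis unfolding cross[OF a, symmetric] even_moment_def by (simp only: mult_ac)
  qed
  ultimately have "even_beta \<nu> a * (2 powr \<nu> * rGamma a) = S a * (2 powr \<nu> * rGamma a)"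
    by (simp only: LIMSEQ_unique)
  moreover have "2 powr \<nu> * rGamma a \<noteq> 0"
    using a by (simp add: rGamma_eq_zero_iff)
  ultimately show ?thesis unfolding S_def by (metis mult_cancel_right)
qed

text \<open>
  Partial sum form of \<open>(1 - u) (1 + u)^(\<nu> + 1) = (1 - u^2) (1 + u)^\<nu>\<close>, with \<open>b\<close> and \<open>f\<close> the coefficients of
  \<open>(1 + u)^\<nu>\<close> and \<open>(1 + u)^(\<nu> + 1)\<close>.
\<close>

lemma beta_series_raise_partial:
  fixes f b h :: "nat \<Rightarrow> complex"
  assumes "f 0 = b 0" "\<And>j. f (Suc j) = b j + b (Suc j)"
  shows "(\<Sum>m<J + 2. f m * (h m - h (Suc m))) =
     (\<Sum>m<J + 2. b m * h m) - (\<Sum>m<J. b m * h (m + 2)) - f (Suc J) * h (J + 2)"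
  by (induction J) (simp_all add: assms numeral_2_eq_2 algebra_simps)

text \<open>
  The relation between \<open>\<nu>\<close> and \<open>\<nu> + 1\<close> and the recurrence in \<open>a\<close> are two linear equations for the sum \<open>S 0\<close> and its
  shift \<open>S 2\<close>. They determine \<open>S 0\<close> from the value at \<open>\<nu> + 1\<close>, which lies in the half plane already treated.
\<close>

lemma beta_series_strip:
  assumes \<nu>: "Re \<nu> > - 1" and a: "a \<notin> \<int>\<^sub>\<le>\<^sub>0"
  shows "(\<Sum>j. (\<nu> gchoose j) * beta_moment \<nu> a j) = even_beta \<nu> a"
proof -
  define S where "S m = (\<Sum>j. (\<nu> gchoose j) * beta_moment \<nu> a (j + m))" for m
  have S: "(\<lambda>j. (\<nu> gchoose j) * beta_moment \<nu> a (j + m)) sums S m" for m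
    unfolding S_def by (rule summable_sums[OF beta_series_summable_bounded(1)[OF \<nu>]])
  have S0: "(\<lambda>J. \<Sum>j<J + 2. (\<nu> gchoose j) * beta_moment \<nu> a j) \<longlonglongrightarrow> S 0"
    using LIMSEQ_ignore_initial_segment[OF S[of 0, unfolded sums_def], of 2] by simp
  have upper: "(\<lambda>j. (\<nu> + 1 gchoose j) * beta_moment (\<nu> + 1) a j) sums even_beta (\<nu> + 1) a"
    using beta_series_right_half_plane[of "\<nu> + 1" a] beta_series_summable_bounded(1)[of "\<nu> + 1" a 0] \<nu> a
    by (simp add: sums_iff)
  have "(\<lambda>J. (\<nu> + 1 gchoose Suc J) * beta_moment \<nu> a (J + 2)) \<longlonglongrightarrow> 0"
  proof -
    obtain K where K: "K > 0" "\<And>n. norm (\<nu> + 1 gchoose n) \<le> K * (1 + real n) powr (- Re \<nu> - 2)"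
      using gbinomial_norm_bound[of "\<nu> + 1"] by (auto simp: algebra_simps)
    obtain L where L: "L > 0" "\<And>n. norm (beta_moment \<nu> a n) \<le> L * (1 + real n) powr (- Re \<nu> - 1)"
      by (rule beta_moment_norm_bound[of \<nu> a]) blast
    have bound: "norm ((\<nu> + 1 gchoose Suc J) * beta_moment \<nu> a (J + 2)) \<le> K * L * (1 + real J) powr (- 2 * Re \<nu> - 3)" for J
    proof -
      have "norm (\<nu> + 1 gchoose Suc J) \<le> K * (1 + real (Suc J)) powr (- Re \<nu> - 2)" by (rule K)
      also have "\<dots> \<le> K * (1 + real J) powr (- Re \<nu> - 2)"
        using K(1) \<nu> by (intro mult_left_mono powr_mono2') auto
      finally have 1: "norm (\<nu> + 1 gchoose Suc J) \<le> \<dots>" .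
      have "norm (beta_moment \<nu> a (J + 2)) \<le> L * (1 + real (J + 2)) powr (- Re \<nu> - 1)" by (rule L)
      also have "\<dots> \<le> L * (1 + real J) powr (- Re \<nu> - 1)"
        using L(1) \<nu> by (intro mult_left_mono powr_mono2') auto
      finally have 2: "norm (beta_moment \<nu> a (J + 2)) \<le> \<dots>" .
      have "norm ((\<nu> + 1 gchoose Suc J) * beta_moment \<nu> a (J + 2)) \<le>
          (K * (1 + real J) powr (- Re \<nu> - 2)) * (L * (1 + real J) powr (- Re \<nu> - 1))"
        unfolding norm_mult using K(1) by (intro mult_mono 1 2) auto
      also have "\<dots> = K * L * ((1 + real J) powr (- Re \<nu> - 2) * (1 + real J) powr (- Re \<nu> - 1))"
        by (simp only: mult_ac)
      finally show ?thesis unfolding powr_add[symmetric] by simp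
    qed
    show ?thesis
    proof (rule Lim_null_comparison[OF always_eventually, OF allI, OF bound])
      show "(\<lambda>J. K * L * (1 + real J) powr (- 2 * Re \<nu> - 3)) \<longlonglongrightarrow> 0"
        using \<nu> by (intro one_plus_powr_tendsto_0) auto
    qed
  qed
  hence "(\<lambda>J. (\<Sum>j<J + 2. (\<nu> gchoose j) * beta_moment \<nu> a j) - (\<Sum>j<J. (\<nu> gchoose j) * beta_moment \<nu> a (j + 2))
       - (\<nu> + 1 gchoose Suc J) * beta_moment \<nu> a (J + 2)) \<longlonglongrightarrow> S 0 - S 2 - 0"
    using S[of 2] S0 unfolding sums_def by (intro tendsto_diff)
  also have "(\<lambda>J. (\<Sum>j<J + 2. (\<nu> gchoose j) * beta_moment \<nu> a j) - (\<Sum>j<J. (\<nu> gchoose j) * beta_moment \<nu> a (j + 2))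
       - (\<nu> + 1 gchoose Suc J) * beta_moment \<nu> a (J + 2))
     = (\<lambda>J. (1 + \<nu>) * (\<Sum>m<J + 2. (\<nu> + 1 gchoose m) * beta_moment (\<nu> + 1) a m))"
  proof
    fix J
    have "(\<Sum>m<J + 2. (\<nu> + 1 gchoose m) * (beta_moment \<nu> a m - beta_moment \<nu> a (Suc m)))
      = (\<Sum>j<J + 2. (\<nu> gchoose j) * beta_moment \<nu> a j) - (\<Sum>j<J. (\<nu> gchoose j) * beta_moment \<nu> a (j + 2))
       - (\<nu> + 1 gchoose Suc J) * beta_moment \<nu> a (J + 2)"
      by (rule beta_series_raise_partial) (simp_all add: gbinomial_Suc_Suc)
    thus "(\<Sum>j<J + 2. (\<nu> gchoose j) * beta_moment \<nu> a j) - (\<Sum>j<J. (\<nu> gchoose j) * beta_moment \<nu> a (j + 2))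
       - (\<nu> + 1 gchoose Suc J) * beta_moment \<nu> a (J + 2)
      = (1 + \<nu>) * (\<Sum>m<J + 2. (\<nu> + 1 gchoose m) * beta_moment (\<nu> + 1) a m)"
      unfolding beta_moment_raise[symmetric] by (simp only: sum_distrib_left mult.left_commute)
  qed
  finally have "(\<lambda>J. (1 + \<nu>) * (\<Sum>m<J + 2. (\<nu> + 1 gchoose m) * beta_moment (\<nu> + 1) a m)) \<longlonglongrightarrow> S 0 - S 2 - 0" .
  moreover have "(\<lambda>J. (1 + \<nu>) * (\<Sum>m<J + 2. (\<nu> + 1 gchoose m) * beta_moment (\<nu> + 1) a m)) \<longlonglongrightarrow> (1 + \<nu>) * even_beta (\<nu> + 1) a"
    by (intro tendsto_mult tendsto_const LIMSEQ_ignore_initial_segment[OF upper[unfolded sums_def]])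
  ultimately have diff: "S 0 - S 2 = (1 + \<nu>) * even_beta (\<nu> + 1) a"
    using LIMSEQ_unique by fastforce
  have rec: "a * S 0 = (a + 2 + 2 * \<nu>) * S 2"
    using beta_series_shift2[OF \<nu>, of a] by (simp add: S_def)
  have "(1 + \<nu>) * S 0 = (1 + \<nu>) * ((1 + \<nu> + a / 2) * even_beta (\<nu> + 1) a)"
    using diff rec by (simp add: field_simps)
  moreover have "1 + \<nu> \<noteq> 0"
    using \<nu> by (auto simp: complex_eq_iff)
  ultimately show ?thesis
    using even_beta_raise[of \<nu> a] by (simp add: S_def)
qed

text \<open>
  On the level of moments: \<open>(1 - u)^\<nu> (1 + u)^\<nu> = (1 - u^2)^\<nu>\<close>.
\<close>

theorem beta_moment_binomial_sums:
  assumes "Re \<nu> > - 1 \<or> a \<in> \<int>\<^sub>\<le>\<^sub>0"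
  shows "(\<lambda>j. (\<nu> gchoose j) * beta_moment \<nu> a (j + m)) sums even_moment \<nu> a m"
proof -
  have main: "(\<lambda>j. (\<nu> gchoose j) * beta_moment \<nu> A j) sums even_beta \<nu> A"
    if "Re \<nu> > - 1 \<or> A \<in> \<int>\<^sub>\<le>\<^sub>0" for A
  proof (cases "A \<in> \<int>\<^sub>\<le>\<^sub>0")
    case True
    then obtain n where "A = - of_nat n" by (auto elim: nonpos_Ints_cases')
    thus ?thesis using beta_series_nonpos by simp
  next
    case False
    thus ?thesis
      using that beta_series_strip[of \<nu> A] beta_series_summable_bounded(1)[of \<nu> A 0] by (simp add: sums_iff)
  qed
  have shift: "beta_moment \<nu> a (j + m) = pochhammer a m * beta_moment \<nu> (a + of_nat m) j" for j
    using beta_moment_add[of \<nu> a m j] by (simp add: add_ac)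
  show ?thesis
  proof (cases "Re \<nu> > - 1 \<or> a + of_nat m \<in> \<int>\<^sub>\<le>\<^sub>0")
    case True
    from sums_mult[OF main[OF this], of "pochhammer a m"] show ?thesis
      by (simp add: shift even_moment_def mult_ac)
  next
    case False
    with assms obtain n where n: "a = - of_nat n" by (auto elim: nonpos_Ints_cases')
    have "m > n"
    proof (rule ccontr)
      assume "\<not> m > n"
      hence "a + of_nat m = - of_nat (n - m)" using n by (simp add: of_nat_diff)
      thus False using False by (metis minus_of_nat_in_nonpos_Ints)
    qed
    hence "pochhammer a m = 0" using n by (simp add: pochhammer_of_nat_eq_0_lemma)
    thus ?thesis by (simp add: shift even_moment_def)
  qed
qed

section \<open>Dividing the second weight by a power of 1 + u\<close>

text \<open>
  The growth of the moments, of order \<open>-\<nu> - 1\<close>, and that of the coefficients, of order \<open>\<nu> - 1\<close>, always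
  combine to \<open>j^(-2)\<close>. This series therefore converges absolutely for all parameters.
\<close>

lemma even_series_norm_bound:
  "\<exists>K\<ge>0. \<forall>j m. norm ((- \<nu> gchoose j) * even_moment \<nu> a (j + m))
     \<le> K * (1 + real j) powr (- 2) * (1 + real m) powr \<bar>Re \<nu> + 1\<bar>"
proof -
  obtain B where B: "B > 0" "\<And>n. norm (- \<nu> gchoose n) \<le> B * (1 + real n) powr (Re \<nu> - 1)"
    using gbinomial_norm_bound[of "- \<nu>"] by auto
  obtain G where G: "G > 0" "\<And>n. norm (even_moment \<nu> a n) \<le> G * (1 + real n) powr (- Re \<nu> - 1)"
    by (rule even_moment_norm_bound[of \<nu> a]) blast
  show ?thesis
  proof (intro exI conjI allI)
    show "B * G \<ge> 0" using B(1) G(1) by simp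
    fix j m
    have abs: "\<bar>- Re \<nu> - 1\<bar> = \<bar>Re \<nu> + 1\<bar>" by linarith
    have "norm (even_moment \<nu> a (j + m)) \<le> G * (1 + real (j + m)) powr (- Re \<nu> - 1)" by (rule G)
    also have "\<dots> \<le> G * ((1 + real j) powr (- Re \<nu> - 1) * (1 + real m) powr \<bar>- Re \<nu> - 1\<bar>)"
      using G(1) by (intro mult_left_mono one_plus_add_powr_le) auto
    finally have "norm ((- \<nu> gchoose j) * even_moment \<nu> a (j + m))
        \<le> (B * (1 + real j) powr (Re \<nu> - 1)) *
           (G * ((1 + real j) powr (- Re \<nu> - 1) * (1 + real m) powr \<bar>- Re \<nu> - 1\<bar>))"
      unfolding norm_mult using B(1) by (intro mult_mono B(2)) auto
    also have "\<dots> = B * G * ((1 + real j) powr (Re \<nu> - 1) * (1 + real j) powr (- Re \<nu> - 1))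
           * (1 + real m) powr \<bar>Re \<nu> + 1\<bar>"
      unfolding abs by (simp only: mult_ac)
    finally show "norm ((- \<nu> gchoose j) * even_moment \<nu> a (j + m))
        \<le> B * G * (1 + real j) powr (- 2) * (1 + real m) powr \<bar>Re \<nu> + 1\<bar>"
      unfolding powr_add[symmetric] by simp
  qed
qed

lemma summable_even_series: "summable (\<lambda>j. (- \<nu> gchoose j) * even_moment \<nu> a (j + m))"
proof -
  obtain K where K: "\<And>j m. norm ((- \<nu> gchoose j) * even_moment \<nu> a (j + m))
     \<le> K * (1 + real j) powr (- 2) * (1 + real m) powr \<bar>Re \<nu> + 1\<bar>"
    using even_series_norm_bound[of \<nu> a] by blast
  have "summable (\<lambda>j. K * (1 + real j) powr (- 2) * (1 + real m) powr \<bar>Re \<nu> + 1\<bar>)"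
    by (intro summable_mult summable_mult2 summable_one_plus_powr) auto
  thus ?thesis by (rule summable_comparison_test') (rule K)
qed

text \<open>
  Here the total derivative is that of \<open>u^a (1 - u^2)^(\<nu> + 1) (1 + u)^(-\<nu> - 1)\<close>, which equals
  \<open>u^(a - 1) (1 - u^2)^\<nu> (1 + u)^(-\<nu>) (a - (a + \<nu> + 1) u)\<close>.
\<close>

lemma even_series_telescope:
  defines "y \<equiv> \<lambda>\<nu> a J. (a + of_nat J) * (- \<nu> - 1 gchoose J) * even_moment \<nu> a J"
  shows "a * (\<Sum>m<J + 2. (- \<nu> gchoose m) * even_moment \<nu> a m)
     - (a + \<nu> + 1) * (\<Sum>m<J + 1. (- \<nu> gchoose m) * even_moment \<nu> a (m + 1)) = y \<nu> a J + y \<nu> a (Suc J)"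
proof (induction J)
  case 0
  thus ?case by (simp add: numeral_2_eq_2 y_def algebra_simps)
next
  case (Suc J)
  define f where "f m = (- \<nu> - 1 gchoose m)" for m
  define g where "g = even_moment \<nu> a"
  have b: "(- \<nu> gchoose Suc m) = f m + f (Suc m)" for m
    using gbinomial_Suc_Suc[of "- \<nu> - 1" m] by (simp add: f_def)
  have f1: "of_nat (Suc J) * f (Suc J) = (- \<nu> - 1 - of_nat J) * f J"
    and f2: "of_nat (Suc (Suc J)) * f (Suc (Suc J)) = (- \<nu> - 1 - of_nat (Suc J)) * f (Suc J)"
    unfolding f_def by (rule gbinomial_Suc_mult)+
  have g: "(a + of_nat J) * g J = (a + of_nat J + 2 * \<nu> + 2) * g (Suc (Suc J))"
    unfolding g_def using even_moment_rec[of a J \<nu>] by simp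
  have coeff: "a * (f' + f'') - (a + \<nu> + 1) * (f0 + f') = (a + (N + 2)) * f'' - (a + N + 2 * \<nu> + 2) * f0"
    if "(N + 1) * f' = (- \<nu> - 1 - N) * f0" "(N + 2) * f'' = (- \<nu> - 1 - (N + 1)) * f'" for f0 f' f'' N
    using that by algebra
  have N: "complex_of_nat (Suc J) = of_nat J + 1" "complex_of_nat (Suc (Suc J)) = of_nat J + 2"
    by simp_all
  have "a * (f (Suc J) + f (Suc (Suc J))) - (a + \<nu> + 1) * (f J + f (Suc J))
     = (a + of_nat (Suc (Suc J))) * f (Suc (Suc J)) - (a + of_nat J + 2 * \<nu> + 2) * f J"
    using coeff f1 f2 unfolding N by blast
  moreover have "U * v = A * B * v - E * D * w" if "U = A * B - C * D" "E * w = C * v" for U v w A B C D E :: complex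
    using that by algebra
  ultimately have *: "(a * (f (Suc J) + f (Suc (Suc J))) - (a + \<nu> + 1) * (f J + f (Suc J))) * g (Suc (Suc J))
     = (a + of_nat (Suc (Suc J))) * f (Suc (Suc J)) * g (Suc (Suc J)) - (a + of_nat J) * f J * g J"
    using g by blast
  have yf: "y \<nu> a m = (a + of_nat m) * f m * g m" for m
    by (simp add: y_def f_def g_def)
  have combine: "a * (S + u * v) - c * (T + w * v) = X1 + X2" if "a * S - c * T = X0 + X1" "(a * u - c * w) * v = X2 - X0"
    for S T u v w c X0 X1 X2
    using that by (simp add: algebra_simps)
  have IH: "a * (\<Sum>m<Suc (Suc J). (- \<nu> gchoose m) * g m) - (a + \<nu> + 1) * (\<Sum>m<Suc J. (- \<nu> gchoose m) * g (Suc m))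
      = (a + of_nat J) * f J * g J + y \<nu> a (Suc J)"
    using Suc.IH unfolding g_def[symmetric] yf[of J] by (simp only: add_2_eq_Suc' add_Suc_right add_0_right One_nat_def)
  show ?case
    unfolding g_def[symmetric] yf[of "Suc (Suc J)"]
    using combine[OF IH *]
    by (simp only: add_2_eq_Suc' add_Suc_right add_0_right One_nat_def b sum.lessThan_Suc[of _ "Suc J"] sum.lessThan_Suc[of _ "Suc (Suc J)"])
qed

text \<open>
  The single boundary terms are bounded but do not tend to zero; their signs alternate and \<open>(-1)^J y J\<close>
  converges, so that consecutive ones cancel in the limit.
\<close>

lemma even_series_boundary:
  fixes \<nu> a :: complex
  defines "y \<equiv> \<lambda>J. (a + of_nat J) * (- \<nu> - 1 gchoose J) * even_moment \<nu> a J"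
  shows "(\<lambda>J. y J + y (Suc J)) \<longlonglongrightarrow> 0"
proof -
  define z where "z J = (-1) ^ J * y J" for J
  have "(\<lambda>J. a * inverse (of_nat J) + 1) \<longlonglongrightarrow> a * 0 + 1"
    by (intro tendsto_intros lim_inverse_n)
  hence "(\<lambda>J. (a * inverse (of_nat J) + 1) * ((-1) ^ J * (- \<nu> - 1 gchoose J) * of_nat J powr (- \<nu> - 1 + 1))
      * (even_moment \<nu> a J * of_nat J powr (\<nu> + 1)))
      \<longlonglongrightarrow> (a * 0 + 1) * rGamma (- (- \<nu> - 1)) * (2 powr \<nu> * rGamma a)"
    by (intro tendsto_mult gbinomial_LIMSEQ even_moment_LIMSEQ)
  moreover have "eventually (\<lambda>J. (a * inverse (of_nat J) + 1) * ((-1) ^ J * (- \<nu> - 1 gchoose J) * of_nat J powr (- \<nu> - 1 + 1))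
      * (even_moment \<nu> a J * of_nat J powr (\<nu> + 1)) = z J) sequentially"
    using eventually_gt_at_top[of 0]
  proof eventually_elim
    case (elim J)
    have p: "of_nat J powr (- \<nu> - 1 + 1) * of_nat J powr (\<nu> + 1) = complex_of_nat J"
      using elim by (simp flip: powr_add)
    have "(a * inverse (of_nat J) + 1) * ((-1) ^ J * (- \<nu> - 1 gchoose J) * of_nat J powr (- \<nu> - 1 + 1))
      * (even_moment \<nu> a J * of_nat J powr (\<nu> + 1))
      = (a * inverse (of_nat J) + 1) * (of_nat J powr (- \<nu> - 1 + 1) * of_nat J powr (\<nu> + 1))
        * ((-1) ^ J * (- \<nu> - 1 gchoose J) * even_moment \<nu> a J)"
      by (simp only: mult_ac)
    also have "(a * inverse (of_nat J) + 1) * (of_nat J powr (- \<nu> - 1 + 1) * of_nat J powr (\<nu> + 1)) = a + of_nat J"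
      unfolding p using elim by (simp add: field_simps)
    finally show ?case by (simp add: z_def y_def mult_ac)
  qed
  ultimately obtain l where z: "z \<longlonglongrightarrow> l"
    by (blast intro: Lim_transform_eventually)
  have "(\<lambda>J. z J - z (Suc J)) \<longlonglongrightarrow> l - l"
    by (intro tendsto_diff z LIMSEQ_Suc)
  hence "(\<lambda>J. norm (z J - z (Suc J))) \<longlonglongrightarrow> 0"
    using tendsto_norm_zero by fastforce
  also have "(\<lambda>J. norm (z J - z (Suc J))) = (\<lambda>J. norm (y J + y (Suc J)))"
  proof
    fix J
    have "z J - z (Suc J) = (-1) ^ J * (y J + y (Suc J))" by (simp add: z_def algebra_simps)
    thus "norm (z J - z (Suc J)) = norm (y J + y (Suc J))" by (simp add: norm_mult norm_power)
  qed
  finally show ?thesis by (rule tendsto_norm_zero_cancel)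
qed

lemma even_series_shift1:
  assumes "a \<noteq> 0"
  shows "(\<Sum>j. (- \<nu> gchoose j) * even_moment \<nu> a j)
       = (a + \<nu> + 1) * (\<Sum>j. (- \<nu> gchoose j) * even_moment \<nu> (a + 1) j)"
proof -
  define S where "S a = (\<Sum>j. (- \<nu> gchoose j) * even_moment \<nu> a j)" for a
  have S: "(\<lambda>j. (- \<nu> gchoose j) * even_moment \<nu> a j) sums S a" for a
    using summable_even_series[of \<nu> a 0] by (simp add: S_def summable_sums)
  have shift: "even_moment \<nu> a (j + 1) = a * even_moment \<nu> (a + 1) j" for j
    using even_moment_add[of \<nu> a 1 j] by (simp add: add_ac)
  have S1: "(\<lambda>j. (- \<nu> gchoose j) * even_moment \<nu> a (j + 1)) sums (a * S (a + 1))"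
    unfolding shift using sums_mult[OF S[of "a + 1"], of a] by (simp only: mult_ac)
  have "(\<lambda>J. a * (\<Sum>m<J + 2. (- \<nu> gchoose m) * even_moment \<nu> a m)
     - (a + \<nu> + 1) * (\<Sum>m<J + 1. (- \<nu> gchoose m) * even_moment \<nu> a (m + 1)))
     \<longlonglongrightarrow> a * S a - (a + \<nu> + 1) * (a * S (a + 1))"
    by (intro tendsto_diff tendsto_mult tendsto_const LIMSEQ_ignore_initial_segment[OF S[unfolded sums_def]]
        LIMSEQ_ignore_initial_segment[OF S1[unfolded sums_def]])
  hence "a * S a - (a + \<nu> + 1) * (a * S (a + 1)) = 0"
    unfolding even_series_telescope using even_series_boundary[of a \<nu>] by (rule LIMSEQ_unique)
  hence "a * S a = a * ((a + \<nu> + 1) * S (a + 1))" by (simp add: mult_ac)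
  thus ?thesis using assms by (simp add: S_def)
qed

lemma even_series_nonpos:
  "(\<Sum>j. (- \<nu> gchoose j) * even_moment \<nu> (- of_nat n) j) = rGamma (- of_nat n + 1 + \<nu>)"
proof (induction n)
  case 0
  have "(\<lambda>j. (- \<nu> gchoose j) * even_moment \<nu> 0 j) sums (\<Sum>j\<le>0. (- \<nu> gchoose j) * even_moment \<nu> 0 j)"
    by (rule sums_finite) (auto simp: even_moment_def pochhammer_0_left)
  thus ?case by (simp add: sums_iff even_moment_def)
next
  case (Suc n)
  have "- of_nat (Suc n) \<noteq> (0 :: complex)"
    unfolding neg_equal_0_iff_equal of_nat_eq_0_iff by simp
  note step = even_series_shift1[OF this, of \<nu>]
  have e: "- of_nat (Suc n) + 1 = (- of_nat n :: complex)"
    "- of_nat n + 1 + \<nu> = - of_nat (Suc n) + \<nu> + 1 + 1" by simp_all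
  have "(\<Sum>j. (- \<nu> gchoose j) * even_moment \<nu> (- of_nat (Suc n)) j)
     = (- of_nat (Suc n) + \<nu> + 1) * rGamma (- of_nat (Suc n) + \<nu> + 1 + 1)"
    using step unfolding e(1) Suc.IH unfolding e(2) .
  also have "\<dots> = rGamma (- of_nat (Suc n) + 1 + \<nu>)"
    unfolding rGamma_plus1 by (simp add: add_ac)
  finally show ?case .
qed

text \<open>
  The same argument as for the first weight, with the roles of the two moment sequences exchanged and
  with steps of length one. Now the coefficients of \<open>(1 + u)^(-\<nu>)\<close> are summable for \<open>Re \<nu> < 0\<close>.
\<close>

lemma even_series_left_half_plane:
  assumes \<nu>: "Re \<nu> < 0"
  shows "(\<Sum>j. (- \<nu> gchoose j) * even_moment \<nu> a j) = rGamma (a + 1 + \<nu>)"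
proof (cases "a \<in> \<int>\<^sub>\<le>\<^sub>0")
  case True
  then obtain n where "a = - of_nat n" by (auto elim: nonpos_Ints_cases')
  thus ?thesis using even_series_nonpos by simp
next
  case a: False
  define S where "S a = (\<Sum>j. (- \<nu> gchoose j) * even_moment \<nu> a j)" for a
  have shift: "(\<Sum>j. (- \<nu> gchoose j) * even_moment \<nu> a (m + j)) = pochhammer a m * S (a + of_nat m)" for a m
    using suminf_mult[OF summable_even_series[of \<nu> "a + of_nat m" 0], of "pochhammer a m"]
    by (simp add: S_def even_moment_add mult_ac)
  have cross: "S a * rGamma (a + 1 + \<nu> + of_nat N) = rGamma (a + 1 + \<nu>) * S (a + of_nat N)"
    if "a \<notin> \<int>\<^sub>\<le>\<^sub>0" for a N
    using that
  proof (induction N arbitrary: a)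
    case (Suc N)
    have "a \<noteq> 0" using Suc.prems by auto
    hence Sa: "S a = (a + 1 + \<nu>) * S (a + 1)"
      unfolding S_def using even_series_shift1[of a \<nu>] by (simp add: add_ac)
    have ra: "rGamma (a + 1 + \<nu>) = (a + 1 + \<nu>) * rGamma (a + 1 + 1 + \<nu>)"
      using rGamma_plus1[of "a + 1 + \<nu>"] by (simp add: add_ac)
    have e: "a + of_nat (Suc N) = a + 1 + of_nat N" "a + 1 + \<nu> + of_nat (Suc N) = a + 1 + 1 + \<nu> + of_nat N" by simp_all
    have "a + 1 \<notin> \<int>\<^sub>\<le>\<^sub>0" using plus_nat_notin_nonpos_Ints[OF Suc.prems, of 1] by simp
    from Suc.IH[OF this] show ?case
      unfolding e Sa ra by (simp only: mult.assoc)
  qed simp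
  define p where "p = max 0 (- Re (\<nu> + 1))"
  have "(\<lambda>N. (\<Sum>j. (- \<nu> gchoose j) * even_moment \<nu> a (N + j)) * of_nat N powr (\<nu> + 1))
      \<longlonglongrightarrow> (\<Sum>j. - \<nu> gchoose j) * (2 powr \<nu> * rGamma a)"
  proof (rule shifted_series_LIMSEQ[OF even_moment_LIMSEQ])
    show "summable (\<lambda>j. norm (- \<nu> gchoose j) * (1 + real j) powr p)"
      by (rule summable_norm_gbinomial_powr) (use \<nu> in \<open>auto simp: p_def\<close>)
    show "(\<lambda>j. (- \<nu> gchoose j) * even_moment \<nu> a (N + j)) sums (\<Sum>j. (- \<nu> gchoose j) * even_moment \<nu> a (N + j))" for N
      using summable_even_series[of \<nu> a N] by (simp add: add_ac summable_sums)
  qed (auto simp: p_def)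
  also have "(\<Sum>j. - \<nu> gchoose j) = 2 powr (- \<nu>)"
    using gbinomial_sums_two_powr[of "- \<nu>"] \<nu> by (simp add: sums_iff)
  also have "2 powr (- \<nu>) * (2 powr \<nu> * rGamma a) = rGamma a"
    by (simp add: powr_minus)
  finally have "(\<lambda>N. pochhammer a N * S (a + of_nat N) * of_nat N powr (\<nu> + 1)) \<longlonglongrightarrow> rGamma a"
    unfolding shift .
  hence "(\<lambda>N. rGamma (a + 1 + \<nu>) * (pochhammer a N * S (a + of_nat N) * of_nat N powr (\<nu> + 1)))
      \<longlonglongrightarrow> rGamma (a + 1 + \<nu>) * rGamma a"
    by (rule tendsto_mult[OF tendsto_const])
  moreover have "(\<lambda>N. S a * (beta_moment \<nu> a N * of_nat N powr (\<nu> + 1))) \<longlonglongrightarrow> S a * rGamma a"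
    by (intro tendsto_mult tendsto_const beta_moment_LIMSEQ)
  moreover have "rGamma (a + 1 + \<nu>) * (pochhammer a N * S (a + of_nat N) * of_nat N powr (\<nu> + 1))
      = S a * (beta_moment \<nu> a N * of_nat N powr (\<nu> + 1))" for N
  proof -
    have "rGamma (a + 1 + \<nu>) * (pochhammer a N * S (a + of_nat N) * of_nat N powr (\<nu> + 1))
      = (rGamma (a + 1 + \<nu>) * S (a + of_nat N)) * (pochhammer a N * of_nat N powr (\<nu> + 1))"
      by (simp only: mult_ac)
    thus ?thesis unfolding cross[OF a, symmetric] beta_moment_def by (simp only: mult_ac)
  qed
  ultimately have "rGamma (a + 1 + \<nu>) * rGamma a = S a * rGamma a"
    by (simp only: LIMSEQ_unique)
  moreover have "rGamma a \<noteq> 0"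
    using a by (simp add: rGamma_eq_zero_iff)
  ultimately show ?thesis unfolding S_def by (metis mult_cancel_right)
qed

text \<open>
  Partial sum form of \<open>(1 - u^2) (1 + u)^(-\<nu> - 1) = (1 - u) (1 + u)^(-\<nu>)\<close>.
\<close>

lemma even_series_raise_partial:
  fixes f b h :: "nat \<Rightarrow> complex"
  assumes "f 0 = b 0" "\<And>j. b (Suc j) = f j + f (Suc j)"
  shows "(\<Sum>m<J + 2. f m * (h m - h (m + 2))) =
     (\<Sum>m<J + 2. b m * h m) - (\<Sum>m<J + 1. b m * h (m + 1)) - f J * h (J + 2) - f (Suc J) * h (J + 3)"
  by (induction J) (simp_all add: assms numeral_2_eq_2 numeral_3_eq_3 algebra_simps)

text \<open>
  The boundary terms have size \<open>1 / J\<close>, whatever \<open>\<nu>\<close> is.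
\<close>

lemma even_series_raise:
  "(1 + \<nu>) * (\<Sum>j. (- (\<nu> + 1) gchoose j) * even_moment (\<nu> + 1) a j)
   = (\<Sum>j. (- \<nu> gchoose j) * even_moment \<nu> a j) - (\<Sum>j. (- \<nu> gchoose j) * even_moment \<nu> a (j + 1))"
proof -
  define f where "f j = (- (\<nu> + 1) gchoose j)" for j
  obtain F where F: "F > 0" "\<And>n. norm (f n) \<le> F * (1 + real n) powr Re \<nu>"
    using gbinomial_norm_bound[of "- (\<nu> + 1)"] by (auto simp: f_def)
  obtain G where G: "G > 0" "\<And>n. norm (even_moment \<nu> a n) \<le> G * (1 + real n) powr (- Re \<nu> - 1)"
    by (rule even_moment_norm_bound[of \<nu> a]) blast
  have zero: "(\<lambda>J. f J * even_moment \<nu> a (J + 2)) \<longlonglongrightarrow> 0"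
  proof (rule Lim_null_comparison[OF always_eventually, OF allI])
    show "(\<lambda>J. F * G * (1 + real 2) powr \<bar>- Re \<nu> - 1\<bar> * (1 + real J) powr (- 1)) \<longlonglongrightarrow> 0"
      by (intro one_plus_powr_tendsto_0) auto
  next
    fix J
    have "norm (even_moment \<nu> a (J + 2)) \<le> G * (1 + real (J + 2)) powr (- Re \<nu> - 1)" by (rule G)
    also have "\<dots> \<le> G * ((1 + real J) powr (- Re \<nu> - 1) * (1 + real 2) powr \<bar>- Re \<nu> - 1\<bar>)"
      using G(1) by (intro mult_left_mono one_plus_add_powr_le) auto
    finally have "norm (f J * even_moment \<nu> a (J + 2)) \<le>
        (F * (1 + real J) powr Re \<nu>) * (G * ((1 + real J) powr (- Re \<nu> - 1) * (1 + real 2) powr \<bar>- Re \<nu> - 1\<bar>))"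
      unfolding norm_mult using F(1) by (intro mult_mono F(2)) auto
    also have "\<dots> = F * G * (1 + real 2) powr \<bar>- Re \<nu> - 1\<bar> * ((1 + real J) powr Re \<nu> * (1 + real J) powr (- Re \<nu> - 1))"
      by (simp only: mult_ac)
    finally show "norm (f J * even_moment \<nu> a (J + 2)) \<le> F * G * (1 + real 2) powr \<bar>- Re \<nu> - 1\<bar> * (1 + real J) powr (- 1)"
      unfolding powr_add[symmetric] by simp
  qed
  have zero': "(\<lambda>J. f (Suc J) * even_moment \<nu> a (J + 3)) \<longlonglongrightarrow> 0"
    using LIMSEQ_Suc[OF zero] by (simp add: numeral_3_eq_3)
  have S0: "(\<lambda>j. (- \<nu> gchoose j) * even_moment \<nu> a j) sums (\<Sum>j. (- \<nu> gchoose j) * even_moment \<nu> a j)"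
    using summable_even_series[of \<nu> a 0] by (simp add: summable_sums)
  have S1: "(\<lambda>j. (- \<nu> gchoose j) * even_moment \<nu> a (j + 1)) sums (\<Sum>j. (- \<nu> gchoose j) * even_moment \<nu> a (j + 1))"
    by (rule summable_sums[OF summable_even_series])
  have SU: "(\<lambda>j. f j * even_moment (\<nu> + 1) a j) sums (\<Sum>j. f j * even_moment (\<nu> + 1) a j)"
    using summable_even_series[of "\<nu> + 1" a 0] unfolding f_def by (simp add: summable_sums)
  have part: "(1 + \<nu>) * (\<Sum>m<J + 2. f m * even_moment (\<nu> + 1) a m) =
     (\<Sum>m<J + 2. (- \<nu> gchoose m) * even_moment \<nu> a m) - (\<Sum>m<J + 1. (- \<nu> gchoose m) * even_moment \<nu> a (m + 1))
     - f J * even_moment \<nu> a (J + 2) - f (Suc J) * even_moment \<nu> a (J + 3)" for J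
  proof -
    have "f 0 = (- \<nu> gchoose 0)" "\<And>j. (- \<nu> gchoose Suc j) = f j + f (Suc j)"
      using gbinomial_Suc_Suc[of "- (\<nu> + 1)"] by (simp_all add: f_def)
    from even_series_raise_partial[OF this, where J = J and h = "even_moment \<nu> a"]
    show ?thesis unfolding even_moment_raise[symmetric] by (simp only: sum_distrib_left mult.left_commute)
  qed
  have "(\<lambda>J. (1 + \<nu>) * (\<Sum>m<J + 2. f m * even_moment (\<nu> + 1) a m)) \<longlonglongrightarrow>
     (\<Sum>j. (- \<nu> gchoose j) * even_moment \<nu> a j) - (\<Sum>j. (- \<nu> gchoose j) * even_moment \<nu> a (j + 1)) - 0 - 0"
    unfolding part
    by (intro tendsto_diff zero zero' LIMSEQ_ignore_initial_segment[OF S0[unfolded sums_def]]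
        LIMSEQ_ignore_initial_segment[OF S1[unfolded sums_def]])
  moreover have "(\<lambda>J. (1 + \<nu>) * (\<Sum>m<J + 2. f m * even_moment (\<nu> + 1) a m)) \<longlonglongrightarrow>
     (1 + \<nu>) * (\<Sum>j. f j * even_moment (\<nu> + 1) a j)"
    by (intro tendsto_mult tendsto_const LIMSEQ_ignore_initial_segment[OF SU[unfolded sums_def]])
  ultimately show ?thesis
    unfolding f_def using LIMSEQ_unique by fastforce
qed

text \<open>
  On the level of moments: \<open>(1 - u^2)^\<nu> (1 + u)^(-\<nu>) = (1 - u)^\<nu>\<close>. The formula propagates from \<open>\<nu>\<close> to
  \<open>\<nu> + 1\<close> except where the factor \<open>1 + \<nu>\<close> vanishes; the resulting gap at \<open>\<nu> = 0\<close> is filled by the duplication formula.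
\<close>

theorem even_moment_binomial_sums:
  "(\<lambda>j. (- \<nu> gchoose j) * even_moment \<nu> a (j + m)) sums beta_moment \<nu> a m"
proof -
  define S where "S \<nu> a = (\<Sum>j. (- \<nu> gchoose j) * even_moment \<nu> a j)" for \<nu> a
  have main: "\<forall>a. S \<nu> a = rGamma (a + 1 + \<nu>)" if "Re \<nu> < real k" for k \<nu>
    using that
  proof (induction k arbitrary: \<nu>)
    case 0
    thus ?case using even_series_left_half_plane by (simp add: S_def)
  next
    case (Suc k)
    show ?case
    proof (cases "\<nu> = 0")
      case True
      have "S \<nu> a = rGamma (a + 1 + \<nu>)" for a
      proof -
        have "(\<lambda>j. (- \<nu> gchoose j) * even_moment \<nu> a j) sums (\<Sum>j\<le>0. (- \<nu> gchoose j) * even_moment \<nu> a j)"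
          by (rule sums_finite) (auto simp: True gbinomial_0_left)
        hence "S \<nu> a = even_beta 0 a" by (simp add: S_def True even_moment_def sums_iff)
        also have "\<dots> = 2 * (of_real (sqrt pi) * 2 powr (- (a + 1)) * rGamma ((a + 1 + 1) / 2) * rGamma ((a + 1) / 2))"
        proof -
          have p: "2 powr (- a) = 2 * (2 powr (- (a + 1)) :: complex)"
            by (simp add: powr_diff powr_minus)
          have h: "1 + 0 + a / 2 = (a + 1 + 1) / 2" by (simp add: field_simps)
          show ?thesis unfolding even_beta_def p h by (simp only: mult_ac)
        qed
        also have "\<dots> = rGamma (a + 1)" unfolding rGamma_duplication by simp
        finally show ?thesis using True by simp
      qed
      thus ?thesis by simp
    next
      case False
      define \<kappa> where "\<kappa> = \<nu> - 1"
      have \<nu>: "\<nu> = \<kappa> + 1" by (simp add: \<kappa>_def)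
      have IH: "S \<kappa> a = rGamma (a + 1 + \<kappa>)" for a
        using Suc.IH[of \<kappa>] Suc.prems by (simp add: \<kappa>_def)
      have "S \<nu> a = rGamma (a + 1 + \<nu>)" for a
      proof -
        have "even_moment \<kappa> a (j + 1) = a * even_moment \<kappa> (a + 1) j" for j
          using even_moment_add[of \<kappa> a 1 j] by (simp add: add_ac)
        hence "(\<Sum>j. (- \<kappa> gchoose j) * even_moment \<kappa> a (j + 1)) = a * S \<kappa> (a + 1)"
          using suminf_mult[OF summable_even_series[of \<kappa> "a + 1" 0], of a] by (simp add: S_def mult_ac)
        hence "(1 + \<kappa>) * S \<nu> a = rGamma (a + 1 + \<kappa>) - a * rGamma (a + 1 + 1 + \<kappa>)"
          using even_series_raise[of \<kappa> a] unfolding \<nu> S_def[symmetric] IH by simp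
        also have "rGamma (a + 1 + \<kappa>) = (a + 1 + \<kappa>) * rGamma (a + 1 + 1 + \<kappa>)"
          using rGamma_plus1[of "a + 1 + \<kappa>"] by (simp add: add_ac)
        finally have "(1 + \<kappa>) * S \<nu> a = (1 + \<kappa>) * rGamma (a + 1 + 1 + \<kappa>)"
          by (simp add: algebra_simps)
        moreover have "1 + \<kappa> \<noteq> 0" using False by (simp add: \<kappa>_def)
        ultimately show ?thesis by (simp add: \<nu> add_ac)
      qed
      thus ?thesis by simp
    qed
  qed
  have "S \<nu> a = rGamma (a + 1 + \<nu>)" for a
    using main reals_Archimedean2[of "Re \<nu>"] by blast
  hence sums: "(\<lambda>j. (- \<nu> gchoose j) * even_moment \<nu> a j) sums rGamma (a + 1 + \<nu>)" for a
    using summable_even_series[of \<nu> a 0] by (simp add: S_def sums_iff)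
  have "even_moment \<nu> a (j + m) = pochhammer a m * even_moment \<nu> (a + of_nat m) j" for j
    using even_moment_add[of \<nu> a m j] by (simp add: add_ac)
  moreover have "beta_moment \<nu> a m = pochhammer a m * rGamma (a + of_nat m + 1 + \<nu>)"
    by (simp add: beta_moment_def add_ac)
  ultimately show ?thesis
    using sums_mult[OF sums[of "a + of_nat m"], of "pochhammer a m"] by (simp add: mult_ac)
qed

section \<open>Rearranging double series\<close>

text \<open>
  A product bound on the terms gives absolute summability over all pairs, hence summation along diagonals.
\<close>

lemma product_bounded_double_series:
  fixes f :: "nat \<Rightarrow> nat \<Rightarrow> complex" and u v :: "nat \<Rightarrow> real"
  assumes bound: "\<And>i k. norm (f i k) \<le> u i * v k" and u: "summable u" "\<And>i. u i \<ge> 0"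
    and v: "summable v" "\<And>k. v k \<ge> 0"
  shows "(\<lambda>m. \<Sum>i\<le>m. f i (m - i)) sums (\<Sum>i. \<Sum>k. f i k)"
proof -
  have row_norm: "summable (\<lambda>k. norm (f i k))" for i
    by (rule summable_comparison_test'[OF summable_mult[OF v(1), of "u i"]]) (use bound in auto)
  have "(\<lambda>x. norm (case x of (i, k) \<Rightarrow> f i k)) summable_on UNIV \<times> UNIV"
    unfolding Infinite_Sum.abs_summable_on_Sigma_iff
  proof (intro conjI ballI)
    have uv: "u summable_on UNIV" "v summable_on UNIV"
      using u v by (simp_all add: summable_on_UNIV_nonneg_real_iff)
    show "(\<lambda>k. norm (case (i, k) of (i, k) \<Rightarrow> f i k)) summable_on UNIV" for i
      using row_norm[of i] by (simp add: summable_on_UNIV_nonneg_real_iff)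
    hence row: "(\<lambda>k. norm (f i k)) summable_on UNIV" for i by simp
    have "(\<lambda>i. infsum (\<lambda>k. norm (f i k)) UNIV) summable_on UNIV"
    proof (rule summable_on_comparison_test)
      show "(\<lambda>i. u i * infsum v UNIV) summable_on UNIV"
        by (intro summable_on_cmult_left uv)
      show "infsum (\<lambda>k. norm (f i k)) UNIV \<le> u i * infsum v UNIV" for i
      proof -
        have "infsum (\<lambda>k. norm (f i k)) UNIV \<le> infsum (\<lambda>k. u i * v k) UNIV"
          by (intro infsum_mono row summable_on_cmult_right uv bound)
        thus ?thesis by (simp add: infsum_cmult_right')
      qed
    qed (auto intro: infsum_nonneg)
    moreover have "infsum (\<lambda>k. norm (f i k)) UNIV \<ge> 0" for i by (intro infsum_nonneg) auto
    ultimately show "(\<lambda>i. norm (\<Sum>\<^sub>\<infinity>k\<in>UNIV. norm (case (i, k) of (i, k) \<Rightarrow> f i k))) summable_on UNIV"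
      by simp
  qed
  then obtain S where S: "((\<lambda>(i, k). f i k) has_sum S) (UNIV \<times> UNIV)"
    using Infinite_Sum.abs_summable_summable summable_on_def by blast
  have "((\<lambda>i. \<Sum>k. f i k) has_sum S) UNIV"
    by (rule has_sum_SigmaD[OF S])
      (auto intro!: norm_summable_imp_has_sum row_norm summable_sums summable_norm_cancel[OF row_norm])
  hence "(\<lambda>i. \<Sum>k. f i k) sums S" by (rule has_sum_imp_sums)
  moreover have "((\<lambda>m. \<Sum>i\<le>m. f i (m - i)) has_sum S) UNIV"
  proof (rule has_sum_SigmaD)
    have "bij_betw (\<lambda>(m, i). (i, m - i)) (Sigma UNIV (\<lambda>m :: nat. {..m})) (UNIV \<times> UNIV)"
      by (rule bij_betwI[where g = "\<lambda>(i, k). (i + k, i)"]) auto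
    from has_sum_reindex_bij_betw[OF this, of "\<lambda>(i, k). f i k" S] S
    show "((\<lambda>(m, i). f i (m - i)) has_sum S) (Sigma UNIV (\<lambda>m. {..m}))"
      by (simp add: case_prod_unfold)
    show "((\<lambda>i. case (m, i) of (m, i) \<Rightarrow> f i (m - i)) has_sum (\<Sum>i\<le>m. f i (m - i))) {..m}" for m
      using has_sum_finite[of "{..m}" "\<lambda>i. f i (m - i)"] by simp
  qed
  ultimately show ?thesis using has_sum_imp_sums by (metis sums_unique)
qed

lemma triangular_sum:
  fixes d b H :: "nat \<Rightarrow> complex"
  shows "(\<Sum>n<N. (\<Sum>i\<le>n. d i * b (n - i)) * H n) = (\<Sum>i<N. d i * (\<Sum>j<N - i. b j * H (i + j)))"
proof (induction N)
  case (Suc N)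
  have "(\<Sum>i<Suc N. d i * (\<Sum>j<Suc N - i. b j * H (i + j)))
      = (\<Sum>i<Suc N. d i * (\<Sum>j<N - i. b j * H (i + j)) + d i * b (N - i) * H N)"
    by (intro sum.cong) (auto simp: Suc_diff_le algebra_simps)
  also have "\<dots> = (\<Sum>i<N. d i * (\<Sum>j<N - i. b j * H (i + j))) + (\<Sum>i\<le>N. d i * b (N - i)) * H N"
    by (simp add: sum.distrib sum_distrib_right sum_distrib_left lessThan_Suc_atMost[symmetric] algebra_simps)
  finally show ?case using Suc by simp
qed simp

text \<open>
  Think of \<open>h\<close> as the moments of a weight, of \<open>b\<close>, \<open>c\<close>, \<open>d\<close> as the coefficients of three functions, and of \<open>V\<close> as the
  moments after multiplication by the function of \<open>b\<close>. Both series then express the integral of the product of all three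
  functions: the first expands the product of the functions of \<open>d\<close> and \<open>b\<close>, the second that of \<open>d\<close> and \<open>c\<close>. A partial sum of the
  first series consists of partial sums of the series for \<open>V\<close>, weighted by \<open>d_i c_k\<close>. These converge and are bounded, and the
  weights decay, so that Tannery's theorem applies to the sums over \<open>k\<close> and \<open>i\<close>. Absolute convergence
  enters only for \<open>d\<close> and \<open>c\<close>.
\<close>

lemma moment_series_rearrange:
  fixes b c d h V :: "nat \<Rightarrow> complex" and p K :: real
  assumes d: "summable (\<lambda>i. norm (d i) * (1 + real i) powr p)"
    and c: "summable (\<lambda>k. norm (c k) * (1 + real k) powr p)"
    and p: "p \<ge> 0"
    and h: "\<And>m. norm (h m) \<le> K * (1 + real m) powr p"
    and W: "\<And>J m. norm (\<Sum>j<J. b j * h (j + m)) \<le> K * (1 + real m) powr p"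
    and V: "\<And>m. (\<lambda>j. b j * h (j + m)) sums V m"
  shows "\<exists>L. (\<lambda>n. (\<Sum>i\<le>n. d i * b (n - i)) * (\<Sum>k. c k * h (n + k))) sums L
           \<and> (\<lambda>m. (\<Sum>i\<le>m. d i * c (m - i)) * V m) sums L"
proof -
  have K: "K \<ge> 0" using order_trans[OF norm_ge_zero h[of 0]] by simp
  have V_bound: "norm (V m) \<le> K * (1 + real m) powr p" for m
    by (rule tendsto_upperbound[OF tendsto_norm[OF V[unfolded sums_def]]]) (use W in auto)
  have split: "(1 + real (i + k)) powr p \<le> (1 + real i) powr p * (1 + real k) powr p" for i k
    using one_plus_add_powr_le[of i k p] p by simp
  have weight: "norm (c k * z) \<le> K * (1 + real i) powr p * (norm (c k) * (1 + real k) powr p)"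
    if "norm z \<le> K * (1 + real (i + k)) powr p" for i k z
  proof -
    have "norm (c k * z) \<le> norm (c k) * (K * ((1 + real i) powr p * (1 + real k) powr p))"
      unfolding norm_mult using K
      by (intro mult_left_mono order_trans[OF that] mult_left_mono split) auto
    thus ?thesis by (simp only: mult_ac)
  qed
  have sm: "summable (\<lambda>k. c k * z k)" if "\<And>k. norm (z k) \<le> K * (1 + real (i + k)) powr p" for i z
    by (rule summable_comparison_test'[OF summable_mult[OF c, of "K * (1 + real i) powr p"]])
      (rule weight[OF that])
  define C where "C = (\<Sum>k. norm (c k) * (1 + real k) powr p)"
  have bound: "norm (\<Sum>k. c k * z k) \<le> K * (1 + real i) powr p * C"
    if "\<And>k. norm (z k) \<le> K * (1 + real (i + k)) powr p" for i z
    unfolding C_def suminf_mult[OF c, symmetric]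
    by (rule norm_suminf_le[OF weight[OF that] summable_mult[OF c]])
  define T where "T J i = (\<Sum>k. c k * (\<Sum>j<J. b j * h (j + (i + k))))" for J i
  define U where "U i = (\<Sum>k. c k * V (i + k))" for i
  have T_lim: "(\<lambda>J. T J i) \<longlonglongrightarrow> U i" for i
    unfolding T_def U_def
  proof (rule tannerys_theorem[THEN conjunct2, THEN conjunct2])
    show "(\<lambda>J. c k * (\<Sum>j<J. b j * h (j + (i + k)))) \<longlonglongrightarrow> c k * V (i + k)" for k
      using V[of "i + k"] unfolding sums_def by (intro tendsto_mult tendsto_const)
    show "\<forall>\<^sub>F (k, J) in sequentially \<times>\<^sub>F sequentially.
        norm (c k * (\<Sum>j<J. b j * h (j + (i + k)))) \<le> K * (1 + real i) powr p * (norm (c k) * (1 + real k) powr p)"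
      by (intro always_eventually) (auto intro!: weight W)
    show "summable (\<lambda>k. K * (1 + real i) powr p * (norm (c k) * (1 + real k) powr p))"
      by (intro summable_mult c)
  qed simp
  have "(\<lambda>N. \<Sum>i. d i * T (N - i) i) \<longlonglongrightarrow> (\<Sum>i. d i * U i)"
  proof (rule tannerys_theorem[THEN conjunct2, THEN conjunct2])
    show "(\<lambda>N. d i * T (N - i) i) \<longlonglongrightarrow> d i * U i" for i
      by (intro tendsto_mult tendsto_const filterlim_compose[OF T_lim]) (rule filterlim_minus_const_nat_at_top)
    have "norm (d i * T (N - i) i) \<le> K * C * (norm (d i) * (1 + real i) powr p)" for i N
    proof -
      have "norm (d i * T (N - i) i) \<le> norm (d i) * (K * (1 + real i) powr p * C)"
        unfolding norm_mult T_def by (intro mult_left_mono bound W) auto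
      thus ?thesis by (simp only: mult_ac)
    qed
    thus "\<forall>\<^sub>F (i, N) in sequentially \<times>\<^sub>F sequentially.
        norm (d i * T (N - i) i) \<le> K * C * (norm (d i) * (1 + real i) powr p)"
      by (intro always_eventually) auto
    show "summable (\<lambda>i. K * C * (norm (d i) * (1 + real i) powr p))"
      by (intro summable_mult d)
  qed simp
  also have "(\<lambda>N. \<Sum>i. d i * T (N - i) i)
      = (\<lambda>N. \<Sum>n<N. (\<Sum>i\<le>n. d i * b (n - i)) * (\<Sum>k. c k * h (n + k)))"
  proof
    fix N
    have hs: "summable (\<lambda>k. c k * h (i + j + k))" for i j
      by (rule sm[of _ "i + j"]) (rule h)
    have TT: "T J i = (\<Sum>j<J. b j * (\<Sum>k. c k * h (i + j + k)))" for J i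
    proof -
      have "T J i = (\<Sum>k. \<Sum>j<J. b j * (c k * h (i + j + k)))"
        by (simp add: T_def sum_distrib_left mult_ac add_ac)
      also have "\<dots> = (\<Sum>j<J. \<Sum>k. b j * (c k * h (i + j + k)))"
        by (intro suminf_sum summable_mult hs)
      also have "\<dots> = (\<Sum>j<J. b j * (\<Sum>k. c k * h (i + j + k)))"
        by (intro sum.cong refl suminf_mult hs)
      finally show ?thesis .
    qed
    have "(\<Sum>n<N. (\<Sum>i\<le>n. d i * b (n - i)) * (\<Sum>k. c k * h (n + k))) = (\<Sum>i<N. d i * T (N - i) i)"
      unfolding TT by (rule triangular_sum)
    moreover have "(\<Sum>i. d i * T (N - i) i) = (\<Sum>i<N. d i * T (N - i) i)"
      by (rule suminf_finite) (auto simp: T_def)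
    ultimately show "(\<Sum>i. d i * T (N - i) i)
        = (\<Sum>n<N. (\<Sum>i\<le>n. d i * b (n - i)) * (\<Sum>k. c k * h (n + k)))" by simp
  qed
  finally have 1: "(\<lambda>n. (\<Sum>i\<le>n. d i * b (n - i)) * (\<Sum>k. c k * h (n + k))) sums (\<Sum>i. d i * U i)"
    unfolding sums_def .
  have "(\<lambda>m. \<Sum>i\<le>m. d i * c (m - i) * V (i + (m - i))) sums (\<Sum>i. \<Sum>k. d i * c k * V (i + k))"
  proof (rule product_bounded_double_series)
    show "norm (d i * c k * V (i + k)) \<le> (K * (norm (d i) * (1 + real i) powr p)) * (norm (c k) * (1 + real k) powr p)"
      for i k
    proof -
      have "norm (d i * (c k * V (i + k))) \<le> norm (d i) * (K * (1 + real i) powr p * (norm (c k) * (1 + real k) powr p))"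
        unfolding norm_mult[of "d i"] by (intro mult_left_mono weight V_bound) auto
      thus ?thesis by (simp only: mult_ac)
    qed
  qed (use d c K in \<open>auto intro: summable_mult\<close>)
  moreover have "(\<Sum>k. d i * c k * V (i + k)) = d i * U i" for i
    using suminf_mult[OF sm[OF V_bound, of i], of "d i"] by (simp add: U_def mult_ac)
  moreover have "(\<Sum>i\<le>m. d i * c (m - i) * V (i + (m - i))) = (\<Sum>i\<le>m. d i * c (m - i)) * V m" for m
    unfolding sum_distrib_right by (intro sum.cong) auto
  ultimately have "(\<lambda>m. (\<Sum>i\<le>m. d i * c (m - i)) * V m) sums (\<Sum>i. d i * U i)" by simp
  with 1 show ?thesis by blast
qed

lemma summable_powr_geometric:
  fixes r q :: real
  assumes "0 \<le> r" "r < 1"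
  shows "summable (\<lambda>n. (1 + real n) powr q * r ^ n)"
proof (cases "r = 0")
  case True
  show ?thesis by (rule summable_finite[of "{0}"]) (use True in auto)
next
  case False
  define c where "c = - ln r"
  have c: "c > 0" "r ^ n = exp (- c * real n)" for n
    using assms False by (auto simp: c_def exp_of_nat2_mult[symmetric] mult.commute exp_of_nat_mult)
  have "(\<lambda>n. (1 + real n) powr q * exp (- c * real n)) \<in> O(\<lambda>n. exp (- (c / 2)) ^ n)"
  proof -
    have "(\<lambda>n. (1 + real n) powr q * exp (- c * real n)) \<in> O(\<lambda>n. exp (- (c / 2) * real n))"
      using c(1) by real_asymp
    moreover have "exp (- (c / 2)) ^ n = exp (- (c / 2) * real n)" for n
      by (simp only: exp_of_nat_mult[symmetric] mult.commute)
    ultimately show ?thesis by simp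
  qed
  moreover have "summable (\<lambda>n. norm (exp (- (c / 2)) ^ n))"
  proof -
    have "summable (\<lambda>n. exp (- (c / 2)) ^ n)"
      by (rule summable_geometric) (use c(1) in simp)
    thus ?thesis unfolding norm_power by simp
  qed
  ultimately show ?thesis
    unfolding c(2) by (rule summable_comparison_test_bigo[rotated])
qed

section \<open>The Pfaff transformation and the Legendre functions\<close>

text \<open>
  The Chu-Vandermonde sum in a form without denominators. Pascal's rule reduces \<open>m + 1\<close> to \<open>m\<close> with \<open>b\<close> and
  \<open>c\<close> raised by one.
\<close>

lemma pochhammer_chu_vandermonde:
  fixes b c :: complex
  shows "(\<Sum>i\<le>m. of_nat (m choose i) * (-1) ^ i * pochhammer (c - b) i * rGamma (c + of_nat i))
    = pochhammer b m * rGamma (c + of_nat m)"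
proof (induction m arbitrary: b c)
  case (Suc m)
  define t where "t i = (-1) ^ i * pochhammer (c - b) i * rGamma (c + of_nat i)" for i
  have "(\<Sum>i\<le>Suc m. of_nat (Suc m choose i) * (-1) ^ i * pochhammer (c - b) i * rGamma (c + of_nat i))
      = (\<Sum>i\<le>Suc m. of_nat (Suc m choose i) * t i)"
    by (simp only: t_def mult.assoc)
  also have "\<dots> = t 0 + (\<Sum>i\<le>m. of_nat (Suc m choose Suc i) * t (Suc i))"
    by (simp add: sum.atMost_Suc_shift del: binomial_Suc_Suc sum.atMost_Suc)
  also have "\<dots> = (t 0 + (\<Sum>i\<le>m. of_nat (m choose Suc i) * t (Suc i))) + (\<Sum>i\<le>m. of_nat (m choose i) * t (Suc i))"
    by (simp add: sum.distrib algebra_simps)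
  also have "t 0 + (\<Sum>i\<le>m. of_nat (m choose Suc i) * t (Suc i)) = (\<Sum>i\<le>Suc m. of_nat (m choose i) * t i)"
    by (simp add: sum.atMost_Suc_shift del: sum.atMost_Suc)
  also have "\<dots> = (\<Sum>i\<le>m. of_nat (m choose i) * t i)" by simp
  also have "\<dots> + (\<Sum>i\<le>m. of_nat (m choose i) * t (Suc i)) = (\<Sum>i\<le>m. of_nat (m choose i) * (t i + t (Suc i)))"
    by (simp add: sum.distrib distrib_left)
  also have "\<dots> = (\<Sum>i\<le>m. b * (of_nat (m choose i) * (-1) ^ i * pochhammer ((c + 1) - (b + 1)) i * rGamma ((c + 1) + of_nat i)))"
  proof (intro sum.cong refl)
    fix i
    have "rGamma (c + of_nat i) = (c + of_nat i) * rGamma (c + 1 + of_nat i)"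
      using rGamma_plus1[of "c + of_nat i"] by (simp add: add_ac)
    moreover have "rGamma (c + of_nat (Suc i)) = rGamma (c + 1 + of_nat i)" by (simp add: add_ac)
    ultimately have "t i + t (Suc i) = b * ((-1) ^ i * pochhammer (c - b) i * rGamma (c + 1 + of_nat i))"
      by (simp only: t_def pochhammer_rec' power_Suc) (simp add: algebra_simps)
    thus "of_nat (m choose i) * (t i + t (Suc i)) = b * (of_nat (m choose i) * (-1) ^ i * pochhammer ((c + 1) - (b + 1)) i * rGamma ((c + 1) + of_nat i))"
      by simp
  qed
  also have "\<dots> = b * (pochhammer (b + 1) m * rGamma (c + 1 + of_nat m))"
    unfolding sum_distrib_left[symmetric] Suc.IH ..
  also have "\<dots> = pochhammer b (Suc m) * rGamma (c + of_nat (Suc m))"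
    by (simp add: pochhammer_rec add_ac)
  finally show ?case .
qed simp

lemma pochhammer_rGamma_norm_bound:
  fixes a c :: complex
  obtains K where "K > 0" "\<And>n. norm (pochhammer a n * rGamma (c + of_nat n)) \<le> K * (1 + real n) powr (Re a - Re c)"
proof -
  obtain K where "K > 0" "\<And>n. norm (pochhammer a n * rGamma (c + of_nat n)) \<le> K * (1 + real n) powr (- Re (c - a))"
    by (rule norm_bound_of_LIMSEQ[OF pochhammer_rGamma_LIMSEQ[of a c]]) blast
  thus ?thesis using that[of K] by simp
qed

lemma pochhammer_fact_norm_bound:
  fixes a :: complex
  obtains K where "K > 0" "\<And>n. norm (pochhammer a n / fact n) \<le> K * (1 + real n) powr (Re a - 1)"
proof -
  obtain K where "K > 0" "\<And>n. norm (pochhammer a n / fact n) \<le> K * (1 + real n) powr (- Re (1 - a))"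
    by (rule norm_bound_of_LIMSEQ[OF pochhammer_LIMSEQ[of a]]) blast
  thus ?thesis using that[of K] by simp
qed

lemma hypergeo_reg_series_sums:
  assumes "norm z < 1"
  shows "(\<lambda>n. pochhammer a n * pochhammer b n * rGamma (c + of_nat n) / fact n * z ^ n)
    sums hypergeo_reg_series a b c z"
proof -
  obtain K where K: "K > 0" "\<And>n. norm (pochhammer a n / fact n) \<le> K * (1 + real n) powr (Re a - 1)"
    by (rule pochhammer_fact_norm_bound[of a]) blast
  obtain L where L: "L > 0" "\<And>n. norm (pochhammer b n * rGamma (c + of_nat n)) \<le> L * (1 + real n) powr (Re b - Re c)"
    by (rule pochhammer_rGamma_norm_bound[of b c]) blast
  have "summable (\<lambda>n. pochhammer a n * pochhammer b n * rGamma (c + of_nat n) / fact n * z ^ n)"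
  proof (rule summable_comparison_test')
    show "summable (\<lambda>n. K * L * ((1 + real n) powr (Re a - 1 + (Re b - Re c)) * norm z ^ n))"
      using assms by (intro summable_mult summable_powr_geometric) auto
    fix n
    have "norm (pochhammer a n * pochhammer b n * rGamma (c + of_nat n) / fact n * z ^ n)
        = norm (pochhammer a n / fact n) * norm (pochhammer b n * rGamma (c + of_nat n)) * norm z ^ n"
      by (simp add: norm_mult norm_divide norm_power)
    also have "\<dots> \<le> (K * (1 + real n) powr (Re a - 1)) * (L * (1 + real n) powr (Re b - Re c)) * norm z ^ n"
      using K(1) by (intro mult_right_mono mult_mono K L) auto
    also have "\<dots> = K * L * ((1 + real n) powr (Re a - 1 + (Re b - Re c)) * norm z ^ n)"
      unfolding powr_add by (simp only: mult_ac)
    finally show "norm (pochhammer a n * pochhammer b n * rGamma (c + of_nat n) / fact n * z ^ n)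
      \<le> K * L * ((1 + real n) powr (Re a - 1 + (Re b - Re c)) * norm z ^ n)" .
  qed
  thus ?thesis unfolding hypergeo_reg_series_def by (rule summable_sums)
qed

lemma hypergeo_reg_series_holomorphic: "hypergeo_reg_series a b c holomorphic_on ball 0 1"
proof (rule power_series_holomorphic)
  fix w :: complex assume "w \<in> ball 0 1"
  thus "(\<lambda>n. pochhammer a n * pochhammer b n * rGamma (c + of_nat n) / fact n * (w - 0) ^ n)
      sums hypergeo_reg_series a b c w"
    using hypergeo_reg_series_sums[of w a b c] by simp
qed

text \<open>
  The half plane \<open>Re z < 1/2\<close> of the Pfaff transformation consists of the points closer to 0 than to 1.
\<close>

lemma half_plane_ratio:
  fixes z :: complex
  assumes "Re z < 1 / 2"
  shows "norm (z / (z - 1)) < 1" "1 - z \<notin> \<real>\<^sub>\<le>\<^sub>0" "z \<noteq> 1"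
proof -
  show ne: "z \<noteq> 1" using assms by auto
  have "(norm z)\<^sup>2 < (norm (z - 1))\<^sup>2"
    unfolding cmod_power2 using assms by (simp add: power2_eq_square algebra_simps)
  hence "norm z < norm (z - 1)" by (rule power_less_imp_less_base) simp
  thus "norm (z / (z - 1)) < 1" using ne by (simp add: norm_divide)
  show "1 - z \<notin> \<real>\<^sub>\<le>\<^sub>0" using assms by (auto simp: complex_nonpos_Reals_iff)
qed

text \<open>
  Expanding \<open>(1 - t)^(-a - k)\<close> in each term of the right hand side gives a double series whose diagonal sums
  are evaluated by Chu-Vandermonde. It converges absolutely because the binomial coefficient in
  the terms is at most \<open>2^(k + l)\<close>; this is where the radius \<open>1/2\<close> comes from.
\<close>

lemma pfaff_small:
  assumes t: "norm t < 1 / 2"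
  shows "hypergeo_reg_series a b c t = (1 - t) powr (- a) * hypergeo_reg_series a (c - b) c (t / (t - 1))"
proof -
  have Ret: "Re t < 1 / 2" using t complex_Re_le_cmod[of t] by linarith
  note half = half_plane_ratio[OF Ret]
  define f where "f k l = pochhammer a (k + l) * pochhammer (c - b) k * rGamma (c + of_nat k)
      / (fact k * fact l) * (-1) ^ k * t ^ (k + l)" for k l
  obtain K where K: "K > 0" "\<And>n. norm (pochhammer a n / fact n) \<le> K * (1 + real n) powr (Re a - 1)"
    by (rule pochhammer_fact_norm_bound[of a]) blast
  define q where "q = \<bar>Re a - 1\<bar>"
  obtain L where L: "L > 0" "\<And>n. norm (pochhammer (c - b) n * rGamma (c + of_nat n)) \<le> L * (1 + real n) powr (Re (c - b) - Re c)"
    by (rule pochhammer_rGamma_norm_bound[of "c - b" c]) blast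
  define r where "r = 2 * norm t"
  have r: "0 \<le> r" "r < 1" using t by (auto simp: r_def)
  have diag: "(\<lambda>m. \<Sum>i\<le>m. f i (m - i)) sums (\<Sum>k. \<Sum>l. f k l)"
  proof (rule product_bounded_double_series)
    fix k l
    have "f k l = (pochhammer a (k + l) / fact (k + l)) * of_nat ((k + l) choose k)
        * (pochhammer (c - b) k * rGamma (c + of_nat k)) * ((-1) ^ k * t ^ (k + l))"
      by (simp add: f_def binomial_fact)
    hence "norm (f k l) = norm (pochhammer a (k + l) / fact (k + l)) * real ((k + l) choose k)
        * norm (pochhammer (c - b) k * rGamma (c + of_nat k)) * norm t ^ (k + l)"
      by (simp only: norm_mult norm_power norm_minus_cancel norm_one power_one mult_1_left norm_of_nat)
    also have "\<dots> \<le> (K * ((1 + real k) powr q * (1 + real l) powr q)) * 2 ^ (k + l)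
        * (L * (1 + real k) powr (Re (c - b) - Re c)) * norm t ^ (k + l)"
    proof (intro mult_right_mono mult_mono L)
      have "norm (pochhammer a (k + l) / fact (k + l)) \<le> K * (1 + real (k + l)) powr (Re a - 1)"
        by (rule K)
      also have "\<dots> \<le> K * (1 + real (k + l)) powr q"
        using K(1) by (intro mult_left_mono powr_mono) (auto simp: q_def)
      also have "\<dots> \<le> K * ((1 + real k) powr q * (1 + real l) powr q)"
        using K(1) one_plus_add_powr_le[of k l q] by (intro mult_left_mono) (auto simp: q_def)
      finally show "norm (pochhammer a (k + l) / fact (k + l)) \<le> \<dots>" .
      show "real ((k + l) choose k) \<le> 2 ^ (k + l)"
        using binomial_le_pow2[of "k + l" k] by (metis of_nat_le_iff of_nat_numeral of_nat_power)
    qed (use K(1) in auto)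
    also have "\<dots> = (K * L * ((1 + real k) powr (q + (Re (c - b) - Re c)) * r ^ k)) * ((1 + real l) powr q * r ^ l)"
      unfolding powr_add r_def power_add power_mult_distrib by (simp only: mult_ac)
    finally show "norm (f k l) \<le> (K * L * ((1 + real k) powr (q + (Re (c - b) - Re c)) * r ^ k)) * ((1 + real l) powr q * r ^ l)" .
  next
    show "summable (\<lambda>k. K * L * ((1 + real k) powr (q + (Re (c - b) - Re c)) * r ^ k))"
      by (intro summable_mult summable_powr_geometric r)
    show "summable (\<lambda>l. (1 + real l) powr q * r ^ l)"
      by (intro summable_powr_geometric r)
  qed (use K(1) L(1) r in auto)
  have "(\<Sum>i\<le>m. f i (m - i)) = pochhammer a m * pochhammer b m * rGamma (c + of_nat m) / fact m * t ^ m" for m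
  proof -
    have "(\<Sum>i\<le>m. f i (m - i)) = (\<Sum>i\<le>m. pochhammer a m / fact m * t ^ m *
        (of_nat (m choose i) * (-1) ^ i * pochhammer (c - b) i * rGamma (c + of_nat i)))"
      by (intro sum.cong refl) (simp add: f_def binomial_fact)
    also have "\<dots> = pochhammer a m / fact m * t ^ m * (pochhammer b m * rGamma (c + of_nat m))"
      unfolding sum_distrib_left[symmetric] pochhammer_chu_vandermonde ..
    finally show ?thesis by simp
  qed
  hence left: "hypergeo_reg_series a b c t = (\<Sum>k. \<Sum>l. f k l)"
    using diag by (simp add: hypergeo_reg_series_def sums_iff)
  have row: "(\<Sum>l. f k l) = (1 - t) powr (- a) *
      (pochhammer a k * pochhammer (c - b) k * rGamma (c + of_nat k) / fact k * (t / (t - 1)) ^ k)" for k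
  proof -
    have "(\<lambda>l. (- (a + of_nat k) gchoose l) * (- t) ^ l) sums (1 + - t) powr (- (a + of_nat k))"
      using t by (intro gen_binomial_complex) simp
    also have "(\<lambda>l. (- (a + of_nat k) gchoose l) * (- t) ^ l) = (\<lambda>l. pochhammer (a + of_nat k) l / fact l * t ^ l)"
    proof
      fix l
      have "(- (a + of_nat k) gchoose l) * (- t) ^ l = ((-1) ^ l * (-1) ^ l) * (pochhammer (a + of_nat k) l / fact l * t ^ l)"
        unfolding gbinomial_pochhammer power_minus[of t] minus_minus by (simp only: mult_ac times_divide_eq_left times_divide_eq_right)
      thus "(- (a + of_nat k) gchoose l) * (- t) ^ l = pochhammer (a + of_nat k) l / fact l * t ^ l" by simp
    qed
    finally have "(\<lambda>l. pochhammer (a + of_nat k) l / fact l * t ^ l) sums (1 - t) powr (- (a + of_nat k))"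
      by simp
    from sums_mult[OF this, of "pochhammer a k * pochhammer (c - b) k * rGamma (c + of_nat k) / fact k * (-1) ^ k * t ^ k"]
    have "f k sums (pochhammer a k * pochhammer (c - b) k * rGamma (c + of_nat k) / fact k * (-1) ^ k * t ^ k
        * (1 - t) powr (- (a + of_nat k)))"
      by (simp add: f_def[abs_def] pochhammer_product' power_add mult_ac)
    hence "(\<Sum>l. f k l) = pochhammer a k * pochhammer (c - b) k * rGamma (c + of_nat k) / fact k
        * ((-1) ^ k * t ^ k * (1 - t) powr (- (a + of_nat k)))"
      by (simp add: sums_iff mult_ac)
    also have "(-1) ^ k * t ^ k * (1 - t) powr (- (a + of_nat k)) = (1 - t) powr (- a) * (t / (t - 1)) ^ k"
    proof -
      have "- (a + of_nat k) = - a - of_nat k" by simp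
      hence "(1 - t) powr (- (a + of_nat k)) = (1 - t) powr (- a) / (1 - t) ^ k"
        using half(3) by (simp only: powr_diff powr_nat' right_minus_eq) (simp add: powr_nat')
      moreover have "t / (t - 1) = - t / (1 - t)"
        using half(3) by (simp add: field_simps)
      moreover have "(-1) ^ k * t ^ k = (- t) ^ k" by (rule power_minus[symmetric])
      ultimately show ?thesis by (simp only: power_divide) simp
    qed
    finally show ?thesis by (simp only: mult_ac)
  qed
  have "(\<lambda>k. (1 - t) powr (- a) * (pochhammer a k * pochhammer (c - b) k * rGamma (c + of_nat k) / fact k * (t / (t - 1)) ^ k))
      sums ((1 - t) powr (- a) * hypergeo_reg_series a (c - b) c (t / (t - 1)))"
    by (intro sums_mult hypergeo_reg_series_sums half)
  thus ?thesis unfolding left row by (simp add: sums_iff)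
qed

text \<open>
  The right hand side is holomorphic in the whole half plane, which is convex and contains 0. It continues the
  series by Pfaff's transformation near 0 and the identity theorem.
\<close>

lemma hypergeo_reg_half_plane:
  assumes z: "Re z < 1 / 2"
  shows "hypergeo_reg a b c z = (1 - z) powr (- a) * hypergeo_reg_series a (c - b) c (z / (z - 1))"
proof -
  define S where "S = {z :: complex. Re z < 1 / 2}"
  define f where "f z = (1 - z) powr (- a) * hypergeo_reg_series a (c - b) c (z / (z - 1))" for z
  have S: "open S" "convex S" "0 \<in> S" "z \<in> S"
    unfolding S_def by (rule open_halfspace_Re_lt convex_halfspace_Re_lt | use z in simp)+
  have hol: "f holomorphic_on S"
  proof -
    have "(\<lambda>z. z / (z - 1)) ` S \<subseteq> ball 0 1"
      using half_plane_ratio(1) by (auto simp: S_def)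
    moreover have "(\<lambda>z. z / (z - 1)) holomorphic_on S"
      by (intro holomorphic_intros) (use half_plane_ratio(3) in \<open>auto simp: S_def\<close>)
    ultimately have "(hypergeo_reg_series a (c - b) c \<circ> (\<lambda>z. z / (z - 1))) holomorphic_on S"
      by (intro holomorphic_on_compose_gen[OF _ hypergeo_reg_series_holomorphic])
    moreover have "(\<lambda>z. (1 - z) powr (- a)) holomorphic_on S"
      by (intro holomorphic_intros) (use half_plane_ratio(2) in \<open>auto simp: S_def\<close>)
    ultimately show ?thesis
      unfolding f_def[abs_def] o_def by (intro holomorphic_on_mult)
  qed
  have agree: "f u = hypergeo_reg_series a b c u" if "u \<in> S" "norm u < 1" for u
  proof (rule analytic_continuation_open[where f = f and g = "hypergeo_reg_series a b c" and s = "ball 0 (1 / 2)" and s' = "S \<inter> ball 0 1"])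
    show "connected (S \<inter> ball 0 1)" by (intro convex_connected convex_Int S convex_ball)
    show "ball 0 (1 / 2) \<subseteq> S \<inter> ball 0 1"
    proof
      fix v :: complex assume "v \<in> ball 0 (1 / 2)"
      thus "v \<in> S \<inter> ball 0 1" using complex_Re_le_cmod[of v] by (auto simp: S_def)
    qed
    show "f holomorphic_on S \<inter> ball 0 1" by (rule holomorphic_on_subset[OF hol]) auto
    show "hypergeo_reg_series a b c holomorphic_on S \<inter> ball 0 1"
      by (rule holomorphic_on_subset[OF hypergeo_reg_series_holomorphic]) auto
    show "f v = hypergeo_reg_series a b c v" if "v \<in> ball 0 (1 / 2)" for v
      using pfaff_small[of v a b c] that by (simp add: f_def)
  qed (use that S in auto)
  have cont: "hypergeo_reg_cont a b c z (f z)"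
    unfolding hypergeo_reg_cont_def using S hol agree by blast
  have "hypergeo_reg a b c z = f z"
    unfolding hypergeo_reg_def by (rule the_equality) (use cont hypergeo_reg_cont_unique in blast)+
  thus ?thesis by (simp add: f_def)
qed

text \<open>
  For all \<open>x > 0\<close> the argument \<open>(1 - x) / 2\<close> lies in the half plane of the Pfaff transformation, and the new argument is \<open>-w\<close>.
  This treats the Ferrers function (\<open>w > 0\<close>) and the Legendre function (\<open>w < 0\<close>) at the same time.
\<close>

lemma legendre_P_beta:
  assumes x: "x > 0"
  defines "w \<equiv> (1 - x) / (1 + x)"
  shows "legendre_P \<nu> (- \<kappa>) x = of_real \<bar>w\<bar> powr (\<kappa> / 2) * of_real ((1 + x) / 2) powr \<nu>
     * (\<Sum>k. (\<nu> gchoose k) * of_real w ^ k * beta_moment \<nu> (\<kappa> - \<nu>) k)"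
proof -
  have "Re (of_real ((1 - x) / 2)) < 1 / 2" using x by simp
  note hypergeo_reg_half_plane[OF this, of "- \<nu>" "\<nu> + 1" "1 + \<kappa>"]
  also have "1 - complex_of_real ((1 - x) / 2) = of_real ((1 + x) / 2)"
    by (simp add: field_simps)
  also have "complex_of_real ((1 - x) / 2) / (of_real ((1 - x) / 2) - 1) = of_real (- w)"
  proof -
    have "(1 - x) / 2 / ((1 - x) / 2 - 1) = - w"
      using x by (simp add: w_def field_simps)
    moreover have "complex_of_real ((1 - x) / 2) / (of_real ((1 - x) / 2) - 1)
        = of_real ((1 - x) / 2 / ((1 - x) / 2 - 1))"
      by (simp only: of_real_divide of_real_diff of_real_1)
    ultimately show ?thesis by simp
  qed
  also have "1 + \<kappa> - (\<nu> + 1) = \<kappa> - \<nu>" by simp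
  also have "hypergeo_reg_series (- \<nu>) (\<kappa> - \<nu>) (1 + \<kappa>) (of_real (- w))
      = (\<Sum>k. (\<nu> gchoose k) * of_real w ^ k * beta_moment \<nu> (\<kappa> - \<nu>) k)"
    unfolding hypergeo_reg_series_def
  proof (rule suminf_cong)
    fix k
    have "(\<nu> gchoose k) * of_real w ^ k = pochhammer (- \<nu>) k / fact k * of_real (- w) ^ k"
      unfolding gbinomial_pochhammer of_real_minus power_minus[of "of_real w"] by simp
    moreover have "beta_moment \<nu> (\<kappa> - \<nu>) k = pochhammer (\<kappa> - \<nu>) k * rGamma (1 + \<kappa> + of_nat k)"
      by (simp add: beta_moment_def add_ac)
    ultimately show "pochhammer (- \<nu>) k * pochhammer (\<kappa> - \<nu>) k * rGamma (1 + \<kappa> + of_nat k) / fact k * of_real (- w) ^ k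
      = (\<nu> gchoose k) * of_real w ^ k * beta_moment \<nu> (\<kappa> - \<nu>) k" by simp
  qed
  finally show ?thesis
    unfolding legendre_P_def w_def by simp
qed

section \<open>The Gegenbauer factors\<close>

definition polynomial_map :: "(complex \<Rightarrow> complex) \<Rightarrow> bool" where
  "polynomial_map f \<longleftrightarrow> (\<exists>p. \<forall>s. f s = poly p s)"

lemma polynomial_map_const: "polynomial_map (\<lambda>s. c)"
  unfolding polynomial_map_def by (rule exI[of _ "[:c:]"]) simp

lemma polynomial_map_id: "polynomial_map (\<lambda>s. s)"
  unfolding polynomial_map_def by (rule exI[of _ "[:0, 1:]"]) simp

lemma polynomial_map_add: "polynomial_map f \<Longrightarrow> polynomial_map g \<Longrightarrow> polynomial_map (\<lambda>s. f s + g s)"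
  unfolding polynomial_map_def by (metis poly_add)

lemma polynomial_map_diff: "polynomial_map f \<Longrightarrow> polynomial_map g \<Longrightarrow> polynomial_map (\<lambda>s. f s - g s)"
  unfolding polynomial_map_def by (metis poly_diff)

lemma polynomial_map_mult: "polynomial_map f \<Longrightarrow> polynomial_map g \<Longrightarrow> polynomial_map (\<lambda>s. f s * g s)"
  unfolding polynomial_map_def by (metis poly_mult)

lemma polynomial_map_sum: "(\<And>i. i \<in> A \<Longrightarrow> polynomial_map (f i)) \<Longrightarrow> polynomial_map (\<lambda>s. \<Sum>i\<in>A. f i s)"
  by (induction A rule: infinite_finite_induct) (simp_all add: polynomial_map_const polynomial_map_add)

lemma polynomial_map_gchoose:
  assumes "polynomial_map f"
  shows "polynomial_map (\<lambda>s. f s gchoose k)"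
proof (induction k)
  case 0
  show ?case by (simp add: polynomial_map_const)
next
  case (Suc k)
  have "(f s gchoose Suc k) = (f s - of_nat k) * (f s gchoose k) * (1 / of_nat (Suc k))" for s
    using gbinomial_Suc_mult[of k "f s"] by (simp add: field_simps del: of_nat_Suc)
  moreover have "polynomial_map (\<lambda>s. (f s - of_nat k) * (f s gchoose k) * (1 / of_nat (Suc k)))"
    by (intro polynomial_map_mult polynomial_map_diff polynomial_map_const assms Suc)
  ultimately show ?case by simp
qed

lemmas polynomial_map_intros = polynomial_map_const polynomial_map_id polynomial_map_add
  polynomial_map_diff polynomial_map_mult polynomial_map_sum polynomial_map_gchoose

lemma poly_eq_of_infinite:
  fixes p q :: "complex poly"
  assumes "infinite {s. poly p s = poly q s}"
  shows "p = q"
proof (rule ccontr)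
  assume "p \<noteq> q"
  hence "finite {s. poly (p - q) s = 0}" by (intro poly_roots_finite) simp
  thus False using assms by simp
qed

lemma polynomial_map_eq_of_nat:
  assumes "polynomial_map f" "polynomial_map g" and eq: "\<And>n :: nat. f (of_nat n) = g (of_nat n)"
  shows "f s = g s"
proof -
  obtain p q where pq: "\<And>s. f s = poly p s" "\<And>s. g s = poly q s"
    using assms unfolding polynomial_map_def by blast
  have "range of_nat \<subseteq> {s. poly p s = poly q s}" using eq pq by auto
  moreover have "infinite (range (of_nat :: nat \<Rightarrow> complex))"
    by (rule range_inj_infinite) (simp add: inj_on_def)
  ultimately have "p = q" using poly_eq_of_infinite finite_subset by blast
  thus ?thesis using pq by simp
qed

lemma coeff_one_linear_power:
  fixes c :: complex
  shows "coeff ([:1, c:] ^ N) i = of_nat (N choose i) * c ^ i"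
proof (cases "i \<le> N")
  case True
  thus ?thesis by (simp add: coeff_linear_poly_power)
next
  case False
  have "degree ([:1, c:] ^ N) \<le> degree [:1, c:] * N" by (rule degree_power_le)
  also have "\<dots> \<le> 1 * N" by (intro mult_right_mono) auto
  finally have "coeff ([:1, c:] ^ N) i = 0" using False by (intro coeff_eq_0) simp
  thus ?thesis using False by (simp add: binomial_eq_0)
qed

text \<open>
  Both sides are the coefficient of \<open>h^n\<close> in \<open>((1 + (1 + x) h) (1 + (x - 1) h))^\<alpha> = ((1 + x h)^2 - h^2)^\<alpha>\<close>. They
  are polynomials in \<open>\<alpha>\<close>, so it suffices to let \<open>\<alpha>\<close> be a natural number, where the
  coefficients can be compared in the polynomial ring.
\<close>

lemma gbinomial_convolution:
  fixes \<alpha> x :: complex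
  shows "(\<Sum>k\<le>n. (\<alpha> gchoose k) * (\<alpha> gchoose (n - k)) * (1 + x) ^ k * (x - 1) ^ (n - k))
    = (\<Sum>j\<le>n div 2. (-1) ^ j * (\<alpha> gchoose j) * (2 * \<alpha> - 2 * of_nat j gchoose (n - 2 * j)) * x ^ (n - 2 * j))"
proof (rule polynomial_map_eq_of_nat[where s = \<alpha>])
  fix N :: nat
  define P where "P = [:1, 1 + x:] ^ N * [:1, x - 1:] ^ N"
  have "coeff P n = (\<Sum>k\<le>n. of_nat (N choose k) * (1 + x) ^ k * (of_nat (N choose (n - k)) * (x - 1) ^ (n - k)))"
    by (simp add: P_def coeff_mult coeff_one_linear_power)
  hence 1: "coeff P n = (\<Sum>k\<le>n. (of_nat N gchoose k) * (of_nat N gchoose (n - k)) * (1 + x) ^ k * (x - 1) ^ (n - k))"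
    by (simp add: binomial_gbinomial mult_ac)
  have "P = (- monom 1 2 + [:1, x:]\<^sup>2) ^ N"
    unfolding P_def power_mult_distrib[symmetric]
    by (rule arg_cong[where f = "\<lambda>p. p ^ N"]) (simp add: monom_altdef power2_eq_square algebra_simps)
  hence P: "P = (\<Sum>j\<le>N. of_nat (N choose j) * (- monom 1 2) ^ j * ([:1, x:]\<^sup>2) ^ (N - j))"
    unfolding binomial_ring .
  have "coeff P n = (\<Sum>j\<le>N. if 2 * j \<le> n then (-1) ^ j * (of_nat N gchoose j) *
      (2 * of_nat N - 2 * of_nat j gchoose (n - 2 * j)) * x ^ (n - 2 * j) else 0)"
    unfolding P coeff_sum
  proof (rule sum.cong[OF refl])
    fix j assume "j \<in> {..N}"
    hence j: "j \<le> N" by simp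
    have "of_nat (N choose j) * (- monom 1 2) ^ j * ([:1, x:]\<^sup>2) ^ (N - j)
        = monom ((-1) ^ j * of_nat (N choose j)) (2 * j) * [:1, x:] ^ (2 * (N - j))"
    proof -
      have "(- monom 1 2 :: complex poly) = monom (-1) 2" by (simp add: minus_monom)
      hence "(- monom 1 2 :: complex poly) ^ j = monom ((-1) ^ j) (2 * j)"
        by (simp add: monom_power mult.commute)
      moreover have "([:1, x:]\<^sup>2) ^ (N - j) = [:1, x:] ^ (2 * (N - j))" by (rule power_mult[symmetric])
      ultimately show ?thesis
        by (simp add: of_nat_poly smult_monom mult.commute)
    qed
    hence "coeff (of_nat (N choose j) * (- monom 1 2) ^ j * ([:1, x:]\<^sup>2) ^ (N - j)) n
        = (if n < 2 * j then 0 else (-1) ^ j * of_nat (N choose j) * (of_nat (2 * (N - j) choose (n - 2 * j)) * x ^ (n - 2 * j)))"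
      by (simp add: coeff_monom_mult coeff_one_linear_power)
    also have "of_nat (2 * (N - j) choose (n - 2 * j)) = (2 * complex_of_nat N - 2 * of_nat j gchoose (n - 2 * j))"
      using j by (simp add: binomial_gbinomial of_nat_diff right_diff_distrib)
    finally show "coeff (of_nat (N choose j) * (- monom 1 2) ^ j * ([:1, x:]\<^sup>2) ^ (N - j)) n
        = (if 2 * j \<le> n then (-1) ^ j * (of_nat N gchoose j) *
      (2 * of_nat N - 2 * of_nat j gchoose (n - 2 * j)) * x ^ (n - 2 * j) else 0)"
      by (simp add: binomial_gbinomial mult_ac)
  qed
  also have "\<dots> = (\<Sum>j\<le>n div 2. (-1) ^ j * (of_nat N gchoose j) *
      (2 * of_nat N - 2 * of_nat j gchoose (n - 2 * j)) * x ^ (n - 2 * j))"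
  proof -
    have "(of_nat N gchoose j) = (0 :: complex)" if "j > N" for j
      using that by (simp add: binomial_gbinomial[symmetric])
    thus ?thesis
      by (intro sum.mono_neutral_cong) auto
  qed
  finally show "(\<Sum>k\<le>n. (of_nat N gchoose k) * (of_nat N gchoose (n - k)) * (1 + x) ^ k * (x - 1) ^ (n - k))
    = (\<Sum>j\<le>n div 2. (-1) ^ j * (of_nat N gchoose j) *
      (2 * of_nat N - 2 * of_nat j gchoose (n - 2 * j)) * x ^ (n - 2 * j))"
    unfolding 1[symmetric] .
qed (intro polynomial_map_intros)+

text \<open>
  The Gegenbauer sum agrees term by term with the right hand side of \<open>gbinomial_convolution\<close> for \<open>\<alpha> = -s\<close>. The denominator cancels because
  \<open>(2 s)_(2 j) = 4^j (s)_j (s + 1/2)_j\<close>.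
\<close>

lemma gegenbauer_quot_generic:
  assumes nz: "pochhammer (1 / 2 + s) n \<noteq> 0"
  shows "pochhammer (2 * s) n / pochhammer (1 / 2 + s) n * gegenbauer n (1 / 2 - s - of_nat n) x
    = 2 ^ n * (\<Sum>k\<le>n. (- s gchoose k) * (- s gchoose (n - k)) * (1 + x) ^ k * (x - 1) ^ (n - k))"
  unfolding gegenbauer_def gbinomial_convolution sum_distrib_left
proof (rule sum.cong[OF refl])
  fix j assume "j \<in> {..n div 2}"
  hence j: "2 * j \<le> n" by auto
  define A where "A = pochhammer s j"
  define B where "B = pochhammer (2 * s + 2 * of_nat j) (n - 2 * j)"
  define C where "C = pochhammer (1 / 2 + s) j"
  define E where "E = pochhammer (1 / 2 + s + of_nat j) (n - j)"
  have "1 / 2 - s - of_nat n = - (s + of_nat n - 1 / 2)" by simp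
  hence "pochhammer (1 / 2 - s - of_nat n) (n - j) = (-1) ^ (n - j) * pochhammer (s + of_nat n - 1 / 2 - of_nat (n - j) + 1) (n - j)"
    by (simp only: pochhammer_minus)
  also have "s + of_nat n - 1 / 2 - of_nat (n - j) + 1 = 1 / 2 + s + of_nat j"
    using j by (simp add: of_nat_diff)
  finally have 1: "pochhammer (1 / 2 - s - of_nat n) (n - j) = (-1) ^ (n - j) * E" by (simp add: E_def)
  have 2: "pochhammer (1 / 2 + s) n = C * E"
    using pochhammer_product'[of "1 / 2 + s" j "n - j"] j by (simp add: C_def E_def)
  have "pochhammer (2 * s) n = pochhammer (2 * s) (2 * j) * B"
    using pochhammer_product'[of "2 * s" "2 * j" "n - 2 * j"] j by (simp add: B_def)
  also have "pochhammer (2 * s) (2 * j) = 4 ^ j * A * C"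
    using pochhammer_double[of s j] by (simp add: power_mult A_def C_def add.commute)
  finally have 3: "pochhammer (2 * s) n = 4 ^ j * A * C * B" .
  have 4: "(- s gchoose j) = (-1) ^ j * A / fact j"
    by (simp add: gbinomial_pochhammer A_def)
  have 5: "(2 * - s - 2 * of_nat j gchoose (n - 2 * j)) = (-1) ^ (n - 2 * j) * B / fact (n - 2 * j)"
  proof -
    have "- (2 * - s - 2 * of_nat j) = 2 * s + 2 * of_nat j" by simp
    thus ?thesis unfolding gbinomial_pochhammer B_def by (simp only:)
  qed
  have "even (n - 2 * j) \<longleftrightarrow> even n" using j by simp
  hence sign: "(-1) ^ (n - 2 * j) = ((-1) ^ n :: complex)" "(-1) ^ j * (-1) ^ (n - j) = ((-1) ^ n :: complex)"
    using j by (auto simp: minus_one_power_iff simp flip: power_add)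
  have two: "(4 :: complex) ^ j * 2 ^ (n - 2 * j) = 2 ^ n"
  proof -
    have "(4 :: complex) ^ j = 2 ^ (2 * j)" by (simp add: power_mult)
    thus ?thesis using j by (simp flip: power_add)
  qed
  have "C \<noteq> 0" "E \<noteq> 0" using nz 2 by auto
  hence "pochhammer (2 * s) n / pochhammer (1 / 2 + s) n
      * ((-1) ^ j * pochhammer (1 / 2 - s - of_nat n) (n - j) / (fact j * fact (n - 2 * j)) * (2 * x) ^ (n - 2 * j))
      = (4 ^ j * 2 ^ (n - 2 * j)) * ((-1) ^ j * (-1) ^ (n - j)) * (A * B / (fact j * fact (n - 2 * j)) * x ^ (n - 2 * j))"
    unfolding 1 2 3 power_mult_distrib by simp
  also have "\<dots> = 2 ^ n * (((-1) ^ j * (-1) ^ j) * (-1) ^ (n - 2 * j) * (A * B / (fact j * fact (n - 2 * j)) * x ^ (n - 2 * j)))"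
    unfolding sign two by (simp flip: power_mult_distrib)
  finally show "pochhammer (2 * s) n / pochhammer (1 / 2 + s) n
      * ((-1) ^ j * pochhammer (1 / 2 - s - of_nat n) (n - j) / (fact j * fact (n - 2 * j)) * (2 * x) ^ (n - 2 * j))
      = 2 ^ n * ((-1) ^ j * (- s gchoose j) * (2 * - s - 2 * of_nat j gchoose (n - 2 * j)) * x ^ (n - 2 * j))"
    unfolding 4 5 by simp
qed

text \<open>
  The right hand side is a polynomial in \<open>t\<close> that has the required values off a finite set, so it is the polynomial
  described in the definition, also at the removable singularities.
\<close>

lemma gegenbauer_quot_eq:
  "gegenbauer_quot n t x
    = 2 ^ n * (\<Sum>k\<le>n. (- t gchoose k) * (- t gchoose (n - k)) * (1 + x) ^ k * (x - 1) ^ (n - k))"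
proof -
  define F where "F s = 2 ^ n * (\<Sum>k\<le>n. (- s gchoose k) * (- s gchoose (n - k)) * (1 + x) ^ k * (x - 1) ^ (n - k))" for s
  have minus: "polynomial_map (\<lambda>s. - s)"
    using polynomial_map_diff[OF polynomial_map_const[of 0] polynomial_map_id] by simp
  have "polynomial_map F"
    unfolding F_def by (intro polynomial_map_intros minus)
  then obtain p where p: "\<And>s. F s = poly p s" unfolding polynomial_map_def by blast
  have gen: "pochhammer (2 * s) n / pochhammer (1 / 2 + s) n * gegenbauer n (1 / 2 - s - of_nat n) x = F s"
    if "pochhammer (1 / 2 + s) n \<noteq> 0" for s
    unfolding F_def by (rule gegenbauer_quot_generic[OF that])
  have "finite {s :: complex. pochhammer (1 / 2 + s) n = 0}"
  proof (rule finite_subset)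
    show "{s :: complex. pochhammer (1 / 2 + s) n = 0} \<subseteq> (\<lambda>k. - of_nat k - 1 / 2) ` {..<n}"
    proof
      fix s :: complex assume "s \<in> {s. pochhammer (1 / 2 + s) n = 0}"
      then obtain k where "k < n" "1 / 2 + s = - of_nat k" by (auto simp: pochhammer_eq_0_iff)
      moreover from this(2) have "s = - of_nat k - 1 / 2" by (simp add: algebra_simps)
      ultimately show "s \<in> (\<lambda>k. - of_nat k - 1 / 2) ` {..<n}" by auto
    qed
  qed simp
  hence inf: "infinite (- {s :: complex. pochhammer (1 / 2 + s) n = 0})"
    using infinite_UNIV_char_0 by (metis Diff_infinite_finite Compl_eq_Diff_UNIV)
  have "(THE p. \<forall>s. pochhammer (1 / 2 + s) n \<noteq> 0 \<longrightarrow>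
      poly p s = pochhammer (2 * s) n / pochhammer (1 / 2 + s) n * gegenbauer n (1 / 2 - s - of_nat n) x) = p"
  proof (rule the_equality)
    show "\<forall>s. pochhammer (1 / 2 + s) n \<noteq> 0 \<longrightarrow>
      poly p s = pochhammer (2 * s) n / pochhammer (1 / 2 + s) n * gegenbauer n (1 / 2 - s - of_nat n) x"
      using gen p by simp
    fix q assume q: "\<forall>s. pochhammer (1 / 2 + s) n \<noteq> 0 \<longrightarrow>
      poly q s = pochhammer (2 * s) n / pochhammer (1 / 2 + s) n * gegenbauer n (1 / 2 - s - of_nat n) x"
    have "- {s :: complex. pochhammer (1 / 2 + s) n = 0} \<subseteq> {s. poly q s = poly p s}"
      using q gen p by auto
    thus "q = p" using inf by (intro poly_eq_of_infinite) (metis finite_subset)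
  qed
  thus ?thesis unfolding gegenbauer_quot_def using p[of t] by (simp add: F_def)
qed

section \<open>The two expansions\<close>

text \<open>
  The coefficients of \<open>(1 - u^2)^\<nu>\<close>.
\<close>

definition even_binomial :: "complex \<Rightarrow> nat \<Rightarrow> complex" where
  "even_binomial \<nu> k = (if even k then (-1) ^ (k div 2) * (\<nu> gchoose (k div 2)) else 0)"

lemma sum_atMost_flip: "(\<Sum>i\<le>n. f (n - i)) = (\<Sum>i\<le>(n :: nat). f i :: complex)"
  using sum.atLeastAtMost_rev[of f 0 n] by (simp add: atLeast0AtMost)

text \<open>
  \<open>(1 - u)^\<nu> (1 + u)^\<nu> = (1 - u^2)^\<nu>\<close>, which is \<open>gbinomial_convolution\<close> at \<open>x = 0\<close>.
\<close>

lemma even_binomial_convolution: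
  "(\<Sum>i\<le>m. (\<nu> gchoose i) * (-1) ^ i * (\<nu> gchoose (m - i))) = even_binomial \<nu> m"
proof -
  have "(\<Sum>i\<le>m. (\<nu> gchoose i) * (-1) ^ i * (\<nu> gchoose (m - i)))
      = (\<Sum>k\<le>m. (\<nu> gchoose k) * (\<nu> gchoose (m - k)) * (1 + 0) ^ k * (0 - 1) ^ (m - k))"
    by (subst sum_atMost_flip[symmetric], intro sum.cong refl) simp
  also have "\<dots> = (\<Sum>j\<le>m div 2. (-1) ^ j * (\<nu> gchoose j) * (2 * \<nu> - 2 * of_nat j gchoose (m - 2 * j)) * 0 ^ (m - 2 * j))"
    by (rule gbinomial_convolution)
  also have "\<dots> = (\<Sum>j\<le>m div 2. if j = m div 2 then even_binomial \<nu> m else 0)"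
  proof (intro sum.cong refl)
    fix j assume "j \<in> {..m div 2}"
    hence "j \<le> m div 2" by simp
    hence "m - 2 * j = 0 \<longleftrightarrow> even m \<and> j = m div 2" by presburger
    thus "(-1) ^ j * (\<nu> gchoose j) * (2 * \<nu> - 2 * of_nat j gchoose (m - 2 * j)) * 0 ^ (m - 2 * j)
        = (if j = m div 2 then even_binomial \<nu> m else 0)"
      by (auto simp: even_binomial_def power_0_left)
  qed
  also have "\<dots> = even_binomial \<nu> m" by simp
  finally show ?thesis .
qed

text \<open>
  \<open>(1 - u)^(-\<nu>) (1 - u^2)^\<nu> = (1 + u)^\<nu>\<close>.
\<close>

lemma even_binomial_quotient:
  "(\<Sum>i\<le>m. (- \<nu> gchoose i) * (-1) ^ i * even_binomial \<nu> (m - i)) = (\<nu> gchoose m)"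
proof -
  define A where "A \<kappa> = Abs_fps (\<lambda>i. (-1) ^ i * (\<kappa> gchoose i) :: complex)" for \<kappa>
  have E: "A \<nu> * fps_binomial \<nu> = Abs_fps (even_binomial \<nu>)"
    by (rule fps_ext) (simp add: A_def fps_mult_nth atLeast0AtMost mult.commute[of "(-1) ^ _"] even_binomial_convolution)
  have "A (- \<nu>) * A \<nu> = 1"
  proof (rule fps_ext)
    fix n
    have "(A (- \<nu>) * A \<nu>) $ n = (\<Sum>i\<in>{0..n}. (-1) ^ n * ((- \<nu> gchoose i) * (\<nu> gchoose (n - i))))"
      unfolding fps_mult_nth A_def
    proof (intro sum.cong refl)
      fix i assume "i \<in> {0..n}"
      hence "(-1) ^ i * (-1) ^ (n - i) = ((-1) ^ n :: complex)" by (simp flip: power_add)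
      moreover have "(u * a) * (v * b) = (u * v) * (a * b)" for u v a b :: complex by simp
      ultimately show "Abs_fps (\<lambda>i. (-1) ^ i * (- \<nu> gchoose i)) $ i * Abs_fps (\<lambda>i. (-1) ^ i * (\<nu> gchoose i)) $ (n - i)
          = (-1) ^ n * ((- \<nu> gchoose i) * (\<nu> gchoose (n - i)))" by simp
    qed
    also have "\<dots> = (-1) ^ n * (- \<nu> + \<nu> gchoose n)"
      unfolding sum_distrib_left[symmetric] gbinomial_Vandermonde ..
    finally show "(A (- \<nu>) * A \<nu>) $ n = 1 $ n" by (simp add: gbinomial_0_left)
  qed
  hence "A (- \<nu>) * Abs_fps (even_binomial \<nu>) = fps_binomial \<nu>"
    unfolding E[symmetric] mult.assoc[symmetric] by simp
  hence "(A (- \<nu>) * Abs_fps (even_binomial \<nu>)) $ m = fps_binomial \<nu> $ m" by simp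
  thus ?thesis
    unfolding fps_mult_nth A_def by (simp add: atLeast0AtMost mult.commute[of "(-1) ^ _"])
qed

lemma even_binomial_norm_bound:
  "\<exists>K\<ge>0. \<exists>q. \<forall>k. norm (even_binomial \<nu> k) \<le> K * (1 + real k) powr q"
proof -
  obtain K where K: "K > 0" "\<And>n. norm (\<nu> gchoose n) \<le> K * (1 + real n) powr (- Re \<nu> - 1)"
    by (rule gbinomial_norm_bound[of \<nu>]) blast
  have "norm (even_binomial \<nu> k) \<le> K * (1 + real k) powr \<bar>- Re \<nu> - 1\<bar>" for k
  proof -
    have "norm (even_binomial \<nu> k) \<le> norm (\<nu> gchoose (k div 2))"
      by (simp add: even_binomial_def norm_mult norm_power)
    also have "\<dots> \<le> K * (1 + real (k div 2)) powr (- Re \<nu> - 1)" by (rule K)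
    also have "\<dots> \<le> K * (1 + real (k div 2)) powr \<bar>- Re \<nu> - 1\<bar>"
      using K(1) by (intro mult_left_mono powr_mono) auto
    also have "\<dots> \<le> K * (1 + real k) powr \<bar>- Re \<nu> - 1\<bar>"
      using K(1) by (intro mult_left_mono powr_mono2) auto
    finally show ?thesis .
  qed
  thus ?thesis using K(1) by (intro exI[of _ K] exI[of _ "\<bar>- Re \<nu> - 1\<bar>"]) auto
qed

lemma summable_weighted_geometric:
  fixes e :: "nat \<Rightarrow> complex" and w :: complex
  assumes e: "\<exists>K\<ge>0. \<exists>q. \<forall>k. norm (e k) \<le> K * (1 + real k) powr q" and w: "norm w < 1"
  shows "summable (\<lambda>k. norm (e k * w ^ k) * (1 + real k) powr p)"
proof -
  obtain K q where K: "K \<ge> 0" "\<And>k. norm (e k) \<le> K * (1 + real k) powr q" using e by blast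
  show ?thesis
  proof (rule summable_comparison_test')
    show "summable (\<lambda>k. K * ((1 + real k) powr (q + p) * norm w ^ k))"
      by (intro summable_mult summable_powr_geometric w) auto
    fix k
    have "norm (norm (e k * w ^ k) * (1 + real k) powr p) = norm (e k) * (norm w ^ k * (1 + real k) powr p)"
      by (simp add: norm_mult norm_power)
    also have "\<dots> \<le> (K * (1 + real k) powr q) * (norm w ^ k * (1 + real k) powr p)"
      by (intro mult_right_mono K) auto
    finally show "norm (norm (e k * w ^ k) * (1 + real k) powr p) \<le> K * ((1 + real k) powr (q + p) * norm w ^ k)"
      unfolding powr_add by (simp only: mult_ac)
  qed
qed

lemma gbinomial_norm_bound': "\<exists>K\<ge>0. \<exists>q. \<forall>k. norm (z gchoose k :: complex) \<le> K * (1 + real k) powr q"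
proof -
  obtain K where "K > 0" "\<And>n. norm (z gchoose n) \<le> K * (1 + real n) powr (- Re z - 1)"
    by (rule gbinomial_norm_bound[of z]) blast
  thus ?thesis by (intro exI[of _ K] exI[of _ "- Re z - 1"]) auto
qed

lemma even_binomial_suminf:
  "(\<Sum>k. even_binomial \<nu> k * w ^ k * h k) = (\<Sum>j. (-1) ^ j * (\<nu> gchoose j) * w ^ (2 * j) * h (2 * j))"
proof -
  have "(\<Sum>j. even_binomial \<nu> (2 * j) * w ^ (2 * j) * h (2 * j)) = (\<Sum>k. even_binomial \<nu> k * w ^ k * h k)"
  proof (rule suminf_mono_reindex)
    show "strict_mono (\<lambda>j :: nat. 2 * j)" by (simp add: strict_mono_def)
    fix k :: nat assume "k \<notin> range (\<lambda>j. 2 * j)"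
    hence "odd k" by (auto simp: dvd_def)
    thus "even_binomial \<nu> k * w ^ k * h k = 0" by (simp add: even_binomial_def)
  qed
  thus ?thesis by (simp add: even_binomial_def)
qed

text \<open>
  The integral of \<open>(1 - w^2 u^2)^\<nu>\<close> times the expansion of \<open>((1 + u) (1 - w u))^(-\<nu>)\<close> against the second weight is that of
  \<open>(1 + w u)^\<nu>\<close> against the first one.
\<close>

lemma first_moment_identity:
  assumes w: "norm w < 1"
  shows "(\<lambda>n. (\<Sum>i\<le>n. ((- \<nu> gchoose i) * (- w) ^ i) * (- \<nu> gchoose (n - i)))
           * (\<Sum>k. even_binomial \<nu> k * w ^ k * even_moment \<nu> a (n + k)))
         sums (\<Sum>m. (\<nu> gchoose m) * w ^ m * beta_moment \<nu> a m)"
proof -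
  define p where "p = \<bar>Re \<nu> + 1\<bar>"
  obtain B where B: "B \<ge> 0" "\<And>j m. norm ((- \<nu> gchoose j) * even_moment \<nu> a (j + m))
     \<le> B * (1 + real j) powr (- 2) * (1 + real m) powr p"
    using even_series_norm_bound[of \<nu> a] unfolding p_def by blast
  define Z where "Z = (\<Sum>j. (1 + real j) powr (- 2))"
  have Z: "summable (\<lambda>j. (1 + real j) powr (- 2))" by (rule summable_one_plus_powr) simp
  have Z1: "Z \<ge> 1"
    using sum_le_suminf[OF Z, of "{0}"] by (simp add: Z_def)
  define K where "K = B * Z"
  have W: "norm (\<Sum>j<J. (- \<nu> gchoose j) * even_moment \<nu> a (j + m)) \<le> K * (1 + real m) powr p" for J m
  proof -
    have "norm (\<Sum>j<J. (- \<nu> gchoose j) * even_moment \<nu> a (j + m))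
        \<le> (\<Sum>j<J. B * (1 + real j) powr (- 2) * (1 + real m) powr p)"
      by (rule sum_norm_le) (rule B)
    also have "\<dots> = B * (\<Sum>j<J. (1 + real j) powr (- 2)) * (1 + real m) powr p"
      by (simp add: sum_distrib_left sum_distrib_right)
    also have "\<dots> \<le> B * Z * (1 + real m) powr p"
      unfolding Z_def using B(1) Z by (intro mult_right_mono mult_left_mono sum_le_suminf) auto
    finally show ?thesis by (simp add: K_def)
  qed
  have h: "norm (even_moment \<nu> a m) \<le> K * (1 + real m) powr p" for m
  proof -
    have "norm (even_moment \<nu> a m) \<le> B * (1 + real m) powr p" using B(2)[of 0 m] by simp
    also have "\<dots> \<le> K * (1 + real m) powr p"
      unfolding K_def using B(1) Z1 by (intro mult_right_mono) (auto simp: mult_le_cancel_left1)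
    finally show ?thesis .
  qed
  have "\<exists>L. (\<lambda>n. (\<Sum>i\<le>n. ((- \<nu> gchoose i) * (- w) ^ i) * (- \<nu> gchoose (n - i)))
      * (\<Sum>k. (even_binomial \<nu> k * w ^ k) * even_moment \<nu> a (n + k))) sums L
      \<and> (\<lambda>m. (\<Sum>i\<le>m. ((- \<nu> gchoose i) * (- w) ^ i) * (even_binomial \<nu> (m - i) * w ^ (m - i))) * beta_moment \<nu> a m) sums L"
  proof (rule moment_series_rearrange[OF _ _ _ h W even_moment_binomial_sums])
    show "summable (\<lambda>i. norm ((- \<nu> gchoose i) * (- w) ^ i) * (1 + real i) powr p)"
      by (intro summable_weighted_geometric gbinomial_norm_bound') (simp add: w)
    show "summable (\<lambda>k. norm (even_binomial \<nu> k * w ^ k) * (1 + real k) powr p)"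
      by (intro summable_weighted_geometric even_binomial_norm_bound w)
  qed (simp add: p_def)
  moreover have "(\<Sum>i\<le>m. ((- \<nu> gchoose i) * (- w) ^ i) * (even_binomial \<nu> (m - i) * w ^ (m - i))) = (\<nu> gchoose m) * w ^ m" for m
  proof -
    have "(\<Sum>i\<le>m. ((- \<nu> gchoose i) * (- w) ^ i) * (even_binomial \<nu> (m - i) * w ^ (m - i)))
        = (\<Sum>i\<le>m. (- \<nu> gchoose i) * (-1) ^ i * even_binomial \<nu> (m - i)) * w ^ m"
      unfolding sum_distrib_right
    proof (intro sum.cong refl)
      fix i assume "i \<in> {..m}"
      hence "w ^ i * w ^ (m - i) = w ^ m" by (simp flip: power_add)
      thus "((- \<nu> gchoose i) * (- w) ^ i) * (even_binomial \<nu> (m - i) * w ^ (m - i))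
          = (- \<nu> gchoose i) * (-1) ^ i * even_binomial \<nu> (m - i) * w ^ m"
        unfolding power_minus[of w] by (metis (no_types, lifting) mult.assoc mult.left_commute)
    qed
    thus ?thesis by (simp only: even_binomial_quotient)
  qed
  ultimately show ?thesis by (auto simp: sums_iff)
qed

text \<open>
  The integral of \<open>(1 + w u)^\<nu>\<close> times the expansion of \<open>((1 + u) (1 - w u))^\<nu>\<close> against the first weight is that of
  \<open>(1 - w^2 u^2)^\<nu>\<close> against the second one. For \<open>a = -N\<close> all sums over \<open>j\<close> stop at \<open>N\<close>, and boundedness is trivial.
\<close>

lemma second_moment_identity:
  assumes w: "norm w < 1" and \<nu>: "Re \<nu> > - 1 \<or> a \<in> \<int>\<^sub>\<le>\<^sub>0"
  shows "(\<lambda>n. (\<Sum>i\<le>n. ((\<nu> gchoose i) * (- w) ^ i) * (\<nu> gchoose (n - i)))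
           * (\<Sum>k. (\<nu> gchoose k) * w ^ k * beta_moment \<nu> a (n + k)))
         sums (\<Sum>m. even_binomial \<nu> m * w ^ m * even_moment \<nu> a m)"
proof -
  obtain K where h: "\<And>m. norm (beta_moment \<nu> a m) \<le> K"
    and W: "\<And>J m. norm (\<Sum>j<J. (\<nu> gchoose j) * beta_moment \<nu> a (j + m)) \<le> K"
  proof (cases "Re \<nu> > - 1")
    case True
    obtain K1 where K1: "\<And>J m. norm (\<Sum>j<J. (\<nu> gchoose j) * beta_moment \<nu> a (j + m)) \<le> K1"
      using beta_series_summable_bounded(2)[OF True, of a] by blast
    have "norm (beta_moment \<nu> a m) \<le> K1" for m
      using K1[where J = "Suc 0" and m = m] by simp
    with K1 that show ?thesis by blast
  next
    case False
    then obtain N where N: "a = - of_nat N" using \<nu> by (auto elim: nonpos_Ints_cases')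
    define H where "H = (\<Sum>m\<le>N. norm (beta_moment \<nu> a m))"
    define K where "K = (1 + (\<Sum>j\<le>N. norm (\<nu> gchoose j))) * H"
    have H0: "H \<ge> 0" by (simp add: H_def sum_nonneg)
    have H: "norm (beta_moment \<nu> a m) \<le> H" for m
    proof (cases "m \<le> N")
      case True
      thus ?thesis unfolding H_def by (intro member_le_sum) auto
    next
      case False
      thus ?thesis using N beta_moment_nonpos_eq_0[of N m \<nu>] H0 by simp
    qed
    have "norm (beta_moment \<nu> a m) \<le> K" for m
      using order_trans[OF H] H0 by (simp add: K_def distrib_right sum_nonneg)
    moreover have "norm (\<Sum>j<J. (\<nu> gchoose j) * beta_moment \<nu> a (j + m)) \<le> K" for J m
    proof -
      have "beta_moment \<nu> a (j + m) = 0" if "\<not> j \<le> N" for j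
        using that N beta_moment_nonpos_eq_0[of N "j + m" \<nu>] by simp
      hence "(\<Sum>j<J. (\<nu> gchoose j) * beta_moment \<nu> a (j + m)) = (\<Sum>j\<in>{..<J} \<inter> {..N}. (\<nu> gchoose j) * beta_moment \<nu> a (j + m))"
        by (intro sum.mono_neutral_right) auto
      also have "norm \<dots> \<le> (\<Sum>j\<in>{..<J} \<inter> {..N}. norm (\<nu> gchoose j) * H)"
        by (rule sum_norm_le) (simp add: norm_mult mult_left_mono H)
      also have "\<dots> \<le> (\<Sum>j\<le>N. norm (\<nu> gchoose j) * H)"
        using H0 by (intro sum_mono2) auto
      also have "\<dots> \<le> K"
        using H0 by (simp add: K_def sum_distrib_right distrib_right)
      finally show ?thesis .
    qed
    ultimately show ?thesis using that by blast
  qed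
  have "\<exists>L. (\<lambda>n. (\<Sum>i\<le>n. ((\<nu> gchoose i) * (- w) ^ i) * (\<nu> gchoose (n - i)))
      * (\<Sum>k. ((\<nu> gchoose k) * w ^ k) * beta_moment \<nu> a (n + k))) sums L
      \<and> (\<lambda>m. (\<Sum>i\<le>m. ((\<nu> gchoose i) * (- w) ^ i) * ((\<nu> gchoose (m - i)) * w ^ (m - i))) * even_moment \<nu> a m) sums L"
  proof (rule moment_series_rearrange[where p = 0 and K = K])
    show "summable (\<lambda>i. norm ((\<nu> gchoose i) * (- w) ^ i) * (1 + real i) powr 0)"
      by (intro summable_weighted_geometric gbinomial_norm_bound') (simp add: w)
    show "summable (\<lambda>k. norm ((\<nu> gchoose k) * w ^ k) * (1 + real k) powr 0)"
      by (intro summable_weighted_geometric gbinomial_norm_bound' w)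
    show "(\<lambda>j. (\<nu> gchoose j) * beta_moment \<nu> a (j + m)) sums even_moment \<nu> a m" for m
      by (rule beta_moment_binomial_sums[OF \<nu>])
  qed (use h W in auto)
  moreover have "(\<Sum>i\<le>m. ((\<nu> gchoose i) * (- w) ^ i) * ((\<nu> gchoose (m - i)) * w ^ (m - i))) = even_binomial \<nu> m * w ^ m" for m
  proof -
    have "(\<Sum>i\<le>m. ((\<nu> gchoose i) * (- w) ^ i) * ((\<nu> gchoose (m - i)) * w ^ (m - i)))
        = (\<Sum>i\<le>m. (\<nu> gchoose i) * (-1) ^ i * (\<nu> gchoose (m - i))) * w ^ m"
      unfolding sum_distrib_right
    proof (intro sum.cong refl)
      fix i assume "i \<in> {..m}"
      hence "w ^ i * w ^ (m - i) = w ^ m" by (simp flip: power_add)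
      thus "((\<nu> gchoose i) * (- w) ^ i) * ((\<nu> gchoose (m - i)) * w ^ (m - i))
          = (\<nu> gchoose i) * (-1) ^ i * (\<nu> gchoose (m - i)) * w ^ m"
        unfolding power_minus[of w] by (metis (no_types, lifting) mult.assoc mult.left_commute)
    qed
    thus ?thesis by (simp only: even_binomial_convolution)
  qed
  ultimately show ?thesis by (auto simp: sums_iff)
qed

lemma gegenbauer_quot_convolution:
  fixes x :: real
  assumes x: "x > 0"
  defines "w \<equiv> complex_of_real ((1 - x) / (1 + x))"
  shows "gegenbauer_quot n t (of_real x)
    = of_real (2 * (1 + x)) ^ n * (\<Sum>i\<le>n. ((- t gchoose i) * (- w) ^ i) * (- t gchoose (n - i)))"
proof -
  define X where "X = complex_of_real x"
  have nz: "1 + X \<noteq> 0" using x by (simp add: X_def complex_eq_iff)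
  have w: "- w * (1 + X) = X - 1" using nz by (simp add: w_def X_def)
  have "(\<Sum>k\<le>n. (- t gchoose k) * (- t gchoose (n - k)) * (1 + X) ^ k * (X - 1) ^ (n - k))
      = (\<Sum>i\<le>n. (- t gchoose (n - i)) * (- t gchoose i) * (1 + X) ^ (n - i) * (X - 1) ^ i)"
    by (subst sum_atMost_flip[symmetric], intro sum.cong refl) simp
  also have "\<dots> = (\<Sum>i\<le>n. (1 + X) ^ n * (((- t gchoose i) * (- w) ^ i) * (- t gchoose (n - i))))"
  proof (intro sum.cong refl)
    fix i assume "i \<in> {..n}"
    hence pow: "(1 + X) ^ (n - i) * (1 + X) ^ i = (1 + X) ^ n" by (simp flip: power_add)
    have base: "(X - 1) ^ i = (- w) ^ i * (1 + X) ^ i"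
      unfolding w[symmetric] by (rule power_mult_distrib)
    show "(- t gchoose (n - i)) * (- t gchoose i) * (1 + X) ^ (n - i) * (X - 1) ^ i
        = (1 + X) ^ n * (((- t gchoose i) * (- w) ^ i) * (- t gchoose (n - i)))"
      unfolding pow[symmetric] base by (simp only: mult_ac)
  qed
  also have "\<dots> = (1 + X) ^ n * (\<Sum>i\<le>n. ((- t gchoose i) * (- w) ^ i) * (- t gchoose (n - i)))"
    by (rule sum_distrib_left[symmetric])
  finally have "gegenbauer_quot n t X = 2 ^ n * ((1 + X) ^ n * (\<Sum>i\<le>n. ((- t gchoose i) * (- w) ^ i) * (- t gchoose (n - i))))"
    unfolding gegenbauer_quot_eq by (rule arg_cong)
  moreover have "of_real (2 * (1 + x)) = 2 * (1 + X)" by (simp add: X_def)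
  ultimately show ?thesis unfolding X_def[symmetric] by (simp only: power_mult_distrib mult.assoc)
qed

lemma of_real_powr_exp:
  fixes r :: real
  assumes "r > 0"
  shows "complex_of_real r powr s = exp (s * of_real (ln r))"
  using assms by (simp add: powr_def Ln_of_real)

text \<open>
  At \<open>y = (1 + x^2) / (2 x)\<close> the parameter \<open>(1 - y) / (1 + y)\<close> is \<open>-w^2\<close>, so only even powers of \<open>w\<close> occur. The factors \<open>(a)_n\<close> and
  \<open>1 / \<Gamma>((a + n + 1) / 2)\<close> of the expansion are those that turn
  \<open>(A / 2)_k / \<Gamma>(1 + \<nu> + A / 2 + k)\<close>, for \<open>A = a + n\<close>, into a moment of the second weight of order \<open>n + 2 k\<close>.
\<close>

lemma legendre_P_even:
  fixes x :: real
  assumes x: "0 < x" "x < 1"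
  defines "w \<equiv> (1 - x) / (1 + x)"
  shows "of_real (sqrt pi) * pochhammer a n * rGamma ((a + of_nat n + 1) / 2)
      * legendre_P \<nu> (- ((a + of_nat n) / 2 + \<nu>)) ((1 + x\<^sup>2) / (2 * x))
    = 2 powr (a + of_nat n) * of_real w powr ((a + of_nat n) / 2 + \<nu>)
      * of_real ((1 + x)\<^sup>2 / (4 * x)) powr \<nu>
      * (\<Sum>k. even_binomial \<nu> k * of_real w ^ k * even_moment \<nu> a (n + k))"
proof -
  define y where "y = (1 + x\<^sup>2) / (2 * x)"
  define A where "A = a + of_nat n"
  define \<kappa> where "\<kappa> = A / 2 + \<nu>"
  have w: "w > 0" using x by (simp add: w_def)
  have y: "y > 0" using x by (simp add: y_def add_pos_nonneg)
  have y1: "(1 + y) / 2 = (1 + x)\<^sup>2 / (4 * x)"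
    using x by (simp add: y_def field_simps power2_eq_square)
  have "1 + y = (1 + x)\<^sup>2 / (2 * x)" "1 - y = - ((1 - x)\<^sup>2 / (2 * x))"
    using x by (simp_all add: y_def field_simps power2_eq_square)
  hence wy: "(1 - y) / (1 + y) = - w\<^sup>2"
    using x by (simp add: w_def power_divide)
  have "of_real \<bar>- w\<^sup>2\<bar> powr (\<kappa> / 2) = of_real w powr \<kappa>"
    using w by (simp add: of_real_powr_exp ln_realpow del: of_real_power)
  hence 1: "legendre_P \<nu> (- \<kappa>) y = of_real w powr \<kappa> * of_real ((1 + x)\<^sup>2 / (4 * x)) powr \<nu>
      * (\<Sum>k. (\<nu> gchoose k) * of_real (- w\<^sup>2) ^ k * beta_moment \<nu> (\<kappa> - \<nu>) k)"
    using legendre_P_beta[OF y, of \<nu> \<kappa>] unfolding wy y1 by simp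
  have 2: "of_real (sqrt pi) * pochhammer a n * rGamma ((A + 1) / 2)
      * (\<Sum>k. (\<nu> gchoose k) * of_real (- w\<^sup>2) ^ k * beta_moment \<nu> (\<kappa> - \<nu>) k)
    = 2 powr A * (\<Sum>k. even_binomial \<nu> k * of_real w ^ k * even_moment \<nu> a (n + k))"
  proof -
    have w2: "norm (complex_of_real (- w\<^sup>2)) < 1"
    proof -
      have "w < 1" using x by (simp add: w_def)
      hence "w\<^sup>2 < 1" using w by (simp add: abs_square_less_1)
      thus ?thesis unfolding norm_of_real by simp
    qed
    have summand: "of_real (sqrt pi) * pochhammer a n * rGamma ((A + 1) / 2) * ((\<nu> gchoose k) * of_real (- w\<^sup>2) ^ k * beta_moment \<nu> (\<kappa> - \<nu>) k)
        = 2 powr A * ((-1) ^ k * (\<nu> gchoose k) * of_real w ^ (2 * k) * even_moment \<nu> a (n + 2 * k))" for k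
    proof -
      have "even_moment \<nu> a (n + 2 * k) = pochhammer a n * (of_real (sqrt pi) * 2 powr (- A) * rGamma ((A + 1) / 2)
          * (pochhammer (A / 2) k * rGamma (1 + \<nu> + A / 2 + of_nat k)))"
        unfolding even_moment_add even_moment_even A_def ..
      also have "pochhammer (A / 2) k * rGamma (1 + \<nu> + A / 2 + of_nat k) = beta_moment \<nu> (\<kappa> - \<nu>) k"
        by (simp add: beta_moment_def \<kappa>_def add_ac)
      finally have em: "even_moment \<nu> a (n + 2 * k) = pochhammer a n * (of_real (sqrt pi) * 2 powr (- A)
          * rGamma ((A + 1) / 2) * beta_moment \<nu> (\<kappa> - \<nu>) k)" .
      have one: "2 powr A * 2 powr (- A) = (1 :: complex)" by (simp add: powr_minus)
      have sq: "complex_of_real (- w\<^sup>2) ^ k = (-1) ^ k * of_real w ^ (2 * k)"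
        unfolding of_real_minus of_real_power power_mult by (rule power_minus)
      have "S * P * R * (b * (s * W) * M) = T * (s * b * W * (P * (S * T' * R * M)))"
        if "T * T' = 1" for S P R b s W M T T' :: complex
        using that by algebra
      from this[OF one] show ?thesis unfolding em sq .
    qed
    have sm: "summable (\<lambda>k. (\<nu> gchoose k) * of_real (- w\<^sup>2) ^ k * beta_moment \<nu> (\<kappa> - \<nu>) k)"
    proof -
      have "summable (\<lambda>k. pochhammer (- \<nu>) k * pochhammer (\<kappa> - \<nu>) k * rGamma (1 + \<kappa> + of_nat k) / fact k * of_real (w\<^sup>2) ^ k)"
        using hypergeo_reg_series_sums[of "of_real (w\<^sup>2)"] w2 by (auto simp: sums_iff norm_power)
      moreover have "pochhammer (- \<nu>) k * pochhammer (\<kappa> - \<nu>) k * rGamma (1 + \<kappa> + of_nat k) / fact k * of_real (w\<^sup>2) ^ k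
          = (\<nu> gchoose k) * of_real (- w\<^sup>2) ^ k * beta_moment \<nu> (\<kappa> - \<nu>) k" for k
        unfolding gbinomial_pochhammer of_real_minus power_minus[of "of_real (w\<^sup>2)"] beta_moment_def
        by (simp add: add_ac)
      ultimately show ?thesis by simp
    qed
    show ?thesis
      unfolding even_binomial_suminf[of \<nu> "of_real w" "\<lambda>k. even_moment \<nu> a (n + k)"] suminf_mult[OF sm, symmetric] summand
    proof (rule suminf_mult)
      have one: "2 powr (- A) * 2 powr A = (1 :: complex)" by (simp add: powr_minus)
      have "summable (\<lambda>k. 2 powr (- A) * (of_real (sqrt pi) * pochhammer a n * rGamma ((A + 1) / 2)
          * ((\<nu> gchoose k) * of_real (- w\<^sup>2) ^ k * beta_moment \<nu> (\<kappa> - \<nu>) k)))"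
        by (intro summable_mult sm)
      thus "summable (\<lambda>k. (-1) ^ k * (\<nu> gchoose k) * of_real w ^ (2 * k) * even_moment \<nu> a (n + 2 * k))"
        unfolding summand mult.assoc[symmetric, of "2 powr (- A)"] one mult_1_left .
    qed
  qed
  have "z * (u * v * s) = p * u * v * t" if "z * s = p * t" for z u v s p t :: complex
    using that by (simp add: mult_ac)
  from this[OF 2] show ?thesis
    unfolding A_def[symmetric] \<kappa>_def[symmetric] y_def[symmetric] 1 .
qed

lemma legendre_P_ferrers:
  fixes x :: real
  assumes x: "0 < x" "x < 1"
  defines "w \<equiv> (1 - x) / (1 + x)"
  shows "pochhammer a n * legendre_P \<nu> (- (a + \<nu>) - of_nat n) x
    = of_real w powr ((a + \<nu> + of_nat n) / 2) * of_real ((1 + x) / 2) powr \<nu>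
      * (\<Sum>k. (\<nu> gchoose k) * of_real w ^ k * beta_moment \<nu> a (n + k))"
proof -
  have w: "w > 0" "w < 1" using x by (simp_all add: w_def)
  have sm: "summable (\<lambda>k. (\<nu> gchoose k) * of_real w ^ k * beta_moment \<nu> (a + of_nat n) k)"
  proof -
    have "norm (complex_of_real (- w)) < 1" using w by simp
    from hypergeo_reg_series_sums[OF this, of "- \<nu>" "a + of_nat n" "a + of_nat n + 1 + \<nu>"]
    have "summable (\<lambda>k. pochhammer (- \<nu>) k * pochhammer (a + of_nat n) k * rGamma (a + of_nat n + 1 + \<nu> + of_nat k) / fact k * of_real (- w) ^ k)"
      by (simp add: sums_iff)
    moreover have "pochhammer (- \<nu>) k * pochhammer (a + of_nat n) k * rGamma (a + of_nat n + 1 + \<nu> + of_nat k) / fact k * of_real (- w) ^ k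
        = (\<nu> gchoose k) * of_real w ^ k * beta_moment \<nu> (a + of_nat n) k" for k
      unfolding gbinomial_pochhammer of_real_minus power_minus[of "of_real w"] beta_moment_def by simp
    ultimately show ?thesis by simp
  qed
  have \<kappa>: "- (a + \<nu>) - of_nat n = - (a + \<nu> + of_nat n)" "a + \<nu> + of_nat n - \<nu> = a + of_nat n" by simp_all
  have 1: "legendre_P \<nu> (- (a + \<nu>) - of_nat n) x = of_real w powr ((a + \<nu> + of_nat n) / 2) * of_real ((1 + x) / 2) powr \<nu>
      * (\<Sum>k. (\<nu> gchoose k) * of_real w ^ k * beta_moment \<nu> (a + of_nat n) k)"
    using legendre_P_beta[OF x(1), of \<nu> "a + \<nu> + of_nat n"] w unfolding \<kappa> w_def[symmetric] by simp
  have 2: "pochhammer a n * (\<Sum>k. (\<nu> gchoose k) * of_real w ^ k * beta_moment \<nu> (a + of_nat n) k)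
      = (\<Sum>k. (\<nu> gchoose k) * of_real w ^ k * beta_moment \<nu> a (n + k))"
    unfolding suminf_mult[OF sm, symmetric] beta_moment_add by (simp only: mult_ac)
  show ?thesis
    unfolding 1 2[symmetric] by (simp only: mult_ac)
qed

theorem theorem19:
  fixes \<mu> \<nu> :: complex and x :: real
  assumes "0 < x" and "x < 1"
  shows "(\<lambda>n. of_real (sqrt pi) / 2 powr (\<mu> - 2 * \<nu>)
              * (gegenbauer_quot n \<nu> (of_real x) * pochhammer (\<mu> - \<nu>) n
                 * legendre_P \<nu> (- ((of_nat n + \<mu> + \<nu>) / 2)) ((1 + x\<^sup>2) / (2 * x))
                 * rGamma ((\<mu> - \<nu> + of_nat n + 1) / 2)
                 / (2 ^ (2 * n) * of_real x powr (- \<nu>)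
                    * of_real (1 - x\<^sup>2) powr ((of_nat n + \<nu>) / 2))))
           sums legendre_P \<nu> (- \<mu>) x
         \<and> (Re \<nu> > -1 \<or> \<mu> - \<nu> \<in> \<int>\<^sub>\<le>\<^sub>0 \<longrightarrow>
         (\<lambda>n. gegenbauer_quot n (- \<nu>) (of_real x) * pochhammer (\<mu> - \<nu>) n / 2 ^ n
              / of_real (1 - x\<^sup>2) powr ((of_nat n - \<nu>) / 2)
              * legendre_P \<nu> (- \<mu> - of_nat n) x)
           sums (of_real (sqrt pi) * legendre_P \<nu> (- ((\<mu> + \<nu>) / 2)) ((1 + x\<^sup>2) / (2 * x))
                 * rGamma ((\<mu> - \<nu> + 1) / 2)
                 / (2 powr (\<mu> - 2 * \<nu>) * of_real x powr (- \<nu>))))"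
proof -
  define a where "a = \<mu> - \<nu>"
  have \<mu>: "\<mu> = a + \<nu>" by (simp add: a_def)
  define w where "w = (1 - x) / (1 + x)"
  have w: "w > 0" "w < 1" using assms by (simp_all add: w_def)
  have nw: "norm (complex_of_real w) < 1" using w by simp
  \<comment> \<open>All powers have positive base. Written as exponentials of multiples of these logarithms, the elementary factors combine by adding exponents.\<close>
  define A B C D where "A = complex_of_real (ln w)" and "B = complex_of_real (ln (1 + x))"
    and "C = complex_of_real (ln x)" and "D = complex_of_real (ln 2)"
  have ln_z: "complex_of_real (ln (1 - x\<^sup>2)) = A + 2 * B"
  proof -
    have "1 - x\<^sup>2 = w * (1 + x)\<^sup>2"
      using assms by (simp add: w_def power2_eq_square field_simps)
    thus ?thesis using assms w by (simp add: ln_mult ln_realpow A_def B_def)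
  qed
  have ln_h: "complex_of_real (ln ((1 + x) / 2)) = B - D"
    using assms by (simp add: ln_div B_def D_def)
  have ln_y: "complex_of_real (ln ((1 + x)\<^sup>2 / (4 * x))) = 2 * B - 2 * D - C"
  proof -
    have "ln ((1 + x)\<^sup>2 / (4 * x)) = 2 * ln (1 + x) - (ln (2\<^sup>2) + ln x)"
      using assms by (simp add: ln_div ln_mult ln_realpow)
    also have "ln (2\<^sup>2 :: real) = 2 * ln 2" by (subst ln_realpow) simp_all
    finally show ?thesis by (simp add: B_def C_def D_def)
  qed
  have z: "1 - x\<^sup>2 > 0" using assms by (simp add: power_less_one_iff abs_square_less_1)
  have pw: "of_real w powr s = exp (s * A)" "of_real x powr s = exp (s * C)"
    "of_real (1 - x\<^sup>2) powr s = exp (s * (A + 2 * B))"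
    "of_real ((1 + x) / 2) powr s = exp (s * (B - D))"
    "of_real ((1 + x)\<^sup>2 / (4 * x)) powr s = exp (s * (2 * B - 2 * D - C))"
    "2 powr s = exp (s * D)" for s
    using assms w z of_real_powr_exp[of w s] of_real_powr_exp[of x s] of_real_powr_exp[of "1 - x\<^sup>2" s]
      of_real_powr_exp[of "(1 + x) / 2" s] of_real_powr_exp[of "(1 + x)\<^sup>2 / (4 * x)" s] of_real_powr_exp[of 2 s]
    unfolding ln_z ln_h ln_y A_def C_def D_def by simp_all
  have eD: "exp D = 2" unfolding D_def by (subst exp_of_real) simp
  have eB: "exp B = of_real (1 + x)" unfolding B_def using assms by (subst exp_of_real) simp
  have p2: "2 ^ n = exp (of_nat n * D)" for n unfolding exp_of_nat_mult eD ..
  have pB: "of_real (2 * (1 + x)) ^ n = exp (of_nat n * (D + B))" for n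
    unfolding exp_of_nat_mult exp_add eD eB by simp
  define Q :: "complex \<Rightarrow> nat \<Rightarrow> complex" where "Q t n = (\<Sum>i\<le>n. ((- t gchoose i) * (- of_real w) ^ i) * (- t gchoose (n - i)))" for t n
  have quot: "gegenbauer_quot n t (of_real x) = exp (of_nat n * (D + B)) * Q t n" for t n
    using gegenbauer_quot_convolution[OF assms(1), of n t] unfolding pB Q_def w_def .
  define E where "E n = (\<Sum>k. even_binomial \<nu> k * of_real w ^ k * even_moment \<nu> a (n + k))" for n
  define F where "F n = (\<Sum>k. (\<nu> gchoose k) * of_real w ^ k * beta_moment \<nu> a (n + k))" for n
  have PE: "of_real (sqrt pi) * pochhammer a n * rGamma ((a + of_nat n + 1) / 2)
      * legendre_P \<nu> (- ((of_nat n + \<mu> + \<nu>) / 2)) ((1 + x\<^sup>2) / (2 * x))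
    = exp ((a + of_nat n) * D + ((a + of_nat n) / 2 + \<nu>) * A + \<nu> * (2 * B - 2 * D - C)) * E n" for n
  proof -
    have idx: "(of_nat n + \<mu> + \<nu>) / 2 = (a + of_nat n) / 2 + \<nu>" by (simp add: \<mu> field_simps)
    show ?thesis
      using legendre_P_even[OF assms, of a n \<nu>, folded w_def]
      unfolding idx pw E_def[symmetric] exp_add .
  qed
  have PF: "pochhammer a n * legendre_P \<nu> (- \<mu> - of_nat n) x
    = exp ((a + \<nu> + of_nat n) / 2 * A + \<nu> * (B - D)) * F n" for n
    using legendre_P_ferrers[OF assms, of a n \<nu>] unfolding w_def[symmetric] pw F_def[symmetric] exp_add \<mu> .
  define c where "c = exp (\<mu> / 2 * A + \<nu> * (B - D))"
  have first: "of_real (sqrt pi) / 2 powr (\<mu> - 2 * \<nu>)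
              * (gegenbauer_quot n \<nu> (of_real x) * pochhammer (\<mu> - \<nu>) n
                 * legendre_P \<nu> (- ((of_nat n + \<mu> + \<nu>) / 2)) ((1 + x\<^sup>2) / (2 * x))
                 * rGamma ((\<mu> - \<nu> + of_nat n + 1) / 2)
                 / (2 ^ (2 * n) * of_real x powr (- \<nu>)
                    * of_real (1 - x\<^sup>2) powr ((of_nat n + \<nu>) / 2))) = c * (Q \<nu> n * E n)" for n
  proof -
    define P where "P = legendre_P \<nu> (- ((of_nat n + \<mu> + \<nu>) / 2)) ((1 + x\<^sup>2) / (2 * x))"
    have "of_real (sqrt pi) / 2 powr (\<mu> - 2 * \<nu>)
              * (gegenbauer_quot n \<nu> (of_real x) * pochhammer a n * P
                 * rGamma ((a + of_nat n + 1) / 2)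
                 / (2 ^ (2 * n) * of_real x powr (- \<nu>)
                    * of_real (1 - x\<^sup>2) powr ((of_nat n + \<nu>) / 2)))
      = (of_real (sqrt pi) * pochhammer a n * rGamma ((a + of_nat n + 1) / 2) * P) * (exp (of_nat n * (D + B)) * Q \<nu> n)
        / (exp ((\<mu> - 2 * \<nu>) * D) * exp (of_nat (2 * n) * D) * exp (- \<nu> * C) * exp ((of_nat n + \<nu>) / 2 * (A + 2 * B)))"
      unfolding quot pw p2 by (simp add: field_simps)
    also have "\<dots> = (exp ((a + of_nat n) * D + ((a + of_nat n) / 2 + \<nu>) * A + \<nu> * (2 * B - 2 * D - C)) * exp (of_nat n * (D + B))
        / (exp ((\<mu> - 2 * \<nu>) * D) * exp (of_nat (2 * n) * D) * exp (- \<nu> * C) * exp ((of_nat n + \<nu>) / 2 * (A + 2 * B))))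
        * (Q \<nu> n * E n)"
      unfolding P_def PE by simp
    also have "exp ((a + of_nat n) * D + ((a + of_nat n) / 2 + \<nu>) * A + \<nu> * (2 * B - 2 * D - C)) * exp (of_nat n * (D + B))
        / (exp ((\<mu> - 2 * \<nu>) * D) * exp (of_nat (2 * n) * D) * exp (- \<nu> * C) * exp ((of_nat n + \<nu>) / 2 * (A + 2 * B))) = c"
      unfolding c_def exp_add[symmetric] exp_diff[symmetric] \<mu>
      by (rule arg_cong[where f = exp]) (simp add: field_simps)
    finally show ?thesis unfolding P_def a_def .
  qed
  have second: "gegenbauer_quot n (- \<nu>) (of_real x) * pochhammer (\<mu> - \<nu>) n / 2 ^ n
              / of_real (1 - x\<^sup>2) powr ((of_nat n - \<nu>) / 2)
              * legendre_P \<nu> (- \<mu> - of_nat n) x = exp (\<nu> * B) * (c * (Q (- \<nu>) n * F n)) * exp (\<nu> / 2 * A)" for n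
  proof -
    define P where "P = legendre_P \<nu> (- \<mu> - of_nat n) x"
    have "gegenbauer_quot n (- \<nu>) (of_real x) * pochhammer a n / 2 ^ n
              / of_real (1 - x\<^sup>2) powr ((of_nat n - \<nu>) / 2) * P
      = (pochhammer a n * P) * (exp (of_nat n * (D + B)) * Q (- \<nu>) n)
         / (exp (of_nat n * D) * exp ((of_nat n - \<nu>) / 2 * (A + 2 * B)))"
      unfolding quot pw p2 by (simp add: field_simps)
    also have "\<dots> = (exp ((a + \<nu> + of_nat n) / 2 * A + \<nu> * (B - D)) * exp (of_nat n * (D + B))
         / (exp (of_nat n * D) * exp ((of_nat n - \<nu>) / 2 * (A + 2 * B)))) * (Q (- \<nu>) n * F n)"
      unfolding P_def PF by simp
    also have "exp ((a + \<nu> + of_nat n) / 2 * A + \<nu> * (B - D)) * exp (of_nat n * (D + B))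
         / (exp (of_nat n * D) * exp ((of_nat n - \<nu>) / 2 * (A + 2 * B))) = exp (\<nu> * B) * c * exp (\<nu> / 2 * A)"
      unfolding c_def exp_add[symmetric] exp_diff[symmetric] \<mu>
      by (rule arg_cong[where f = exp]) (simp add: field_simps)
    finally show ?thesis unfolding P_def a_def by (simp only: mult_ac)
  qed
  have "(\<lambda>n. c * (Q \<nu> n * E n)) sums (c * F 0)"
    using first_moment_identity[OF nw, of \<nu> a] unfolding Q_def E_def F_def by (intro sums_mult) simp
  moreover have "c * F 0 = legendre_P \<nu> (- \<mu>) x"
    using PF[of 0] by (simp add: c_def \<mu>)
  ultimately have one: "(\<lambda>n. c * (Q \<nu> n * E n)) sums legendre_P \<nu> (- \<mu>) x" by simp
  have two: "(\<lambda>n. exp (\<nu> * B) * (c * (Q (- \<nu>) n * F n)) * exp (\<nu> / 2 * A))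
      sums (of_real (sqrt pi) * legendre_P \<nu> (- ((\<mu> + \<nu>) / 2)) ((1 + x\<^sup>2) / (2 * x))
                 * rGamma ((\<mu> - \<nu> + 1) / 2) / (2 powr (\<mu> - 2 * \<nu>) * of_real x powr (- \<nu>)))"
    if "Re \<nu> > - 1 \<or> a \<in> \<int>\<^sub>\<le>\<^sub>0"
  proof -
    have "(\<lambda>n. exp (\<nu> * B) * (c * (Q (- \<nu>) n * F n)) * exp (\<nu> / 2 * A)) sums (exp (\<nu> * B) * (c * E 0) * exp (\<nu> / 2 * A))"
      using second_moment_identity[OF nw that] unfolding Q_def E_def F_def by (intro sums_mult sums_mult2) simp
    moreover have "of_real (sqrt pi) * legendre_P \<nu> (- ((\<mu> + \<nu>) / 2)) ((1 + x\<^sup>2) / (2 * x))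
                 * rGamma ((\<mu> - \<nu> + 1) / 2) / (2 powr (\<mu> - 2 * \<nu>) * of_real x powr (- \<nu>))
        = exp (\<nu> * B) * (c * E 0) * exp (\<nu> / 2 * A)"
    proof -
      have "of_real (sqrt pi) * legendre_P \<nu> (- ((\<mu> + \<nu>) / 2)) ((1 + x\<^sup>2) / (2 * x)) * rGamma ((a + 1) / 2)
          = exp (a * D + (a / 2 + \<nu>) * A + \<nu> * (2 * B - 2 * D - C)) * E 0"
        using PE[of 0] by (simp add: mult_ac)
      hence "of_real (sqrt pi) * legendre_P \<nu> (- ((\<mu> + \<nu>) / 2)) ((1 + x\<^sup>2) / (2 * x))
                 * rGamma ((\<mu> - \<nu> + 1) / 2) / (2 powr (\<mu> - 2 * \<nu>) * of_real x powr (- \<nu>))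
          = (exp (a * D + (a / 2 + \<nu>) * A + \<nu> * (2 * B - 2 * D - C)) / (exp ((\<mu> - 2 * \<nu>) * D) * exp (- \<nu> * C))) * E 0"
        unfolding pw a_def by simp
      also have "exp (a * D + (a / 2 + \<nu>) * A + \<nu> * (2 * B - 2 * D - C)) / (exp ((\<mu> - 2 * \<nu>) * D) * exp (- \<nu> * C))
          = exp (\<nu> * B) * c * exp (\<nu> / 2 * A)"
        unfolding c_def exp_add[symmetric] exp_diff[symmetric] \<mu>
        by (rule arg_cong[where f = exp]) (simp add: field_simps)
      finally show ?thesis by (simp only: mult_ac)
    qed
    ultimately show ?thesis by simp
  qed
  show ?thesis
    unfolding first second using one two unfolding a_def by blast
qed

end
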